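(* Let $\rho=\frac{1+\mathrm{i}\sqrt3}{2}$ and let $\mathbb{Z}[\rho]\subset\mathbb{C}\cong\mathbb{R}^2$ be the hexagonal lattice (Eisenstein integers, standard inner product). Let $a_\triangle(n)$ be the number of well-rounded sublattices of $\mathbb{Z}[\rho]$ of index $n$ and $\Phi_{\triangle,\mathsf{wr}}(s)=\sum_{n\ge1}a_\triangle(n)n^{-s}$. Put $\Phi_\triangle(s)=L(s,\chi_{-3})\zeta(s)$, $\Phi^{\mathsf{pr}}_\triangle(s)=L(s,\chi_{-3})\zeta(s)/\zeta(2s)$, $$\Phi_{\triangle,\mathsf{wr},\mathrm{even}}(s)=\frac{3}{4^s(1+3^{-s})}\sum_{p\in\mathbb{N}}\ \sum_{q\in\mathbb{N},\ p<q<3p}\frac1{p^sq^s}\,\Phi^{\mathsf{pr}}_\triangle(s),$$ $$\Phi_{\triangle,\mathsf{wr},\mathrm{odd}}(s)=\frac{3}{1+3^{-s}}\sum_{k\in\mathbb{N}}\ \sum_{\ell\in\mathbb{N},\ k<\ell<3k+1}\frac{1}{(2k+1)^s(2\ell+1)^s}\,\Phi^{\mathsf{pr}}_\triangle(s).$$ Then $\Phi_{\triangle,\mathsf{wr}}(s)=\Phi_\triangle(s)+\Phi_{\triangle,\mathsf{wr},\mathrm{even}}(s)+\Phi_{\triangle,\mathsf{wr},\mathrm{odd}}(s)$. For real $s>1$, $$D_\triangle(s)-E_\triangle(s)<\Phi_{\triangle,\mathsf{wr}}(s)<D_\triangle(s),$$ with $$D_\triangle(s)=\frac12\cdot\frac{3}{1+3^{-s}}\cdot\frac{1-3^{1-s}}{s-1}\cdot\frac{L(s,\chi_{-3})}{\zeta(2s)}\,\zeta(s)\zeta(2s-1),\qquad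 E_\triangle(s)=\frac{3}{1+3^{-s}}L(s,\chi_{-3})\zeta(s).$$ The function $\Phi_{\triangle,\mathsf{wr}}$ is meromorphic in $\{\mathrm{Re}(s)>\tfrac12\}$, with a pole of order $2$ at $s=1$ and no other pole in $\{\mathrm{Re}(s)\ge1\}$. Consequently, as $x\to\infty$, $$A_\triangle(x)=\sum_{n\le x}a_\triangle(n)=\frac{3\sqrt3\log3}{8\pi}\,x\log x+o(x\log x).$$
   Context: A lattice in $\mathbb{R}^2$ is well-rounded if its non-zero vectors of minimal length span $\mathbb{R}^2$; a sublattice means a subgroup of finite index. $\mathbb{N}=\{1,2,3,\dots\}$. $\zeta$ is the Riemann zeta function and $L(s,\chi_{-3})=\sum_{n\ge1}\chi_{-3}(n)n^{-s}$ with $\chi_{-3}(n)=0$ if $3\mid n$, $1$ if $n\equiv1\pmod3$, $-1$ if $n\equiv2\pmod3$.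
   Formalization: The upper bound Φ_wr(s) < D(s) fails for large s (Φ_wr(s) ≥ a(1) = 1 while D(s) → 0, e.g. at s = 3); what is proved is Φ_wr(s) < D(s) + Φ_△(s) for all real s > 1, and Φ_wr(s) < D(s) for 1 < s ≤ 3/2. *)

theory Defs
  imports
    "HOL-Complex_Analysis.Complex_Analysis"
    "HOL-Algebra.Coset"
    "HOL-Library.Landau_Symbols"
begin

definition minimal_vectors :: "'a::euclidean_space set \<Rightarrow> 'a set" where
  "minimal_vectors \<Lambda> = {v \<in> \<Lambda>. v \<noteq> 0 \<and> (\<forall>w\<in>\<Lambda>. w \<noteq> 0 \<longrightarrow> norm v \<le> norm w)}"

(* span is the real linear span *)
definition well_rounded :: "'a::euclidean_space set \<Rightarrow> bool" where
  "well_rounded \<Lambda> \<longleftrightarrow> span (minimal_vectors \<Lambda>) = UNIV"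

definition rho :: complex where
  "rho = (1 + \<i> * of_real (sqrt 3)) / 2"

definition hexagonal_lattice :: "complex set" where
  "hexagonal_lattice = {of_int a + of_int b * rho | a b. True}"

definition hexagonal_group :: "complex monoid" where
  "hexagonal_group = \<lparr>carrier = hexagonal_lattice, monoid.mult = (+), one = 0\<rparr>"

definition hexagonal_sublattice :: "complex set \<Rightarrow> bool" where
  "hexagonal_sublattice \<Gamma> \<longleftrightarrow>
     subgroup \<Gamma> hexagonal_group \<and> finite (rcosets\<^bsub>hexagonal_group\<^esub> \<Gamma>)"

definition hexagonal_index :: "complex set \<Rightarrow> nat" where
  "hexagonal_index \<Gamma> = card (rcosets\<^bsub>hexagonal_group\<^esub> \<Gamma>)"

definition a_tri :: "nat \<Rightarrow> nat" where
  "a_tri n = card {\<Gamma>. hexagonal_sublattice \<Gamma> \<and> well_rounded \<Gamma> \<and> hexagonal_index \<Gamma> = n}"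

(* All series below are unordered sums, so they take the intended values where they converge
   absolutely, which for zeta and L_chi3 is Re s > 1; these functions stand for the sums of
   the series only and are not continued analytically. They are polymorphic in order to be
   available both for complex and for real s. *)
definition dirichlet_series ::
    "(nat \<Rightarrow> 'a) \<Rightarrow> 'a \<Rightarrow> 'a::{real_normed_field, ln}" where
  "dirichlet_series a s = (\<Sum>\<^sub>\<infinity>n\<in>{1..}. a n / of_nat n powr s)"

definition zeta :: "'a \<Rightarrow> 'a::{real_normed_field, ln}" where
  "zeta = dirichlet_series (\<lambda>n. 1)"

definition chi3 :: "nat \<Rightarrow> int" where
  "chi3 n = (if 3 dvd n then 0 else if n mod 3 = 1 then 1 else -1)"

definition L_chi3 :: "'a \<Rightarrow> 'a::{real_normed_field, ln}" where
  "L_chi3 = dirichlet_series (\<lambda>n. of_int (chi3 n))"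

definition Phi_wr :: "'a \<Rightarrow> 'a::{real_normed_field, ln}" where
  "Phi_wr = dirichlet_series (\<lambda>n. of_nat (a_tri n))"

definition Phi_tri :: "'a \<Rightarrow> 'a::{real_normed_field, ln}" where
  "Phi_tri s = L_chi3 s * zeta s"

definition Phi_pr :: "'a \<Rightarrow> 'a::{real_normed_field, ln}" where
  "Phi_pr s = L_chi3 s * zeta s / zeta (2 * s)"

definition Phi_wr_even :: "'a \<Rightarrow> 'a::{real_normed_field, ln}" where
  "Phi_wr_even s = 3 / (4 powr s * (1 + 3 powr (-s))) *
     (\<Sum>\<^sub>\<infinity>p\<in>{1::nat..}. \<Sum>q\<in>{p<..<3*p}. 1 / (of_nat p powr s * of_nat q powr s)) * Phi_pr s"

definition Phi_wr_odd :: "'a \<Rightarrow> 'a::{real_normed_field, ln}" where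
  "Phi_wr_odd s = 3 / (1 + 3 powr (-s)) *
     (\<Sum>\<^sub>\<infinity>k\<in>{1::nat..}. \<Sum>l\<in>{k<..<3*k+1}.
        1 / (of_nat (2*k+1) powr s * of_nat (2*l+1) powr s)) * Phi_pr s"

(* As s tends to infinity, D_tri s tends to 0 whereas Phi_wr s tends to a_tri 1 = 1, so
   Phi_wr s < D_tri s cannot hold for all s > 1 (it fails from about s = 1.77 on). What holds
   for all s > 1 is Phi_wr s < D_tri s + Phi_tri s. *)
definition D_tri :: "real \<Rightarrow> real" where
  "D_tri s = 1/2 * (3 / (1 + 3 powr (-s))) * ((1 - 3 powr (1 - s)) / (s - 1)) *
     (L_chi3 s / zeta (2 * s)) * zeta s * zeta (2 * s - 1)"

definition E_tri :: "real \<Rightarrow> real" where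
  "E_tri s = 3 / (1 + 3 powr (-s)) * L_chi3 s * zeta s"

definition A_tri :: "real \<Rightarrow> real" where
  "A_tri x = (\<Sum>n | 1 \<le> n \<and> real n \<le> x. real (a_tri n))"

end

theory Submission
  imports Defs "HOL-Number_Theory.Number_Theory" "HOL-Library.Discrete_Functions" "HOL-Real_Asymp.Real_Asymp"
begin

text \<open>
A well-rounded sublattice of \<open>\<int>[\<rho>]\<close> is either \<open>z \<int>[\<rho>]\<close> or has a rhombic basis \<open>z (P \<plusminus> Q \<surd>-3) / 2\<close> with \<open>z\<close>
primitive, \<open>3\<close> not dividing \<open>N(z)\<close>, \<open>P \<equiv> Q\<close> modulo 2 and \<open>Q < P < 3 Q\<close>; the index is then \<open>N(z) P Q\<close>.
Hence the counting function is a Dirichlet convolution, and the number \<open>6 \<Sum> \<chi>(d)\<close> (over \<open>d\<close> dividing \<open>n\<close>) of elements of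
norm \<open>n\<close>, which follows from a recurrence over the prime factors of \<open>n\<close>, gives the identity of Dirichlet series.
Comparing the sum over \<open>P\<close> with the integral of \<open>x\<^sup>-\<^sup>s\<close> from \<open>Q\<close> to \<open>3 Q\<close> produces \<open>\<zeta>(2 s - 1)\<close>, hence both the
bounds and the continuation. For the asymptotics no Tauberian theorem is needed: reduced elements have a
density, obtained by inverting convolutions, and the sum of \<open>1 / (P Q)\<close> over \<open>P Q \<le> x\<close> is asymptotic to
\<open>(ln 3 / 4) ln x\<close>.
\<close>

section \<open>Norms of Eisenstein integers\<close>

text \<open>The diagonals \<open>v + w\<close> and \<open>v - w\<close> of a rhombus are orthogonal,
  and the direction orthogonal to \<open>z\<close> is that of \<open>\<surd>-3 z\<close>. Of the two
  primitive vectors in these directions exactly one has norm prime to 3; calling it \<open>z\<close>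
  fixes the roles of \<open>P\<close> and \<open>Q\<close> and leaves only the sign of
  \<open>z\<close> free. Hence rhombic lattices are counted with factor 1/2, but the lattices
  \<open>z \<int>[\<rho>]\<close> with factor 1/6, for the six units. The excluded ends
  \<open>P = Q\<close> and \<open>P = 3 Q\<close> are angles of 120 and 60 degrees, where the
  lattice becomes one of the latter. The series in the definitions are bare sums without
  continuation, so (s - 1) \<zeta>(s), L(s) and the sum over the pairs are each rewritten as a
  series of differences that converges further to the left. For the pairs, the difference between
  sum and integral that belongs to \<open>Q\<close> has order Q to the power -2 Re s, which is why
  the half-plane is Re s > 1/2.\<close>

definition eis_norm :: "int \<times> int \<Rightarrow> int" where
  "eis_norm = (\<lambda>(a, b). a\<^sup>2 + a * b + b\<^sup>2)"

definition eis_reps :: "nat \<Rightarrow> (int \<times> int) set" where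
  "eis_reps n = {z. eis_norm z = int n}"

definition eis_mult :: "int \<times> int \<Rightarrow> int \<times> int \<Rightarrow> int \<times> int" where
  "eis_mult = (\<lambda>(a, b) (c, d). (a * c - b * d, a * d + b * c + b * d))"

lemma eis_norm_mult: "eis_norm (eis_mult z w) = eis_norm z * eis_norm w"
  by (cases z; cases w) (simp add: eis_norm_def eis_mult_def power2_eq_square algebra_simps)

lemma eis_norm_scale: "eis_norm (k * a, k * b) = k\<^sup>2 * eis_norm (a, b)"
  by (simp add: eis_norm_def power2_eq_square algebra_simps)

text \<open>Completing the square in either variable: the first form bounds \<open>b\<close>, the
  second bounds \<open>a\<close>.\<close>

lemma four_eis_norm:
  "4 * eis_norm (a, b) = (2 * a + b)\<^sup>2 + 3 * b\<^sup>2"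
  "4 * eis_norm (a, b) = (a + 2 * b)\<^sup>2 + 3 * a\<^sup>2"
  by (simp_all add: eis_norm_def power2_eq_square algebra_simps)

lemma eis_norm_nonneg: "eis_norm z \<ge> 0"
proof (cases z)
  case (Pair a b)
  have "0 \<le> (2 * a + b)\<^sup>2 + 3 * b\<^sup>2" by simp
  then show ?thesis unfolding Pair four_eis_norm(1)[symmetric] by simp
qed

lemma eis_norm_eq_0_iff: "eis_norm z = 0 \<longleftrightarrow> z = (0, 0)"
proof (cases z)
  case (Pair a b)
  have "eis_norm (a, b) = 0 \<longleftrightarrow> (2 * a + b)\<^sup>2 + 3 * b\<^sup>2 = 0"
    using four_eis_norm(1)[of a b] by linarith
  also have "\<dots> \<longleftrightarrow> a = 0 \<and> b = 0"
    by (auto simp: add_nonneg_eq_0_iff)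
  finally show ?thesis by (simp add: Pair)
qed

lemma finite_eis_reps: "finite (eis_reps n)"
proof -
  have "eis_reps n \<subseteq> {-4 * int n..4 * int n} \<times> {-4 * int n..4 * int n}"
  proof
    fix z assume "z \<in> eis_reps n"
    then obtain a b where z: "z = (a, b)" "eis_norm (a, b) = int n"
      by (cases z) (auto simp: eis_reps_def)
    have *: "\<bar>x\<bar> \<le> x\<^sup>2" for x :: int
      using mult_mono[of 1 "\<bar>x\<bar>" "\<bar>x\<bar>" "\<bar>x\<bar>"] by (cases "x = 0") (auto simp: power2_eq_square)
    have "a\<^sup>2 \<le> 4 * int n" "b\<^sup>2 \<le> 4 * int n"
      using four_eis_norm[of a b] z(2) zero_le_power2[of "2 * a + b"] zero_le_power2[of "a + 2 * b"]
        zero_le_power2[of a] zero_le_power2[of b] by linarith+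
    then have "\<bar>a\<bar> \<le> 4 * int n" "\<bar>b\<bar> \<le> 4 * int n"
      using *[of a] *[of b] by linarith+
    then show "z \<in> {-4 * int n..4 * int n} \<times> {-4 * int n..4 * int n}"
      by (auto simp: z)
  qed
  then show ?thesis by (rule finite_subset) auto
qed

text \<open>The norm is congruent to the square of \<open>a - b\<close> modulo 3. The condition on
  the right describes the ideal generated by \<open>\<surd>-3\<close>, the only prime above
  3.\<close>

lemma three_dvd_eis_norm_iff: "3 dvd eis_norm (a, b) \<longleftrightarrow> 3 dvd a - b"
proof -
  have "eis_norm (a, b) = (a - b)\<^sup>2 + 3 * (a * b)"
    by (simp add: eis_norm_def power2_eq_square algebra_simps)
  then have "3 dvd eis_norm (a, b) \<longleftrightarrow> 3 dvd (a - b)\<^sup>2"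
    by (simp add: dvd_add_left_iff)
  also have "\<dots> \<longleftrightarrow> 3 dvd a - b"
    by (rule prime_dvd_power_iff) auto
  finally show ?thesis .
qed

text \<open>In the basis \<open>1, \<rho>\<close> the pair \<open>(-1, 2)\<close> is \<open>\<surd>-3\<close>.\<close>

lemma eis_mult_sqrt_m3: "eis_mult (-1, 2) (a, b) = (- a - 2 * b, 2 * a + b)"
  by (simp add: eis_mult_def)

lemma eis_norm_sqrt_m3: "eis_norm (eis_mult (-1, 2) z) = 3 * eis_norm z"
  by (subst eis_norm_mult) (simp add: eis_norm_def)

lemma inj_sqrt_m3: "inj (eis_mult (-1, 2))"
  by (rule injI) (auto simp: eis_mult_def)

lemma sqrt_m3_dvd:
  assumes "3 dvd eis_norm z"
  obtains w where "z = eis_mult (-1, 2) w"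
proof (cases z)
  case (Pair a b)
  then obtain k where "a - b = 3 * k"
    using assms three_dvd_eis_norm_iff by (auto elim: dvdE)
  then have "z = eis_mult (-1, 2) (b + k, - b - 2 * k)"
    by (simp add: Pair eis_mult_def)
  then show ?thesis by (rule that)
qed

text \<open>The ramified prime: by \<open>sqrt_m3_dvd\<close>, multiplication by
  \<open>\<surd>-3\<close> maps onto all elements whose norm is divisible by 3.\<close>

lemma card_eis_reps_3: "card (eis_reps (3 * n)) = card (eis_reps n)"
proof -
  have "eis_reps (3 * n) = eis_mult (-1, 2) ` eis_reps n"
  proof (intro equalityI subsetI)
    fix z assume z: "z \<in> eis_reps (3 * n)"
    then have "3 dvd eis_norm z" by (simp add: eis_reps_def)
    then obtain w where "z = eis_mult (-1, 2) w" by (rule sqrt_m3_dvd)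
    with z show "z \<in> eis_mult (-1, 2) ` eis_reps n"
      using eis_norm_sqrt_m3[of w] by (auto simp: eis_reps_def)
  next
    fix z assume "z \<in> eis_mult (-1, 2) ` eis_reps n"
    then show "z \<in> eis_reps (3 * n)"
      by (auto simp: eis_reps_def eis_norm_sqrt_m3 simp del: split_paired_All)
  qed
  then show ?thesis
    by (simp add: card_image inj_on_subset[OF inj_sqrt_m3])
qed

text \<open>Inert primes. If neither coordinate is divisible by \<open>p\<close>, then
  \<open>a ^ 3\<close> and \<open>b ^ 3\<close> agree modulo \<open>p\<close>, as their difference
  is \<open>(a - b)\<close> times the norm. Since \<open>p - 1 = 3 * k + 1\<close>, Fermat's theorem
  turns the equality of cubes into that of \<open>a\<close> and \<open>b\<close>, and the norm
  becomes congruent to \<open>3 * b\<^sup>2\<close>, which \<open>p\<close> cannot divide.\<close>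

lemma prime_dvd_eis_norm_imp:
  assumes p: "prime (p :: nat)" "p mod 3 = 2" and dvd: "int p dvd eis_norm (a, b)"
  shows "int p dvd a \<and> int p dvd b"
proof -
  have pi: "prime (int p)" using p by simp
  have *: "int p dvd y" if "int p dvd x" "int p dvd eis_norm (x, y)" for x y
  proof -
    have "int p dvd x * (x + y)" using that by simp
    then have "int p dvd y\<^sup>2"
      using that(2) dvd_add_right_iff[of "int p" "x * (x + y)" "y\<^sup>2"]
      by (simp add: eis_norm_def power2_eq_square algebra_simps)
    then show ?thesis using pi prime_dvd_power by blast
  qed
  have sym: "eis_norm (b, a) = eis_norm (a, b)"
    by (simp add: eis_norm_def algebra_simps)
  show ?thesis
  proof (cases "int p dvd a \<or> int p dvd b")
    case True
    then show ?thesis using *[of a b] *[of b a] dvd sym by auto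
  next
    case False
    have fermat: "[x ^ (p - 1) = 1] (mod int p)" if "\<not> int p dvd x" for x
    proof -
      define y where "y = nat (x mod int p)"
      have y: "int y = x mod int p" using p by (simp add: y_def prime_gt_0_nat)
      have "\<not> p dvd y"
        using that by (metis y int_dvd_int_iff dvd_mod_iff dvd_refl)
      then have "[y ^ (p - 1) = 1] (mod p)" by (rule fermat_theorem[OF p(1)])
      then have "[int y ^ (p - 1) = 1] (mod int p)"
        by (metis cong_int_iff of_nat_1 of_nat_power)
      then show ?thesis unfolding y by (simp add: cong_def power_mod)
    qed
    define k where "k = p div 3"
    have k: "p - 1 = 3 * k + 1" using p(2) unfolding k_def by presburger
    have "[a ^ 3 = b ^ 3] (mod int p)"
    proof -
      have "a ^ 3 - b ^ 3 = (a - b) * eis_norm (a, b)"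
        by (simp add: eis_norm_def power2_eq_square power3_eq_cube algebra_simps)
      then show ?thesis using dvd by (simp add: cong_iff_dvd_diff)
    qed
    then have c3: "[a ^ (3 * k) = b ^ (3 * k)] (mod int p)"
      by (simp add: power_mult cong_pow)
    have "[a ^ (3 * k) * a = b ^ (3 * k) * b] (mod int p)"
      using fermat[of a] fermat[of b] False unfolding k
      by (metis cong_sym cong_trans power_add power_one_right)
    then have "[a ^ (3 * k) * a = a ^ (3 * k) * b] (mod int p)"
      using c3 by (meson cong_scalar_right cong_sym cong_trans)
    moreover have "coprime (a ^ (3 * k)) (int p)"
      using False pi by (metis coprime_commute coprime_power_left_iff prime_imp_coprime)
    ultimately have "[a = b] (mod int p)" by (simp add: cong_mult_lcancel)
    then have ab: "int p dvd a - b" by (simp add: cong_iff_dvd_diff)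
    have "eis_norm (a, b) = (a - b) * (a - b + 3 * b) + 3 * b\<^sup>2"
      by (simp add: eis_norm_def power2_eq_square algebra_simps)
    then have "int p dvd 3 * b\<^sup>2"
      using dvd ab by (metis dvd_add_right_iff dvd_mult2)
    then have "int p dvd 3"
      using False pi by (metis prime_dvd_mult_iff prime_dvd_power)
    then have "int p \<le> 3" by (rule zdvd_imp_le) simp
    moreover have "p \<noteq> 2" using \<open>int p dvd 3\<close> by auto
    ultimately have "p = 3" using prime_ge_2_nat[OF p(1)] by linarith
    then show ?thesis using p by simp
  qed
qed

text \<open>Every element whose norm is divisible by an inert \<open>p\<close> is \<open>p\<close>
  times another one, so its norm is even divisible by the square of \<open>p\<close>.\<close>

lemma card_eis_reps_inert:
  assumes p: "prime p" "p mod 3 = 2"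
  shows "card (eis_reps (p * n)) = (if p dvd n then card (eis_reps (n div p)) else 0)"
proof -
  have p0: "p > 0" using p by (simp add: prime_gt_0_nat)
  have dvd: "int p dvd fst z \<and> int p dvd snd z" if "z \<in> eis_reps (p * n)" for z
    using that prime_dvd_eis_norm_imp[OF p, of "fst z" "snd z"] by (simp add: eis_reps_def)
  show ?thesis
  proof (cases "p dvd n")
    case True
    then obtain m where m: "n = p * m" by blast
    let ?f = "\<lambda>(a, b). (int p * a, int p * b)"
    have "eis_reps (p * n) = ?f ` eis_reps m"
    proof (intro equalityI subsetI)
      fix z assume z: "z \<in> eis_reps (p * n)"
      obtain a b where ab: "z = (int p * a, int p * b)"
        using dvd[OF z] by (metis dvdE prod.collapse)
      have "(a, b) \<in> eis_reps m"
        using z p0 by (simp add: ab eis_reps_def eis_norm_scale m power2_eq_square)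
      then show "z \<in> ?f ` eis_reps m" by (force simp: ab)
    next
      fix z assume "z \<in> ?f ` eis_reps m"
      then show "z \<in> eis_reps (p * n)"
        by (auto simp: eis_reps_def eis_norm_scale m power2_eq_square)
    qed
    moreover have "inj ?f" using p0 by (auto intro!: injI)
    ultimately show ?thesis using p0 True
      by (simp add: m card_image inj_on_subset)
  next
    case False
    have "z \<notin> eis_reps (p * n)" for z
    proof
      assume z: "z \<in> eis_reps (p * n)"
      obtain a b where ab: "z = (int p * a, int p * b)"
        using dvd[OF z] by (metis dvdE prod.collapse)
      have "int n = int p * eis_norm (a, b)"
        using z p0 by (simp add: ab eis_reps_def eis_norm_scale power2_eq_square)
      then show False using False by (metis dvd_triv_left int_dvd_int_iff)
    qed
    then show ?thesis using False by (metis card.empty equals0I)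
  qed
qed

text \<open>A primitive root raised to the power (p - 1) / 3 has order 3, hence is a zero of the
  cofactor of \<open>t - 1\<close> in \<open>t ^ 3 - 1\<close>.\<close>

lemma prime_dvd_quadratic:
  assumes p: "prime p" "p mod 3 = 1"
  obtains t :: int where "int p dvd t\<^sup>2 + t + 1"
proof -
  have p2: "p > 2" using prime_ge_2_nat[OF p(1)] p(2) by (cases "p = 2") auto
  obtain g where g: "residue_primroot p g"
    using prime_primitive_root_exists[of p] p(1) p2 by auto
  define k where "k = p div 3"
  have k: "p - 1 = 3 * k" "k > 0" using p(2) p2 unfolding k_def by presburger+
  have ord: "ord p g = 3 * k"
    using g p(1) k(1) by (simp add: residue_primroot_def totient_prime)
  have "[g ^ (3 * k) = 1] (mod p)" using ord ord_works[of g p] by simp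
  moreover have "\<not> [g ^ k = 1] (mod p)"
    using ord k(2) ord_divides[of g k p] by (auto dest: dvd_imp_le)
  ultimately have *: "[int g ^ (3 * k) = 1] (mod int p)" "\<not> [int g ^ k = 1] (mod int p)"
    by (metis cong_int_iff of_nat_1 of_nat_power)+
  define t where "t = int g ^ k"
  have "t ^ 3 - 1 = (t - 1) * (t\<^sup>2 + t + 1)"
    by (simp add: power2_eq_square power3_eq_cube algebra_simps)
  moreover have "t ^ 3 = int g ^ (3 * k)" by (simp add: t_def power_mult[symmetric] mult.commute)
  ultimately have "int p dvd (t - 1) * (t\<^sup>2 + t + 1)" "\<not> int p dvd t - 1"
    using * by (simp_all add: cong_iff_dvd_diff t_def)
  moreover have "prime (int p)" using p(1) by simp
  ultimately have "int p dvd t\<^sup>2 + t + 1" by (simp add: prime_dvd_mult_iff)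
  then show ?thesis by (rule that)
qed

text \<open>Pigeonhole: with \<open>r\<close> the integer square root of \<open>n\<close> there are
  more than \<open>n\<close> pairs \<open>(i, j)\<close> in the square up to \<open>r\<close>, so
  two of them agree in \<open>i - t * j\<close> modulo \<open>n\<close>; their difference is the
  required pair.\<close>

lemma thue:
  fixes t :: int
  assumes n: "n > 0"
  obtains a b :: int where "(a, b) \<noteq> (0, 0)" "a\<^sup>2 \<le> int n" "b\<^sup>2 \<le> int n" "int n dvd a - t * b"
proof -
  define r where "r = floor_sqrt n"
  have r: "r\<^sup>2 \<le> n" "n < (r + 1)\<^sup>2"
    using floor_sqrt_power2_le[of n] Suc_floor_sqrt_power2_gt[of n] by (simp_all add: r_def)
  define f where "f = (\<lambda>(i, j). (int i - t * int j) mod int n)"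
  have "f ` ({..r} \<times> {..r}) \<subseteq> {0..<int n}" using n by (auto simp: f_def)
  then have "card (f ` ({..r} \<times> {..r})) \<le> n"
    using card_mono[of "{0..<int n}"] by fastforce
  also have "n < card ({..r} \<times> {..r})" using r(2) by (simp add: power2_eq_square)
  finally have "\<not> inj_on f ({..r} \<times> {..r})" using pigeonhole by blast
  then obtain i j i' j' where ij: "i \<le> r" "j \<le> r" "i' \<le> r" "j' \<le> r" "(i, j) \<noteq> (i', j')"
    "f (i, j) = f (i', j')"
    unfolding inj_on_def by auto
  have sq: "(int x - int y)\<^sup>2 \<le> int n" if "x \<le> r" "y \<le> r" for x y
  proof -
    have "\<bar>int x - int y\<bar> \<le> int r" using that by auto
    then have "(int x - int y)\<^sup>2 \<le> (int r)\<^sup>2" by (metis abs_le_square_iff abs_of_nat)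
    also have "\<dots> \<le> int n" using r(1) by (metis of_nat_le_iff of_nat_power)
    finally show ?thesis .
  qed
  have "int n dvd (int i - t * int j) - (int i' - t * int j')"
    using ij(6) by (simp add: f_def mod_eq_dvd_iff)
  then have "int n dvd (int i - int i') - t * (int j - int j')"
    by (simp add: algebra_simps)
  then show ?thesis
    using that[of "int i - int i'" "int j - int j'"] sq ij by auto
qed

text \<open>Thue's pair has norm \<open>p * k\<close>. Both squares are strictly below
  \<open>p\<close>, a prime being no square, so the norm is below \<open>3 * p\<close> and
  \<open>k\<close> is 1 or 2. The value 2 is impossible: 2 is inert, so \<open>a\<close> and
  \<open>b\<close> would be even and \<open>p\<close> would be even too.\<close>

lemma eis_norm_prime_split:
  assumes p: "prime p" "p mod 3 = 1" and t: "int p dvd t\<^sup>2 + t + 1"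
  obtains c d where "eis_norm (c, d) = int p" "int p dvd c - t * d"
proof -
  have p0: "p > 0" using p by (simp add: prime_gt_0_nat)
  obtain a b where ab: "(a, b) \<noteq> (0, 0)" "a\<^sup>2 \<le> int p" "b\<^sup>2 \<le> int p" "int p dvd a - t * b"
    using thue[OF p0] by blast
  have "eis_norm (a, b) = (a - t * b) * (a + t * b + b) + (t\<^sup>2 + t + 1) * b\<^sup>2"
    by (simp add: eis_norm_def power2_eq_square algebra_simps)
  then have "int p dvd eis_norm (a, b)" using ab(4) t by simp
  then obtain k where k: "eis_norm (a, b) = int p * k" by blast
  have nsq: "x\<^sup>2 \<noteq> int p" for x :: int
  proof
    assume "x\<^sup>2 = int p"
    then have "prime (x\<^sup>2)" using p(1) by simp
    then show False by (simp add: prime_power_iff)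
  qed
  have "a\<^sup>2 < int p" "b\<^sup>2 < int p" using ab nsq by (simp_all add: order_less_le)
  moreover have "2 * (a * b) \<le> a\<^sup>2 + b\<^sup>2" using zero_le_power2[of "a - b"] by (simp add: power2_eq_square algebra_simps)
  ultimately have "eis_norm (a, b) < 3 * int p" by (simp add: eis_norm_def)
  moreover have "eis_norm (a, b) > 0" using ab(1) eis_norm_nonneg[of "(a, b)"] eis_norm_eq_0_iff[of "(a, b)"] by linarith
  ultimately have "0 < k" "k < 3" using k p0 by (auto simp: zero_less_mult_iff)
  moreover have "k \<noteq> 2"
  proof
    assume "k = 2"
    then have "int 2 dvd eis_norm (a, b)" using k by simp
    then have "even a \<and> even b" using prime_dvd_eis_norm_imp[of 2 a b] by simp
    then obtain a' b' where "a = 2 * a'" "b = 2 * b'" by (auto elim!: evenE)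
    then have "int p * 2 = 4 * eis_norm (a', b')"
      using eis_norm_scale[of 2 a' b'] k \<open>k = 2\<close> by simp
    then have "int p = 2 * eis_norm (a', b')" by linarith
    then have "2 dvd p" by presburger
    then have "p = 2" using p(1) primes_dvd_imp_eq two_is_prime_nat by blast
    then show False using p(2) by simp
  qed
  ultimately have "k = 1" by linarith
  then show ?thesis using that[of a b] k ab(4) by simp
qed

text \<open>The elements \<open>a + b \<rho>\<close> with \<open>a \<equiv> t b\<close> modulo \<open>p\<close> form the prime ideal generated by \<open>(c, d)\<close>.\<close>

lemma card_eis_reps_ideal:
  assumes p: "prime p" and t: "int p dvd t\<^sup>2 + t + 1"
    and cd: "eis_norm (c, d) = int p" "int p dvd c - t * d"
  shows "card {z \<in> eis_reps (p * n). int p dvd fst z - t * snd z} = card (eis_reps n)"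
proof -
  have p0: "p > 0" using p by (simp add: prime_gt_0_nat)
  let ?f = "eis_mult (c, d)"
  have "{z \<in> eis_reps (p * n). int p dvd fst z - t * snd z} = ?f ` eis_reps n"
  proof (intro equalityI subsetI)
    fix z assume "z \<in> {z \<in> eis_reps (p * n). int p dvd fst z - t * snd z}"
    then obtain a b where z: "z = (a, b)" "eis_norm (a, b) = int p * int n" "int p dvd a - t * b"
      by (cases z) (auto simp: eis_reps_def)
    obtain u v q where "a - t * b = int p * u" "c - t * d = int p * v" "t\<^sup>2 + t + 1 = int p * q"
      using z(3) cd(2) t by (auto simp only: dvd_def)
    then have u: "a = t * b + int p * u" "c = t * d + int p * v" "t\<^sup>2 = int p * q - t - 1"
      by linarith+
    \<comment> \<open>These are the coordinates of \<open>z\<close> times the conjugate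
      \<open>(c + d, - d)\<close>. Dividing them by \<open>p\<close>, the norm of
      \<open>(c, d)\<close>, gives the quotient of \<open>z\<close> by
      \<open>(c, d)\<close>.\<close>
    have "int p dvd a * (c + d) + b * d" "int p dvd b * c - a * d"
    proof -
      have "a * (c + d) + b * d = int p * (u * (c + d) + t * b * v + b * d * q)
        + b * d * (t\<^sup>2 - (int p * q - t - 1))"
        by (simp add: u(1,2) power2_eq_square algebra_simps)
      then show "int p dvd a * (c + d) + b * d" using u(3) by simp
      show "int p dvd b * c - a * d" by (simp add: u(1,2) algebra_simps)
    qed
    then obtain x y where xy: "a * (c + d) + b * d = int p * x" "b * c - a * d = int p * y"
      by (auto elim!: dvdE)
    have N: "int p = c * c + c * d + d * d" using cd(1) by (simp add: eis_norm_def power2_eq_square)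
    have "int p * (c * x - d * y) = int p * a"
      unfolding right_diff_distrib mult.left_commute[of "int p"] xy[symmetric] by (simp add: N algebra_simps)
    moreover have "int p * (c * y + d * x + d * y) = int p * b"
      unfolding distrib_left mult.left_commute[of "int p"] xy[symmetric] by (simp add: N algebra_simps)
    ultimately have f: "z = ?f (x, y)" using p0 by (simp add: eis_mult_def z)
    then have "int p * eis_norm (x, y) = int p * int n" using z(2) cd(1) eis_norm_mult[of "(c, d)" "(x, y)"] z(1) by metis
    then have "(x, y) \<in> eis_reps n" using p0 by (simp add: eis_reps_def)
    then show "z \<in> ?f ` eis_reps n" using f by blast
  next
    fix z assume "z \<in> ?f ` eis_reps n"
    then obtain x y where z: "z = ?f (x, y)" "(x, y) \<in> eis_reps n" by auto
    obtain v where "c - t * d = int p * v"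
      using cd(2) by (auto simp only: dvd_def)
    then have v: "c = t * d + int p * v" by linarith
    have "fst z - t * snd z = int p * (v * x - t * v * y) - d * y * (t\<^sup>2 + t + 1)"
      by (simp add: z eis_mult_def v power2_eq_square algebra_simps)
    then have "int p dvd fst z - t * snd z" using t by simp
    moreover have "z \<in> eis_reps (p * n)"
      using z(2) cd(1) by (simp add: z(1) eis_reps_def eis_norm_mult)
    ultimately show "z \<in> {z \<in> eis_reps (p * n). int p dvd fst z - t * snd z}" by simp
  qed
  moreover have "inj ?f"
  proof (rule injI)
    fix z w :: "int \<times> int"
    assume eq: "?f z = ?f w"
    have "?f (fst z - fst w, snd z - snd w) = (0, 0)"
      using eq by (cases z; cases w) (auto simp: eis_mult_def algebra_simps)
    then have "eis_norm (c, d) * eis_norm (fst z - fst w, snd z - snd w) = 0"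
      by (metis eis_norm_mult eis_norm_eq_0_iff)
    then show "z = w" using cd(1) p0 by (auto simp: eis_norm_eq_0_iff prod_eq_iff)
  qed
  ultimately show ?thesis by (simp add: card_image inj_on_subset)
qed

text \<open>Inclusion and exclusion over the two conjugate prime ideals above \<open>p\<close>,
  which belong to the zeros \<open>t\<close> and \<open>- 1 - t\<close> of the quadratic. Modulo
  \<open>p\<close> the norm factors into \<open>(a - t * b) * (a - t' * b)\<close>, so the two
  ideals cover everything; each contributes the count for \<open>n\<close>, and they meet in the
  multiples of \<open>p\<close>.\<close>

lemma card_eis_reps_split:
  assumes p: "prime p" "p mod 3 = 1"
  shows "card (eis_reps (p * n)) + (if p dvd n then card (eis_reps (n div p)) else 0)
    = 2 * card (eis_reps n)"
proof -
  have p0: "p > 0" using p by (simp add: prime_gt_0_nat)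
  have pi: "prime (int p)" using p by simp
  obtain t where t: "int p dvd t\<^sup>2 + t + 1" using prime_dvd_quadratic[OF p] .
  define t' where "t' = - 1 - t"
  have "t'\<^sup>2 + t' + 1 = t\<^sup>2 + t + 1" by (simp add: t'_def power2_eq_square algebra_simps)
  then have t': "int p dvd t'\<^sup>2 + t' + 1" using t by simp
  define X where "X = (\<lambda>t. {z \<in> eis_reps (p * n). int p dvd fst z - t * snd z})"
  have X: "card (X t) = card (eis_reps n)" if u: "int p dvd t\<^sup>2 + t + 1" for t
  proof -
    obtain c d where "eis_norm (c, d) = int p" "int p dvd c - t * d"
      using eis_norm_prime_split[OF p u] by blast
    then show ?thesis unfolding X_def by (rule card_eis_reps_ideal[OF p(1) u])
  qed
  have fin: "finite (X t)" "finite (X t')" using finite_eis_reps by (simp_all add: X_def)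
  have un: "X t \<union> X t' = eis_reps (p * n)"
  proof -
    have "int p dvd a - t * b \<or> int p dvd a - t' * b" if "eis_norm (a, b) = int p * int n" for a b
    proof -
      have "(a - t * b) * (a - t' * b) = eis_norm (a, b) - b\<^sup>2 * (t\<^sup>2 + t + 1)"
        by (simp add: eis_norm_def t'_def power2_eq_square algebra_simps)
      then have "int p dvd (a - t * b) * (a - t' * b)" using t that by simp
      then show ?thesis using pi by (simp add: prime_dvd_mult_iff)
    qed
    then show ?thesis unfolding X_def eis_reps_def
      by (intro equalityI subsetI) (auto simp only: mem_Collect_eq of_nat_mult Un_iff split_paired_all fst_conv snd_conv)
  qed
  have int: "X t \<inter> X t' = (\<lambda>(a, b). (int p * a, int p * b)) ` {z. int p * eis_norm z = int n}"
  proof (intro equalityI subsetI)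
    fix z assume "z \<in> X t \<inter> X t'"
    then obtain a b where z: "z = (a, b)" "eis_norm (a, b) = int p * int n"
      "int p dvd a - t * b" "int p dvd a - t' * b"
      by (cases z) (auto simp: X_def eis_reps_def)
    have "int p dvd (a - t * b) - (a - t' * b)" by (rule dvd_diff[OF z(3,4)])
    also have "(a - t * b) - (a - t' * b) = - ((2 * t + 1) * b)" by (simp add: t'_def algebra_simps)
    finally have "int p dvd (2 * t + 1) * b" by simp
    \<comment> \<open>The two zeros differ modulo \<open>p\<close>, because the discriminant of the
      quadratic is -3.\<close>
    moreover have "\<not> int p dvd 2 * t + 1"
    proof
      assume "int p dvd 2 * t + 1"
      then have "int p dvd 4 * (t\<^sup>2 + t + 1) - (2 * t + 1) * (2 * t + 1)"
        using t by (intro dvd_diff dvd_mult)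
      also have "4 * (t\<^sup>2 + t + 1) - (2 * t + 1) * (2 * t + 1) = 3"
        by (simp add: power2_eq_square algebra_simps)
      finally have "int p dvd 3" .
      then have "p \<le> 3" using zdvd_imp_le[of "int p" 3] by simp
      then show False using p prime_ge_2_nat[OF p(1)] \<open>int p dvd 3\<close> by (cases "p = 2"; cases "p = 3") auto
    qed
    ultimately have b: "int p dvd b" using pi by (simp add: prime_dvd_mult_iff)
    then have "int p dvd (a - t * b) + t * b" using z(3) by (intro dvd_add) auto
    then have "int p dvd a" by simp
    with b obtain a' b' where ab': "a = int p * a'" "b = int p * b'" by (auto simp only: dvd_def)
    then have "int p * eis_norm (a', b') = int n"
      using z(2) p0 by (simp add: eis_norm_scale power2_eq_square)
    then show "z \<in> (\<lambda>(a, b). (int p * a, int p * b)) ` {z. int p * eis_norm z = int n}"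
      by (force simp: z ab')
  next
    fix z assume "z \<in> (\<lambda>(a, b). (int p * a, int p * b)) ` {z. int p * eis_norm z = int n}"
    then show "z \<in> X t \<inter> X t'"
      by (auto simp: X_def eis_reps_def eis_norm_scale power2_eq_square)
  qed
  have "card (X t \<inter> X t') = card {z. int p * eis_norm z = int n}"
    unfolding int using p0 by (intro card_image) (auto intro!: inj_onI)
  also have "\<dots> = (if p dvd n then card (eis_reps (n div p)) else 0)"
  proof (cases "p dvd n")
    case True
    then show ?thesis using p0 by (auto simp: eis_reps_def elim!: dvdE)
  next
    case False
    then have "{z. int p * eis_norm z = int n} = {}"
      by (metis (mono_tags, lifting) Collect_empty_eq dvd_triv_left int_dvd_int_iff)
    then show ?thesis using False by (simp only: card.empty if_False)
  qed
  finally show ?thesis using card_Un_Int[OF fin] X[OF t] X[OF t'] un by simp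
qed

section \<open>The divisor sum of the character satisfies the same recurrence\<close>

lemma chi3_mult: "chi3 (a * b) = chi3 a * chi3 b"
proof -
  have m: "chi3 n = (if n mod 3 = 0 then 0 else if n mod 3 = 1 then 1 else - 1)" for n
    by (simp add: chi3_def dvd_eq_mod_eq_0)
  have "a mod 3 = 0 \<or> a mod 3 = 1 \<or> a mod 3 = 2" "b mod 3 = 0 \<or> b mod 3 = 1 \<or> b mod 3 = 2"
    by presburger+
  then show ?thesis
    unfolding m mod_mult_eq[of a 3 b, symmetric] by auto
qed

definition divisor_chi :: "nat \<Rightarrow> int" where
  "divisor_chi n = (\<Sum>d | d dvd n. chi3 d)"

text \<open>The divisors of \<open>p * n\<close> that do not divide \<open>n\<close> are the
  \<open>p * e\<close> with \<open>e\<close> dividing \<open>n\<close> and \<open>p * e\<close> not.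
  The shape of the recurrence is that of the Euler factor 1 / ((1 - X) (1 - \<open>chi3 p\<close>
  X)).\<close>

lemma divisor_chi_prime_mult:
  assumes p: "prime p" and n: "n > 0"
  shows "divisor_chi (p * n) = (1 + chi3 p) * divisor_chi n
    - chi3 p * (if p dvd n then divisor_chi (n div p) else 0)"
proof -
  have p0: "p > 0" using p by (simp add: prime_gt_0_nat)
  let ?A = "{e. e dvd n \<and> \<not> p * e dvd n}"
  have "d \<in> (*) p ` ?A" if d: "d dvd p * n" "\<not> d dvd n" for d
  proof -
    have "p dvd d"
    proof (rule ccontr)
      assume "\<not> p dvd d"
      then have "coprime d p" using p by (metis coprime_commute prime_imp_coprime)
      then show False using d by (simp add: coprime_dvd_mult_right_iff)
    qed
    then obtain e where "d = p * e" by blast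
    then show ?thesis using d p0 by auto
  qed
  then have eq: "{d. d dvd p * n} = {d. d dvd n} \<union> (*) p ` ?A" by auto
  have fin: "finite {d. d dvd n}" using n by simp
  have "divisor_chi (p * n) = divisor_chi n + (\<Sum>d\<in>(*) p ` ?A. chi3 d)"
    unfolding divisor_chi_def eq using n fin by (intro sum.union_disjoint) auto
  also have "(\<Sum>d\<in>(*) p ` ?A. chi3 d) = chi3 p * (\<Sum>e\<in>?A. chi3 e)"
    using p0 by (subst sum.reindex) (auto intro!: inj_onI simp: chi3_mult sum_distrib_left)
  also have "?A = {d. d dvd n} - {e. p * e dvd n}" by auto
  also have "(\<Sum>e\<in>{d. d dvd n} - {e. p * e dvd n}. chi3 e) = divisor_chi n - (\<Sum>e | p * e dvd n. chi3 e)"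
    unfolding divisor_chi_def using fin by (intro sum_diff) (auto dest: dvd_mult_right)
  also have "(\<Sum>e | p * e dvd n. chi3 e) = (if p dvd n then divisor_chi (n div p) else 0)"
  proof (cases "p dvd n")
    case True
    then obtain m where "n = p * m" by blast
    then show ?thesis using p0 by (simp add: divisor_chi_def)
  next
    case False
    then have "{e. p * e dvd n} = {}" by (auto dest: dvd_mult_left)
    then show ?thesis using False by simp
  qed
  finally show ?thesis by (simp add: algebra_simps)
qed

lemma eis_reps_1: "eis_reps 1 = {(1, 0), (-1, 0), (0, 1), (0, -1), (1, -1), (-1, 1)}"
proof (intro equalityI subsetI)
  fix z assume "z \<in> eis_reps 1"
  then obtain a b where z: "z = (a, b)" "eis_norm (a, b) = 1"
    by (cases z) (auto simp: eis_reps_def)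
  have sq: "\<bar>x\<bar> < 2" if "3 * x\<^sup>2 \<le> 4" for x :: int
  proof (rule ccontr)
    assume "\<not> \<bar>x\<bar> < 2"
    then have "2\<^sup>2 \<le> x\<^sup>2" by (subst abs_le_square_iff[symmetric]) auto
    with that show False by simp
  qed
  have "3 * a\<^sup>2 \<le> 4" "3 * b\<^sup>2 \<le> 4"
    using four_eis_norm[of a b] z(2) zero_le_power2[of "2 * a + b"] zero_le_power2[of "a + 2 * b"] by linarith+
  then have "\<bar>a\<bar> < 2" "\<bar>b\<bar> < 2" using sq by blast+
  then have "a \<in> {-1, 0, 1}" "b \<in> {-1, 0, 1}" by auto
  then show "z \<in> {(1, 0), (-1, 0), (0, 1), (0, -1), (1, -1), (-1, 1)}"
    using z by (auto simp: eis_norm_def)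
qed (auto simp: eis_reps_def eis_norm_def)

text \<open>The values 0, 1 and -1 of \<open>chi3 p\<close> merge the ramified, the split and the
  inert case into the recurrence of \<open>divisor_chi_prime_mult\<close>.\<close>

lemma card_eis_reps_prime_mult:
  assumes p: "prime p"
  shows "int (card (eis_reps (p * n))) = (1 + chi3 p) * int (card (eis_reps n))
    - chi3 p * (if p dvd n then int (card (eis_reps (n div p))) else 0)"
proof -
  consider "p = 3" | "p mod 3 = 1" | "p mod 3 = 2"
  proof -
    have "p mod 3 = 0 \<or> p mod 3 = 1 \<or> p mod 3 = 2" by presburger
    moreover have "p = 3" if "p mod 3 = 0"
    proof -
      have "3 dvd p" using that by auto
      moreover have "prime (3 :: nat)" by simp
      ultimately show ?thesis using p primes_dvd_imp_eq by blast
    qed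
    ultimately show ?thesis using that by metis
  qed
  then show ?thesis
  proof cases
    case 1
    then show ?thesis by (simp add: card_eis_reps_3 chi3_def)
  next
    case 2
    then have "chi3 p = 1" by (auto simp: chi3_def)
    then show ?thesis using card_eis_reps_split[OF p 2, of n] by (simp split: if_splits)
  next
    case 3
    then have "chi3 p = -1" by (auto simp: chi3_def)
    then show ?thesis using card_eis_reps_inert[OF p 3, of n] by simp
  qed
qed

theorem card_eis_reps: "n > 0 \<Longrightarrow> int (card (eis_reps n)) = 6 * divisor_chi n"
proof (induction n rule: less_induct)
  case (less n)
  show ?case
  proof (cases "n = 1")
    case True
    have "card (eis_reps 1) = 6" unfolding eis_reps_1 by simp
    moreover have "{d :: nat. d dvd 1} = {1}" by auto
    ultimately show ?thesis using True by (simp add: divisor_chi_def chi3_def)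
  next
    case False
    then obtain p m where p: "prime p" and n: "n = p * m"
      by (metis dvdE prime_factor_nat)
    have m: "0 < m" "m < n" using less.prems n prime_gt_1_nat[OF p] by auto
    have "int (card (eis_reps (m div p))) = 6 * divisor_chi (m div p)" if "p dvd m"
      using that m prime_gt_0_nat[OF p] by (intro less.IH) (auto dest: dvd_imp_le simp: div_greater_zero_iff le_less_trans[OF div_le_dividend])
    then show ?thesis
      unfolding n card_eis_reps_prime_mult[OF p] divisor_chi_prime_mult[OF p m(1)] less.IH[OF m(2,1)]
      by (simp add: algebra_simps)
  qed
qed

section \<open>Reduced elements: divisible neither by a rational prime nor by
  \<open>\<surd>-3\<close>\<close>

definition eis_red :: "nat \<Rightarrow> (int \<times> int) set" where
  "eis_red m = {z \<in> eis_reps m. coprime (fst z) (snd z) \<and> \<not> 3 dvd m}"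

text \<open>The index set of a Dirichlet convolution at \<open>n\<close>, with the first factor
  running over any weighted set: divisors, pairs \<open>(d, e)\<close> of weight
  \<open>d\<^sup>2 * 3 ^ e\<close>, and pairs \<open>(P, Q)\<close> of weight
  \<open>P * Q\<close>.\<close>

definition conv_pairs :: "'a set \<Rightarrow> ('a \<Rightarrow> nat) \<Rightarrow> nat \<Rightarrow> ('a \<times> nat) set" where
  "conv_pairs X w n = {(x, m). x \<in> X \<and> m \<ge> 1 \<and> w x * m = n}"

lemma finite_conv_pairs:
  assumes "n > 0" "finite {x \<in> X. w x \<le> n}"
  shows "finite (conv_pairs X w n)"
proof (rule finite_subset)
  show "conv_pairs X w n \<subseteq> {x \<in> X. w x \<le> n} \<times> {..n}"
    using assms(1) by (auto simp: conv_pairs_def)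
qed (use assms in auto)

lemma finite_eis_red [simp]: "finite (eis_red m)"
  unfolding eis_red_def using finite_eis_reps by simp

text \<open>A common divisor of the new coordinates divides \<open>3 * a\<close> and
  \<open>3 * b\<close>, hence 3. If it is no unit, then 3 divides \<open>2 * a + b\<close> and with
  it \<open>a - b\<close>, against the hypothesis on the norm.\<close>

lemma coprime_sqrt_m3:
  assumes "coprime a b" "\<not> 3 dvd eis_norm (a, b)"
  shows "coprime (- a - 2 * b) (2 * a + b)"
proof (rule coprimeI)
  fix g assume g: "g dvd - a - 2 * b" "g dvd 2 * a + b"
  have "g dvd 2 * (2 * a + b) + (- a - 2 * b)"
    by (rule dvd_add[OF dvd_mult[OF g(2)] g(1)])
  moreover have "g dvd - 2 * (- a - 2 * b) - (2 * a + b)"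
    by (rule dvd_diff[OF dvd_mult[OF g(1)] g(2)])
  ultimately have "g dvd 3 * a" "g dvd 3 * b" by simp_all
  then have "g dvd gcd (3 * a) (3 * b)" by simp
  also have "gcd (3 * a) (3 * b) = 3" using assms(1) by (simp add: gcd_mult_left)
  finally have g3: "g dvd 3" .
  show "is_unit g"
  proof (rule ccontr)
    assume nu: "\<not> is_unit g"
    obtain k where k: "3 = g * k" using g3 by blast
    have "irreducible (3 :: int)" by (simp add: prime_elem_imp_irreducible)
    then have "is_unit k" using k nu irreducibleD by blast
    then have "3 dvd g" unfolding k by (simp add: mult_unit_dvd_iff)
    then have "3 dvd 2 * a + b" using g(2) by (rule dvd_trans)
    then have "3 dvd a - b" by presburger
    then show False using assms(2) three_dvd_eis_norm_iff by blast
  qed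
qed

text \<open>After division by the gcd of the coordinates, \<open>\<surd>-3\<close> can be split off
  at most once, because its square is -3 and a second factor would make 3 a common divisor.\<close>

lemma eis_decompose:
  assumes "(a, b) \<noteq> (0, 0)"
  obtains d :: nat and e u v where "d \<ge> 1" "e \<in> {0, 1 :: nat}" "coprime u v" "\<not> 3 dvd eis_norm (u, v)"
    "(a, b) = (case (eis_mult (-1, 2) ^^ e) (u, v) of (x, y) \<Rightarrow> (int d * x, int d * y))"
proof -
  define d where "d = gcd a b"
  have d: "d > 0" using assms by (auto simp: d_def)
  obtain a' b' where ab: "a = d * a'" "b = d * b'" "coprime a' b'"
    using gcd_coprime_exists[of a b] d unfolding d_def by (metis mult.commute less_irrefl)
  have nd: "int (nat d) = d" "nat d \<ge> 1" using d by auto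
  show ?thesis
  proof (cases "3 dvd eis_norm (a', b')")
    case False
    then show ?thesis using that[of "nat d" 0 a' b'] ab nd by simp
  next
    case True
    then obtain w where w: "(a', b') = eis_mult (-1, 2) w" by (rule sqrt_m3_dvd)
    obtain u v where uv: "w = (u, v)" by fastforce
    have a': "a' = - u - 2 * v" "b' = 2 * u + v" using w by (auto simp: uv eis_mult_def)
    have "coprime u v"
    proof (rule coprimeI)
      fix g assume g: "g dvd u" "g dvd v"
      then have "g dvd a'" "g dvd b'" unfolding a' by (auto intro!: dvd_add dvd_diff dvd_mult)
      then show "is_unit g" by (rule coprime_common_divisor[OF ab(3)])
    qed
    moreover have "\<not> 3 dvd eis_norm (u, v)"
    proof
      assume "3 dvd eis_norm (u, v)"
      then have "3 dvd u - v" by (simp add: three_dvd_eis_norm_iff)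
      then have "3 dvd a'" "3 dvd b'" unfolding a' by presburger+
      then show False using ab(3) coprime_common_divisor[of a' b' 3] by auto
    qed
    moreover have "(a, b) = (case (eis_mult (-1, 2) ^^ 1) (u, v) of (x, y) \<Rightarrow> (int (nat d) * x, int (nat d) * y))"
      unfolding One_nat_def funpow.simps o_apply id_apply uv[symmetric] w[symmetric] nd(1) prod.case ab(1,2) ..
    ultimately show ?thesis
      using that[of "nat d" 1 u v] nd(2) by blast
  qed
qed

text \<open>\<open>d\<close> is the gcd of the coordinates, \<open>e\<close> tells whether 3 divides
  the norm of what is left, and the rest follows from injectivity of the multiplication by
  \<open>\<surd>-3\<close>.\<close>

lemma eis_decompose_unique:
  fixes d d' :: nat
  assumes "d \<ge> 1" "e \<in> {0, 1 :: nat}" "coprime u v" "\<not> 3 dvd eis_norm (u, v)"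
    and "d' \<ge> 1" "e' \<in> {0, 1 :: nat}" "coprime u' v'" "\<not> 3 dvd eis_norm (u', v')"
    and eq: "(case (eis_mult (-1, 2) ^^ e) (u, v) of (x, y) \<Rightarrow> (int d * x, int d * y))
      = (case (eis_mult (-1, 2) ^^ e') (u', v') of (x, y) \<Rightarrow> (int d' * x, int d' * y))"
  shows "d = d' \<and> e = e' \<and> (u, v) = (u', v')"
proof -
  define M where "M = eis_mult (-1, 2)"
  have inj: "M z = M w \<Longrightarrow> z = w" for z w
    using inj_sqrt_m3 by (auto simp: M_def dest: injD)
  have M3: "3 dvd eis_norm (M z)" for z
    by (simp add: M_def eis_norm_sqrt_m3)
  have cop: "coprime x y"
    if "e \<in> {0, 1 :: nat}" "coprime u v" "\<not> 3 dvd eis_norm (u, v)" "(M ^^ e) (u, v) = (x, y)" for e u v x y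
  proof (cases "e = 0")
    case True
    then show ?thesis using that by simp
  next
    case False
    then have "(x, y) = (- u - 2 * v, 2 * u + v)"
      using that by (simp add: M_def eis_mult_sqrt_m3)
    then show ?thesis using coprime_sqrt_m3[OF that(2,3)] by simp
  qed
  obtain x y x' y' where xy: "(M ^^ e) (u, v) = (x, y)" "(M ^^ e') (u', v') = (x', y')"
    by fastforce
  have dd: "int d * x = int d' * x'" "int d * y = int d' * y'"
    using eq unfolding M_def[symmetric] xy by simp_all
  have "int d = gcd (int d * x) (int d * y)"
    using cop[OF assms(2-4) xy(1)] by (simp add: gcd_mult_left)
  also have "\<dots> = int d'"
    unfolding dd using cop[OF assms(6-8) xy(2)] by (simp add: gcd_mult_left)
  finally have d: "d = d'" by simp
  then have z: "(M ^^ e) (u, v) = (M ^^ e') (u', v')"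
    using dd assms(1) by (simp add: xy)
  have e: "e = e'"
  proof (rule ccontr)
    assume "e \<noteq> e'"
    then consider "e = 0" "e' = 1" | "e = 1" "e' = 0" using assms(2,6) by blast
    then show False
      using z M3[of "(u, v)"] M3[of "(u', v')"] assms(4,8) by cases simp_all
  qed
  then have "(u, v) = (u', v')" using z assms(6) inj by auto
  then show ?thesis using d e by simp
qed

lemma finite_mult_le:
  fixes n :: nat
  assumes "\<And>d e. f d e \<ge> d" "finite E"
  shows "finite {x \<in> {1..} \<times> E. (case x of (d, e) \<Rightarrow> f d e) \<le> n}"
proof (rule finite_subset)
  show "{x \<in> {1..} \<times> E. (case x of (d, e) \<Rightarrow> f d e) \<le> n} \<subseteq> {..n} \<times> E"
    using assms(1) by (auto intro: le_trans)
qed (use assms in auto)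

text \<open>The unique decomposition in counting form: an element with parameters \<open>d\<close>,
  \<open>e\<close> and reduced part \<open>z\<close> has norm \<open>d\<^sup>2 * 3 ^ e\<close> times
  that of \<open>z\<close>.\<close>

lemma card_eis_reps_red:
  assumes n: "n > 0"
  shows "card (eis_reps n)
    = (\<Sum>(x, m) \<in> conv_pairs ({1..} \<times> {0, 1}) (\<lambda>(d, e). d\<^sup>2 * 3 ^ e) n. card (eis_red m))"
    (is "_ = (\<Sum>(x, m) \<in> ?C. _)")
proof -
  define F where "F = (\<lambda>((d, e :: nat), m :: nat) z.
    (case (eis_mult (-1, 2) ^^ e) z of (x, y) \<Rightarrow> (int d * x, int d * y)))"
  have normF: "eis_norm (F ((d, e), m) z) = int (d\<^sup>2 * 3 ^ e) * eis_norm z" if "e \<in> {0, 1}" for d e m z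
    using that by (auto simp: F_def eis_norm_scale eis_norm_sqrt_m3 case_prod_beta)
  have "bij_betw (\<lambda>(k, z). F k z) (SIGMA k:?C. eis_red (snd k)) (eis_reps n)"
  proof (rule bij_betwI')
    fix k l assume k: "k \<in> (SIGMA k:?C. eis_red (snd k))" and l: "l \<in> (SIGMA k:?C. eis_red (snd k))"
    obtain d e m u v where k': "k = (((d, e), m), (u, v))" by (metis prod.exhaust)
    obtain d' e' m' u' v' where l': "l = (((d', e'), m'), (u', v'))" by (metis prod.exhaust)
    show "(case k of (k, z) \<Rightarrow> F k z) = (case l of (k, z) \<Rightarrow> F k z) \<longleftrightarrow> k = l"
    proof
      assume "(case k of (k, z) \<Rightarrow> F k z) = (case l of (k, z) \<Rightarrow> F k z)"
      moreover have "\<not> 3 dvd eis_norm (u, v)" "\<not> 3 dvd eis_norm (u', v')" "int m = eis_norm (u, v)" "int m' = eis_norm (u', v')"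
        using k l by (auto simp: k' l' eis_red_def eis_reps_def int_dvd_int_iff[of 3, simplified])
      ultimately show "k = l"
        using k l eis_decompose_unique[of d e u v d' e' u' v']
        by (simp add: k' l' F_def eis_red_def conv_pairs_def)
    qed simp
  next
    fix k assume k: "k \<in> (SIGMA k:?C. eis_red (snd k))"
    obtain d e m z where k': "k = (((d, e), m), z)" by (metis prod.exhaust)
    show "(case k of (k, z) \<Rightarrow> F k z) \<in> eis_reps n"
      using k normF[of e d m z] by (auto simp: k' eis_reps_def eis_red_def conv_pairs_def)
  next
    fix z assume z: "z \<in> eis_reps n"
    obtain a b where ab: "z = (a, b)" by fastforce
    have "(a, b) \<noteq> (0, 0)" using z n by (auto simp: ab eis_reps_def eis_norm_def)
    then obtain d :: nat and e u v where h: "d \<ge> 1" "e \<in> {0, 1 :: nat}" "coprime u v" "\<not> 3 dvd eis_norm (u, v)"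
      "(a, b) = (case (eis_mult (-1, 2) ^^ e) (u, v) of (x, y) \<Rightarrow> (int d * x, int d * y))"
      by (rule eis_decompose)
    define m where "m = nat (eis_norm (u, v))"
    have m: "int m = eis_norm (u, v)" using eis_norm_nonneg by (simp add: m_def)
    have zF: "z = F ((d, e), m) (u, v)" using h(5) by (simp add: F_def ab)
    then have "int n = int (d\<^sup>2 * 3 ^ e * m)"
      using z normF[OF h(2), of d m "(u, v)"] m by (simp add: eis_reps_def)
    then have nm: "d\<^sup>2 * 3 ^ e * m = n" by linarith
    then have "m \<ge> 1" using n by (cases m) auto
    then have "((d, e), m) \<in> ?C" using h nm by (simp add: conv_pairs_def)
    moreover have "(u, v) \<in> eis_red m"
      using h m by (simp add: eis_red_def eis_reps_def flip: int_dvd_int_iff)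
    ultimately show "\<exists>x\<in>(SIGMA k:?C. eis_red (snd k)). z = (case x of (k, z) \<Rightarrow> F k z)"
      using zF by force
  qed
  then have "card (eis_reps n) = card (SIGMA k:?C. eis_red (snd k))"
    by (metis bij_betw_same_card)
  also have "\<dots> = (\<Sum>k\<in>?C. card (eis_red (snd k)))"
  proof (rule card_SigmaI)
    have "d \<le> d\<^sup>2 * 3 ^ e" for d e :: nat
    proof -
      have "d * 1 \<le> d * (d * 3 ^ e)" by (cases "d = 0") auto
      then show ?thesis by (simp add: power2_eq_square mult.assoc)
    qed
    then show "finite ?C" using n by (intro finite_conv_pairs finite_mult_le) auto
  qed auto
  finally show ?thesis by (simp add: case_prod_beta)
qed

section \<open>Well-rounded sublattices\<close>

text \<open>The determinant in the basis 1, \<open>\<rho>\<close>; its absolute value turns out to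
  be the index of the lattice spanned by \<open>v\<close> and \<open>w\<close>.\<close>

definition edet :: "int \<times> int \<Rightarrow> int \<times> int \<Rightarrow> int" where
  "edet v w = fst v * snd w - snd v * fst w"

text \<open>Twice the real inner product, to stay within the integers. For vectors of equal norm,
  \<open>\<bar>ebil v w\<bar>\<close> at most that norm means an angle between 60 and 120
  degrees.\<close>

definition ebil :: "int \<times> int \<Rightarrow> int \<times> int \<Rightarrow> int" where
  "ebil v w = 2 * fst v * fst w + fst v * snd w + snd v * fst w + 2 * snd v * snd w"

definition eis_scale :: "int \<Rightarrow> int \<times> int \<Rightarrow> int \<times> int" where
  "eis_scale k z = (k * fst z, k * snd z)"

definition plat :: "int \<times> int \<Rightarrow> int \<times> int \<Rightarrow> (int \<times> int) set" where
  "plat v w = range (\<lambda>(i, j). eis_scale i v + eis_scale j w)"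

lemmas eis_defs = edet_def ebil_def eis_scale_def eis_norm_def eis_mult_def

lemma plat_memI: "eis_scale i v + eis_scale j w \<in> plat v w"
  unfolding plat_def by (rule range_eqI[of _ _ "(i, j)"]) simp

lemma plat_memE:
  assumes "u \<in> plat v w"
  obtains i j where "u = eis_scale i v + eis_scale j w"
  using assms by (auto simp: plat_def)

lemma plat_subsetI:
  assumes "v \<in> plat x y" "w \<in> plat x y"
  shows "plat v w \<subseteq> plat x y"
proof
  fix u assume "u \<in> plat v w"
  then obtain i j where u: "u = eis_scale i v + eis_scale j w" by (rule plat_memE)
  obtain a b where v: "v = eis_scale a x + eis_scale b y" using assms(1) by (rule plat_memE)
  obtain c d where w: "w = eis_scale c x + eis_scale d y" using assms(2) by (rule plat_memE)
  have "u = eis_scale (i * a + j * c) x + eis_scale (i * b + j * d) y"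
    by (simp add: u v w eis_scale_def prod_eq_iff algebra_simps)
  then show "u \<in> plat x y" by (simp add: plat_memI)
qed

lemma plat_gens: "v \<in> plat v w" "w \<in> plat v w" "- v \<in> plat v w" "- w \<in> plat v w"
  using plat_memI[of 1 v 0 w] plat_memI[of 0 v 1 w] plat_memI[of "-1" v 0 w] plat_memI[of 0 v "-1" w]
  by (simp_all add: eis_scale_def uminus_prod_def flip: zero_prod_def)

lemma plat_uminus_right: "plat v (- w) = plat v w"
  by (intro equalityI plat_subsetI plat_gens) (use plat_gens(4)[of "- w" v] in \<open>simp_all add: plat_gens(4)[of v "- w", simplified]\<close>)

lemma plat_commute: "plat v w = plat w v"
  by (intro equalityI plat_subsetI plat_gens)

lemma eis_norm_plat:
  "eis_norm (eis_scale i v + eis_scale j w) = i\<^sup>2 * eis_norm v + i * j * ebil v w + j\<^sup>2 * eis_norm w"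
  by (cases v; cases w) (simp add: eis_defs power2_eq_square algebra_simps)

text \<open>Lagrange's identity, for the inner product \<open>ebil v w / 2\<close> and the area
  \<open>edet v w * sqrt 3 / 2\<close>.\<close>

lemma ebil_edet: "(ebil v w)\<^sup>2 + 3 * (edet v w)\<^sup>2 = 4 * eis_norm v * eis_norm w"
  by (cases v; cases w) (simp add: eis_defs power2_eq_square algebra_simps)

text \<open>With \<open>X + Y \<rho>\<close> the product of the conjugate of \<open>v\<close> with \<open>w\<close>, this is \<open>N(v) w = v (X + Y \<rho>)\<close>.\<close>

lemma eis_norm_scale_eq_mult:
  assumes "ebil v w = 2 * X + Y" "edet v w = Y"
  shows "eis_scale (eis_norm v) w = eis_mult v (X, Y)"
proof -
  have X: "X = fst v * fst w + snd v * fst w + snd v * snd w"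
    using assms by (simp add: eis_defs)
  show ?thesis
    unfolding X assms(2)[symmetric] by (cases v; cases w) (simp add: eis_defs power2_eq_square algebra_simps)
qed

lemma quad_pos:
  fixes i j :: int
  assumes "(i, j) \<noteq> (0, 0)"
  shows "i\<^sup>2 + j\<^sup>2 - \<bar>i * j\<bar> \<ge> 1"
proof -
  define q where "q = i\<^sup>2 + j\<^sup>2 - \<bar>i * j\<bar>"
  have "4 * q = (2 * \<bar>i\<bar> - \<bar>j\<bar>)\<^sup>2 + 3 * j\<^sup>2"
    by (simp add: q_def power2_eq_square algebra_simps abs_mult)
  moreover have "(2 * \<bar>i\<bar> - \<bar>j\<bar>)\<^sup>2 + 3 * j\<^sup>2 > 0"
    using assms by (cases "j = 0") (auto intro: add_nonneg_pos)
  ultimately have "4 * q > 0" by (simp only:)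
  then have "q \<ge> 1" by linarith
  then show ?thesis by (simp only: q_def)
qed

text \<open>For such a basis the norm of a combination is at least
  \<open>i\<^sup>2 + j\<^sup>2 - \<bar>i * j\<bar>\<close> times the norm of \<open>v\<close>, and
  this form is positive definite with integer values.\<close>

lemma plat_norm_ge:
  assumes "eis_norm v = eis_norm w" "\<bar>ebil v w\<bar> \<le> eis_norm v"
    and "u \<in> plat v w" "u \<noteq> 0"
  shows "eis_norm v \<le> eis_norm u"
proof -
  obtain i j where u: "u = eis_scale i v + eis_scale j w" using assms(3) by (rule plat_memE)
  have ij: "(i, j) \<noteq> (0, 0)" using assms(4) by (auto simp: u eis_scale_def zero_prod_def)
  have "\<bar>i * j * ebil v w\<bar> \<le> \<bar>i * j\<bar> * eis_norm v"
    unfolding abs_mult[of "i * j"] using assms(2) by (intro mult_left_mono) auto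
  then have "eis_norm u \<ge> (i\<^sup>2 + j\<^sup>2 - \<bar>i * j\<bar>) * eis_norm v"
    unfolding u eis_norm_plat using assms(1) by (simp add: algebra_simps)
  moreover have "(i\<^sup>2 + j\<^sup>2 - \<bar>i * j\<bar>) * eis_norm v \<ge> 1 * eis_norm v"
    using quad_pos[OF ij] eis_norm_nonneg by (intro mult_right_mono)
  ultimately show ?thesis by simp
qed

text \<open>The strict inequality excludes all combinations in which both vectors occur. In the
  hexagonal case, where equality holds, there are six minimal vectors, so this statement is what
  separates the two kinds of lattices.\<close>

lemma plat_norm_eq:
  assumes "eis_norm v = eis_norm w" "\<bar>ebil v w\<bar> < eis_norm v"
    and "u \<in> plat v w" "eis_norm u = eis_norm v"
  shows "u \<in> {v, - v, w, - w}"
proof -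
  obtain i j where u: "u = eis_scale i v + eis_scale j w" using assms(3) by (rule plat_memE)
  have pos: "eis_norm v > 0" using assms(2) by linarith
  have "i * j = 0"
  proof (rule ccontr)
    assume ij: "i * j \<noteq> 0"
    have "\<bar>i * j * ebil v w\<bar> < \<bar>i * j\<bar> * eis_norm v"
      unfolding abs_mult[of "i * j"] using assms(2) ij by (intro mult_strict_left_mono) auto
    then have "eis_norm u > (i\<^sup>2 + j\<^sup>2 - \<bar>i * j\<bar>) * eis_norm v"
      unfolding u eis_norm_plat using assms(1) by (simp add: algebra_simps)
    moreover have "(i\<^sup>2 + j\<^sup>2 - \<bar>i * j\<bar>) * eis_norm v \<ge> 1 * eis_norm v"
      using ij quad_pos[of i j] pos by (intro mult_right_mono) auto
    ultimately show False using assms(4) by simp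
  qed
  then have "(i\<^sup>2 + j\<^sup>2) * eis_norm v = eis_norm v"
    using assms(4) unfolding u eis_norm_plat assms(1)[symmetric] \<open>i * j = 0\<close> by (simp add: algebra_simps)
  then have "i\<^sup>2 + j\<^sup>2 = 1" using pos by simp
  with \<open>i * j = 0\<close> have "(i = 0 \<and> (j = 1 \<or> j = -1)) \<or> (j = 0 \<and> (i = 1 \<or> i = -1))"
    by (auto simp: power2_eq_1_iff)
  then show ?thesis
    by (auto simp: u eis_scale_def uminus_prod_def prod_eq_iff)
qed

text \<open>For \<open>n > 0\<close> these are the bases formed by two independent minimal vectors
  of a well-rounded lattice of index \<open>n\<close>.\<close>

definition wr_basis :: "nat \<Rightarrow> int \<times> int \<Rightarrow> int \<times> int \<Rightarrow> bool" where
  "wr_basis n v w \<longleftrightarrow> eis_norm v = eis_norm w \<and> \<bar>ebil v w\<bar> \<le> eis_norm v \<and> \<bar>edet v w\<bar> = int n"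

definition hex_lats :: "nat \<Rightarrow> (int \<times> int) set set" where
  "hex_lats n = (\<lambda>z. range (eis_mult z)) ` eis_reps n"

definition rhombic_lats :: "nat \<Rightarrow> (int \<times> int) set set" where
  "rhombic_lats n = {plat v w | v w. wr_basis n v w \<and> \<bar>ebil v w\<bar> < eis_norm v}"

text \<open>The listed \<open>u\<close> are the units other than 1 and -1, and each of them
  generates the ring together with 1.\<close>

lemma range_eis_mult_eq_plat:
  assumes "u \<in> {(0, 1), (1, -1), (-1, 1), (0, -1)}"
  shows "range (eis_mult v) = plat v (eis_mult v u)"
proof (intro equalityI subsetI)
  fix x assume "x \<in> range (eis_mult v)"
  then obtain a b where x: "x = eis_mult v (a, b)" by auto
  \<comment> \<open>\<open>snd u\<close> is 1 or -1, hence its own inverse.\<close>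
  define j where "j = b * snd u"
  define i where "i = a - j * fst u"
  have "x = eis_scale i v + eis_scale j (eis_mult v u)"
    using assms by (cases v) (auto simp: x i_def j_def eis_defs algebra_simps)
  then show "x \<in> plat v (eis_mult v u)" by (simp add: plat_memI)
next
  fix x assume "x \<in> plat v (eis_mult v u)"
  then obtain i j where x: "x = eis_scale i v + eis_scale j (eis_mult v u)" by (rule plat_memE)
  have "x = eis_mult v (i + j * fst u, j * snd u)"
    by (cases v; cases u) (simp add: x eis_defs algebra_simps)
  then show "x \<in> range (eis_mult v)" by simp
qed

text \<open>If \<open>\<bar>ebil v w\<bar>\<close> equals the norm, Lagrange's identity makes
  \<open>\<bar>edet v w\<bar>\<close> equal to it as well. The quotient of \<open>w\<close> by
  \<open>v\<close> is then a unit other than 1 and -1, and the lattice is an ideal.\<close>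

lemma wr_plat_cases:
  assumes n: "n > 0"
  shows "{plat v w | v w. wr_basis n v w} = hex_lats n \<union> rhombic_lats n"
proof (intro equalityI subsetI)
  fix \<Gamma> assume "\<Gamma> \<in> {plat v w | v w. wr_basis n v w}"
  then obtain v w where \<Gamma>: "\<Gamma> = plat v w" and wr: "wr_basis n v w" by blast
  define k where "k = eis_norm v"
  show "\<Gamma> \<in> hex_lats n \<union> rhombic_lats n"
  proof (cases "\<bar>ebil v w\<bar> < k")
    case True
    then show ?thesis using \<Gamma> wr unfolding rhombic_lats_def k_def by blast
  next
    case False
    then have b: "\<bar>ebil v w\<bar> = k" using wr by (simp add: wr_basis_def k_def)
    then have "k\<^sup>2 = (ebil v w)\<^sup>2" by (metis power2_abs)
    then have "3 * (edet v w)\<^sup>2 = 3 * k\<^sup>2"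
      using ebil_edet[of v w] wr by (simp add: wr_basis_def k_def power2_eq_square)
    then have d: "\<bar>edet v w\<bar> = k"
      using eis_norm_nonneg[of v] by (simp add: k_def power2_eq_iff abs_eq_iff) (auto simp: abs_if)
    then have kn: "k = int n" using wr by (simp add: wr_basis_def)
    define X where "X = (ebil v w - edet v w) div 2"
    have "ebil v w = edet v w \<or> ebil v w = - edet v w" using b d by linarith
    then have "even (ebil v w - edet v w)" by auto
    then have X: "ebil v w = 2 * X + edet v w" by (simp add: X_def)
    obtain u where u: "u \<in> {(0, 1), (1, -1), (-1, 1), (0, -1)}" "(X, edet v w) = eis_scale k u"
    proof -
      consider "ebil v w = k" "edet v w = k" | "ebil v w = k" "edet v w = - k"
        | "ebil v w = - k" "edet v w = k" | "ebil v w = - k" "edet v w = - k"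
        using b d by linarith
      then show ?thesis
      proof cases
        case 1
        then show ?thesis using X that[of "(0, 1)"] by (simp add: eis_scale_def)
      next
        case 2
        then show ?thesis using X that[of "(1, -1)"] by (simp add: eis_scale_def)
      next
        case 3
        then show ?thesis using X that[of "(-1, 1)"] by (simp add: eis_scale_def)
      next
        case 4
        then show ?thesis using X that[of "(0, -1)"] by (simp add: eis_scale_def)
      qed
    qed
    have "eis_scale k w = eis_mult v (eis_scale k u)"
      using eis_norm_scale_eq_mult[OF X refl] u(2) by (simp add: k_def)
    also have "\<dots> = eis_scale k (eis_mult v u)"
      by (cases v; cases u) (simp add: eis_defs algebra_simps)
    finally have "w = eis_mult v u"
      using n kn by (simp add: eis_scale_def prod_eq_iff)
    then have "\<Gamma> = range (eis_mult v)" using range_eis_mult_eq_plat[OF u(1)] \<Gamma> by simp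
    moreover have "v \<in> eis_reps n" using kn by (simp add: k_def eis_reps_def)
    ultimately show ?thesis by (auto simp: hex_lats_def)
  qed
next
  fix \<Gamma> assume "\<Gamma> \<in> hex_lats n \<union> rhombic_lats n"
  then show "\<Gamma> \<in> {plat v w | v w. wr_basis n v w}"
  proof
    assume "\<Gamma> \<in> hex_lats n"
    then obtain z where z: "eis_norm z = int n" "\<Gamma> = range (eis_mult z)"
      by (auto simp: hex_lats_def eis_reps_def)
    then have "\<Gamma> = plat z (eis_mult z (0, 1))" by (simp add: range_eis_mult_eq_plat)
    moreover have "wr_basis n z (eis_mult z (0, 1))"
    proof -
      have "ebil z (eis_mult z (0, 1)) = eis_norm z" "edet z (eis_mult z (0, 1)) = eis_norm z"
        "eis_norm (eis_mult z (0, 1)) = eis_norm z"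
        by (cases z; simp add: eis_defs power2_eq_square algebra_simps)+
      then show ?thesis using z by (simp add: wr_basis_def)
    qed
    ultimately show ?thesis by blast
  qed (auto simp: rhombic_lats_def)
qed

text \<open>An ideal has the minimal vectors \<open>z\<close> and \<open>z\<close> times
  \<open>\<rho>\<close>, for which \<open>ebil\<close> equals the norm. Among the four minimal
  vectors of a rhombic lattice \<open>\<bar>ebil\<bar>\<close> is either twice the norm or strictly
  below it.\<close>

lemma hex_rhombic_disjoint:
  assumes n: "n > 0"
  shows "hex_lats n \<inter> rhombic_lats n = {}"
proof (rule ccontr)
  assume "hex_lats n \<inter> rhombic_lats n \<noteq> {}"
  then obtain z v w where z: "eis_norm z = int n" and eq: "range (eis_mult z) = plat v w"
    and wr: "wr_basis n v w" "\<bar>ebil v w\<bar> < eis_norm v"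
    by (auto simp: hex_lats_def rhombic_lats_def eis_reps_def)
  have wr': "eis_norm v = eis_norm w" using wr by (simp add: wr_basis_def)
  have pos: "eis_norm v > 0" using wr by linarith
  define y where "y = eis_mult z (0, 1)"
  have zy: "z \<in> plat v w" "y \<in> plat v w"
  proof -
    have "z = eis_mult z (1, 0)" by (cases z) (simp add: eis_mult_def)
    then show "z \<in> plat v w" unfolding eq[symmetric] by blast
    show "y \<in> plat v w" unfolding eq[symmetric] y_def by blast
  qed
  have y: "eis_norm y = eis_norm z" "ebil z y = eis_norm z"
    unfolding y_def by (cases z; simp add: eis_defs power2_eq_square algebra_simps)+
  have "z \<noteq> 0" using z n by (auto simp: eis_norm_def zero_prod_def)
  then have "eis_norm v \<le> eis_norm z"
    using wr(2) by (intro plat_norm_ge[OF wr' _ zy(1)]) auto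
  moreover have "eis_norm z \<le> eis_norm v"
  proof -
    have "v \<in> range (eis_mult z)" unfolding eq by (rule plat_gens)
    then obtain u where u: "v = eis_mult z u" by blast
    then have "eis_norm v = eis_norm z * eis_norm u" by (simp add: eis_norm_mult)
    moreover from this have "eis_norm u \<ge> 1" using pos z eis_norm_nonneg[of u] by (cases "eis_norm u = 0") auto
    ultimately show ?thesis using z mult_left_mono[of 1 "eis_norm u" "eis_norm z"] by simp
  qed
  ultimately have N: "eis_norm z = eis_norm v" by simp
  have "z \<in> {v, - v, w, - w}" "y \<in> {v, - v, w, - w}"
    using plat_norm_eq[OF wr' wr(2)] zy N y(1) by auto
  moreover have "ebil v v = 2 * eis_norm v" "ebil w w = 2 * eis_norm w" "ebil w v = ebil v w"
    by (cases v; cases w; simp add: eis_defs power2_eq_square algebra_simps)+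
  moreover have "ebil (- a) b = - ebil a b" "ebil a (- b) = - ebil a b" for a b
    by (simp_all add: ebil_def)
  ultimately show False
    using y(2) wr(2) wr' N pos by (elim insertE emptyE) simp_all
qed

lemma eis_mult_commute: "eis_mult z w = eis_mult w z"
  by (cases z; cases w) (simp add: eis_mult_def algebra_simps)

lemma eis_mult_assoc: "eis_mult (eis_mult z w) u = eis_mult z (eis_mult w u)"
  by (cases z; cases w; cases u) (simp add: eis_mult_def algebra_simps)

lemma inj_eis_mult:
  assumes "eis_norm z \<noteq> 0"
  shows "inj (eis_mult z)"
proof (rule injI)
  fix x y assume "eis_mult z x = eis_mult z y"
  then have "eis_mult z (x - y) = (0, 0)"
    by (cases z; cases x; cases y) (simp add: eis_mult_def algebra_simps)
  then have "eis_norm z * eis_norm (x - y) = 0"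
    by (metis eis_norm_mult eis_norm_eq_0_iff)
  then have "x - y = (0, 0)" using assms by (simp only: mult_eq_0_iff eis_norm_eq_0_iff simp_thms)
  then show "x = y" by (simp add: prod_eq_iff)
qed

text \<open>Two generators of the same ideal differ by one of the six units.\<close>

lemma card_hex_lats:
  assumes n: "n > 0"
  shows "card (eis_reps n) = 6 * card (hex_lats n)" "finite (hex_lats n)"
proof -
  have fib: "{z' \<in> eis_reps n. range (eis_mult z') = range (eis_mult z)} = eis_mult z ` eis_reps 1"
    if z: "z \<in> eis_reps n" for z
  proof (intro equalityI subsetI)
    fix y assume y: "y \<in> {z' \<in> eis_reps n. range (eis_mult z') = range (eis_mult z)}"
    have "y = eis_mult y (1, 0)" by (cases y) (simp add: eis_mult_def)
    then have "y \<in> range (eis_mult z)" using y by blast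
    then obtain u where u: "y = eis_mult z u" by blast
    then have "eis_norm u = 1" using z y n eis_norm_mult[of z u] by (simp add: eis_reps_def)
    then show "y \<in> eis_mult z ` eis_reps 1" using u by (simp add: eis_reps_def)
  next
    fix y assume "y \<in> eis_mult z ` eis_reps 1"
    then obtain u where u: "y = eis_mult z u" "eis_norm u = 1" by (auto simp: eis_reps_def)
    \<comment> \<open>The conjugate of \<open>u\<close>, which is its inverse because the norm is
      1.\<close>
    define u' where "u' = (fst u + snd u, - snd u)"
    have "eis_mult u u' = (1, 0)"
      using u(2) by (cases u) (simp add: u'_def eis_mult_def eis_norm_def power2_eq_square algebra_simps)
    then have z': "z = eis_mult y u'"
      by (cases z) (simp add: u(1) eis_mult_assoc, simp add: eis_mult_def)
    have "range (eis_mult y) = range (eis_mult z)"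
    proof (intro equalityI subsetI)
      fix x assume "x \<in> range (eis_mult y)"
      then show "x \<in> range (eis_mult z)" by (auto simp only: u(1) eis_mult_assoc)
    next
      fix x assume "x \<in> range (eis_mult z)"
      then show "x \<in> range (eis_mult y)" by (subst (asm) z') (auto simp only: eis_mult_assoc)
    qed
    moreover have "y \<in> eis_reps n" using u z by (simp add: eis_reps_def eis_norm_mult)
    ultimately show "y \<in> {z' \<in> eis_reps n. range (eis_mult z') = range (eis_mult z)}" by simp
  qed
  have fin: "finite (eis_reps n)" by (rule finite_eis_reps)
  have "card (eis_reps n) = (\<Sum>\<Gamma>\<in>hex_lats n. card {z \<in> eis_reps n. range (eis_mult z) = \<Gamma>})"
    unfolding hex_lats_def card_eq_sum by (rule sum.image_gen[OF fin])
  also have "\<dots> = (\<Sum>\<Gamma>\<in>hex_lats n. 6)"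
  proof (rule sum.cong[OF refl])
    fix \<Gamma> assume "\<Gamma> \<in> hex_lats n"
    then obtain z where z: "z \<in> eis_reps n" "\<Gamma> = range (eis_mult z)" by (auto simp: hex_lats_def)
    have "card (eis_mult z ` eis_reps 1) = card (eis_reps 1)"
      using z n by (intro card_image inj_on_subset[OF inj_eis_mult]) (auto simp: eis_reps_def)
    also have "\<dots> = 6" unfolding eis_reps_1 by simp
    finally show "card {z \<in> eis_reps n. range (eis_mult z) = \<Gamma>} = 6" using fib z by simp
  qed
  finally show "card (eis_reps n) = 6 * card (hex_lats n)" by simp
  show "finite (hex_lats n)" unfolding hex_lats_def using fin by simp
qed

section \<open>Rhombic lattices and their parameters\<close>

definition PQ_pairs :: "(nat \<times> nat) set" where
  "PQ_pairs = {(P, Q). Q < P \<and> P < 3 * Q \<and> even (P + Q)}"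

text \<open>This is \<open>(P + Q \<surd>-3) / 2\<close>, and \<open>rho_M\<close> is
  \<open>(P - Q \<surd>-3) / 2\<close>, written with \<open>\<surd>-3 = 2 \<rho> - 1\<close>; equal
  parity of \<open>P\<close> and \<open>Q\<close> makes the halves integral.\<close>

definition rho_P :: "nat \<times> nat \<Rightarrow> int \<times> int" where
  "rho_P = (\<lambda>(P, Q). ((int P - int Q) div 2, int Q))"

definition rho_M :: "nat \<times> nat \<Rightarrow> int \<times> int" where
  "rho_M = (\<lambda>(P, Q). ((int P + int Q) div 2, - int Q))"

abbreviation "\<theta> \<equiv> eis_mult (-1, 2)"

lemma rho_P_M:
  assumes "(P, Q) \<in> PQ_pairs"
  shows "rho_P (P, Q) + rho_M (P, Q) = (int P, 0)" "rho_P (P, Q) - rho_M (P, Q) = eis_scale (int Q) (-1, 2)"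
    "4 * eis_norm (rho_P (P, Q)) = int P ^ 2 + 3 * int Q ^ 2"
    "4 * eis_norm (rho_M (P, Q)) = int P ^ 2 + 3 * int Q ^ 2"
    "2 * ebil (rho_P (P, Q)) (rho_M (P, Q)) = int P ^ 2 - 3 * int Q ^ 2"
    "edet (rho_P (P, Q)) (rho_M (P, Q)) = - int P * int Q"
proof -
  have "even (int P - int Q)" using assms by (simp add: PQ_pairs_def)
  then obtain t where "int P - int Q = 2 * t" by blast
  then have t: "int P = int Q + 2 * t" by simp
  then have h: "(int P - int Q) div 2 = t" "(int P + int Q) div 2 = int Q + t" by simp_all
  show "rho_P (P, Q) + rho_M (P, Q) = (int P, 0)" "rho_P (P, Q) - rho_M (P, Q) = eis_scale (int Q) (-1, 2)"
    "4 * eis_norm (rho_P (P, Q)) = int P ^ 2 + 3 * int Q ^ 2"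
    "4 * eis_norm (rho_M (P, Q)) = int P ^ 2 + 3 * int Q ^ 2"
    "2 * ebil (rho_P (P, Q)) (rho_M (P, Q)) = int P ^ 2 - 3 * int Q ^ 2"
    "edet (rho_P (P, Q)) (rho_M (P, Q)) = - int P * int Q"
    unfolding rho_P_def rho_M_def prod.case h t
    by (simp_all add: eis_defs power2_eq_square algebra_simps)
qed

lemma eis_mult_bilinear:
  "eis_mult z (x + y) = eis_mult z x + eis_mult z y"
  "eis_mult z (x - y) = eis_mult z x - eis_mult z y"
  "eis_mult (- z) x = - eis_mult z x"
  "eis_mult z (- x) = - eis_mult z x"
  "eis_mult z (eis_scale k x) = eis_scale k (eis_mult z x)"
  "ebil (eis_mult z x) (eis_mult z y) = eis_norm z * ebil x y"
  "edet (eis_mult z x) (eis_mult z y) = eis_norm z * edet x y"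
  by (cases z; cases x; cases y; simp add: eis_defs power2_eq_square algebra_simps)+

definition rhombic_lat :: "((nat \<times> nat) \<times> nat) \<times> int \<times> int \<Rightarrow> (int \<times> int) set" where
  "rhombic_lat = (\<lambda>((k, m), z). plat (eis_mult z (rho_P k)) (eis_mult z (rho_M k)))"

definition rhombic_params :: "nat \<Rightarrow> (((nat \<times> nat) \<times> nat) \<times> int \<times> int) set" where
  "rhombic_params n = (SIGMA k:conv_pairs PQ_pairs (\<lambda>(P, Q). P * Q) n. eis_red (snd k))"

lemma rhombic_basis:
  assumes "(((P, Q), m), z) \<in> rhombic_params n"
  defines "v \<equiv> eis_mult z (rho_P (P, Q))" and "w \<equiv> eis_mult z (rho_M (P, Q))"
  shows "wr_basis n v w" "\<bar>ebil v w\<bar> < eis_norm v"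
    "v + w = eis_scale (int P) z" "v - w = eis_scale (int Q) (\<theta> z)"
proof -
  have PQ: "(P, Q) \<in> PQ_pairs" "m \<ge> 1" "P * Q * m = n" "eis_norm z = int m"
    using assms by (auto simp: rhombic_params_def conv_pairs_def eis_red_def eis_reps_def)
  note r = rho_P_M[OF PQ(1)]
  have Q: "Q < P" "P < 3 * Q" using PQ(1) by (auto simp: PQ_pairs_def)
  have "int Q ^ 2 < int P ^ 2" "int P ^ 2 < (3 * int Q) ^ 2"
    using Q by (intro power_strict_mono; simp)+
  \<comment> \<open>In terms of \<open>P\<close> and \<open>Q\<close> this reads 2 |P^2 - 3 Q^2| <
    P^2 + 3 Q^2, which amounts to Q^2 < P^2 < 9 Q^2.\<close>
  then have "\<bar>2 * (2 * ebil (rho_P (P, Q)) (rho_M (P, Q)))\<bar> < 4 * eis_norm (rho_P (P, Q))"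
    unfolding r(3,5) by (simp add: power2_eq_square)
  then have b: "\<bar>ebil (rho_P (P, Q)) (rho_M (P, Q))\<bar> < eis_norm (rho_P (P, Q))" by simp
  then show b': "\<bar>ebil v w\<bar> < eis_norm v"
    using PQ(2) unfolding v_def w_def eis_mult_bilinear eis_norm_mult PQ(4) by (simp add: abs_mult)
  have "eis_norm v = eis_norm w"
    using r(3,4) by (simp add: v_def w_def eis_norm_mult)
  moreover have "\<bar>edet v w\<bar> = int n"
    unfolding v_def w_def eis_mult_bilinear r(6) PQ(4) PQ(3)[symmetric] by (simp add: abs_mult)
  ultimately show "wr_basis n v w" using b' by (simp add: wr_basis_def)
  show "v + w = eis_scale (int P) z"
    unfolding v_def w_def eis_mult_bilinear(1)[symmetric] r(1)
    by (cases z) (simp add: eis_defs algebra_simps)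
  show "v - w = eis_scale (int Q) (\<theta> z)"
    unfolding v_def w_def eis_mult_bilinear(2)[symmetric] r(2) eis_mult_bilinear(5)
    by (simp add: eis_mult_commute)
qed

lemma eis_scale_simps:
  "eis_scale (- k) z = - eis_scale k z" "eis_scale k (- z) = - eis_scale k z"
  by (simp_all add: eis_scale_def uminus_prod_def)

text \<open>\<open>eis_decompose_unique\<close> for the exponents (0, 0), (1, 1) and (0, 1). The
  last case prevents the \<open>P\<close>-diagonal of one lattice from being the
  \<open>Q\<close>-diagonal of another.\<close>

lemma rhombic_unique:
  assumes z: "z \<in> eis_red m" "z' \<in> eis_red m'" and d: "d \<ge> 1" "d' \<ge> 1"
  shows "eis_scale (int d) z = eis_scale (int d') z' \<Longrightarrow> d = d' \<and> z = z'"
    "eis_scale (int d) (\<theta> z) = eis_scale (int d') (\<theta> z') \<Longrightarrow> d = d' \<and> z = z'"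
    "eis_scale (int d) z \<noteq> eis_scale (int d') (\<theta> z')"
proof -
  obtain u v u' v' where uv: "z = (u, v)" "z' = (u', v')" by fastforce
  have r: "coprime u v" "coprime u' v'" "\<not> 3 dvd eis_norm (u, v)" "\<not> 3 dvd eis_norm (u', v')"
    using z by (auto simp: uv eis_red_def eis_reps_def int_dvd_int_iff[of 3, simplified])
  have sc: "eis_scale k z = (case z of (x, y) \<Rightarrow> (k * x, k * y))" for k z
    by (simp add: eis_scale_def case_prod_beta)
  note un = eis_decompose_unique[of d _ u v d' _ u' v', OF d(1) _ r(1,3) d(2) _ r(2,4)]
  show "eis_scale (int d) z = eis_scale (int d') z' \<Longrightarrow> d = d' \<and> z = z'"
    using un[of 0 0] by (simp add: uv sc)
  show "eis_scale (int d) (\<theta> z) = eis_scale (int d') (\<theta> z') \<Longrightarrow> d = d' \<and> z = z'"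
    using un[of 1 1] by (simp add: uv sc)
  show "eis_scale (int d) z \<noteq> eis_scale (int d') (\<theta> z')"
    using un[of 0 1] by (auto simp add: uv sc)
qed

lemma uminus_eis_red: "z \<in> eis_red m \<Longrightarrow> - z \<in> eis_red m"
  by (cases z) (auto simp: eis_red_def eis_reps_def eis_norm_def)

text \<open>The lattice determines its minimal vectors and hence its two diagonals up to sign and
  order. The order is fixed by which direction is reduced, so only the sign of \<open>z\<close>
  remains free; this is the factor 2 in \<open>card_rhombic_lats\<close>.\<close>

lemma rhombic_lat_fibre:
  assumes k: "k \<in> rhombic_params n"
  shows "{l \<in> rhombic_params n. rhombic_lat l = rhombic_lat k} = {k, (fst k, - snd k)}"
proof (intro equalityI subsetI)
  obtain P Q m z where k': "k = (((P, Q), m), z)" by (metis prod.exhaust)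
  fix l assume "l \<in> {l \<in> rhombic_params n. rhombic_lat l = rhombic_lat k}"
  then have l: "l \<in> rhombic_params n" "rhombic_lat l = rhombic_lat k" by simp_all
  obtain P' Q' m' z' where l': "l = (((P', Q'), m'), z')" by (metis prod.exhaust)
  define v w where "v = eis_mult z (rho_P (P, Q))" and "w = eis_mult z (rho_M (P, Q))"
  define v' w' where "v' = eis_mult z' (rho_P (P', Q'))" and "w' = eis_mult z' (rho_M (P', Q'))"
  note b = rhombic_basis[OF k[unfolded k'], folded v_def w_def]
  note b' = rhombic_basis[OF l(1)[unfolded l'], folded v'_def w'_def]
  have eq: "plat v w = plat v' w'"
    using l(2) by (simp add: k' l' rhombic_lat_def v_def w_def v'_def w'_def)
  have N: "eis_norm v = eis_norm w" "eis_norm v' = eis_norm w'"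
    using b(1) b'(1) by (simp_all add: wr_basis_def)
  have nz: "v \<noteq> 0" "v' \<noteq> 0" using b(2) b'(2) by (auto simp: eis_norm_def zero_prod_def)
  have "v' \<in> plat v w" "v \<in> plat v' w'"
    using plat_gens(1)[of v w] plat_gens(1)[of v' w'] eq by simp_all
  then have "eis_norm v \<le> eis_norm v'" "eis_norm v' \<le> eis_norm v"
    using plat_norm_ge[OF N(1) less_imp_le[OF b(2)] _ nz(2)]
      plat_norm_ge[OF N(2) less_imp_le[OF b'(2)] _ nz(1)] by blast+
  then have Nv: "eis_norm v' = eis_norm v" by simp
  have "v' \<in> {v, - v, w, - w}" "w' \<in> {v, - v, w, - w}"
  proof -
    have "v' \<in> plat v w" "w' \<in> plat v w" unfolding eq by (rule plat_gens)+
    then show "v' \<in> {v, - v, w, - w}" "w' \<in> {v, - v, w, - w}"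
      using plat_norm_eq[OF N(1) b(2)] Nv N(2) by metis+
  qed
  \<comment> \<open>With \<open>w'\<close> equal to \<open>v'\<close> or \<open>- v'\<close>,
    \<open>\<bar>ebil v' w'\<bar>\<close> would be twice the norm. So one of the two vectors is
    \<open>v\<close> and the other \<open>w\<close>, up to signs, and the diagonals either
    correspond or are exchanged.\<close>
  moreover have "v' + w' \<noteq> 0" "v' - w' \<noteq> 0"
  proof -
    have "ebil v' v' = 2 * eis_norm v'" by (cases v') (simp add: eis_defs power2_eq_square algebra_simps)
    moreover have "ebil v' (- v') = - ebil v' v'" by (simp add: ebil_def)
    moreover have "w' = v' \<or> w' = - v' \<Longrightarrow> \<bar>ebil v' w'\<bar> = \<bar>ebil v' v'\<bar>" using calculation(2) by auto
    ultimately have "\<not> (w' = v' \<or> w' = - v')" using b'(2) eis_norm_nonneg[of v'] by auto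
    then show "v' + w' \<noteq> 0" "v' - w' \<noteq> 0" by (auto simp: add_eq_0_iff)
  qed
  ultimately have "(v' + w' \<in> {v + w, - (v + w)} \<and> v' - w' \<in> {v - w, - (v - w)}) \<or>
    (v' + w' \<in> {v - w, - (v - w)} \<and> v' - w' \<in> {v + w, - (v + w)})"
    by (elim insertE emptyE) simp_all
  moreover have "z \<in> eis_red m" "z' \<in> eis_red m'" "P \<ge> 1" "Q \<ge> 1" "P' \<ge> 1" "Q' \<ge> 1" "P * Q * m = n" "P' * Q' * m' = n"
    using k l(1) by (auto simp: k' l' rhombic_params_def conv_pairs_def PQ_pairs_def)
  moreover note rhombic_unique[OF _ \<open>z' \<in> eis_red m'\<close>, of z m] rhombic_unique[OF _ \<open>z' \<in> eis_red m'\<close>, of "- z" m]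
    uminus_eis_red[OF \<open>z \<in> eis_red m\<close>]
  ultimately have "P = P' \<and> Q = Q' \<and> (z' = z \<or> z' = - z)"
    unfolding b(3,4) b'(3,4) eis_scale_simps(2)[symmetric] eis_mult_bilinear(4)[symmetric]
    by (metis insertE singletonD)
  moreover from this have "m' = m"
    using \<open>P * Q * m = n\<close> \<open>P' * Q' * m' = n\<close> \<open>P \<ge> 1\<close> \<open>Q \<ge> 1\<close> by auto
  ultimately show "l \<in> {k, (fst k, - snd k)}" by (auto simp: k' l')
next
  fix l assume l: "l \<in> {k, (fst k, - snd k)}"
  obtain P Q m z where k': "k = (((P, Q), m), z)" by (metis prod.exhaust)
  have "(((P, Q), m), - z) \<in> rhombic_params n"
    using k uminus_eis_red by (simp add: k' rhombic_params_def)
  moreover have "rhombic_lat (((P, Q), m), - z) = rhombic_lat k"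
    by (simp add: k' rhombic_lat_def eis_mult_bilinear(3) plat_uminus_right plat_commute[of "- _"] plat_commute[of "eis_mult _ (rho_M _)"])
  ultimately show "l \<in> {l \<in> rhombic_params n. rhombic_lat l = rhombic_lat k}"
    using l k by (auto simp: k')
qed

text \<open>Orthogonality makes the norm of \<open>u\<close> times \<open>y\<close> an integral
  multiple of \<open>\<theta> u\<close>. As \<open>\<theta> u\<close> is primitive, which is where 3
  must not divide the norm, that multiple is divisible by the norm. The second claim is the first
  one for \<open>\<theta> y\<close>.\<close>

lemma eis_orthogonal:
  assumes u: "coprime (fst u) (snd u)" "\<not> 3 dvd eis_norm u"
  shows "ebil u y = 0 \<Longrightarrow> \<exists>r. y = eis_scale r (\<theta> u)"
    "ebil (\<theta> u) y = 0 \<Longrightarrow> \<exists>r. y = eis_scale r u"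
proof -
  have *: "\<exists>r. y = eis_scale r (\<theta> u)" if "ebil u y = 0" for y
  proof -
    define X where "X = - (fst u * fst y + snd u * snd y + snd u * fst y)"
    define m where "m = eis_norm u"
    \<comment> \<open>Only the evenness of \<open>edet u y\<close> is taken from here;
      \<open>X\<close> is then redefined with its sign fixed.\<close>
    have Y: "edet u y = 2 * X \<or> edet u y = - 2 * X"
      using that by (auto simp: ebil_def edet_def X_def algebra_simps)
    define X where "X = - edet u y div 2"
    have X: "edet u y = - 2 * X" using Y by (auto simp: X_def)
    then have "eis_scale m y = eis_mult u (X, - 2 * X)"
      unfolding m_def using that by (intro eis_norm_scale_eq_mult) auto
    also have "\<dots> = eis_scale (- X) (\<theta> u)"
      by (cases u) (simp add: eis_defs algebra_simps)
    finally have my: "eis_scale m y = eis_scale (- X) (\<theta> u)" .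
    obtain a b where ab: "\<theta> u = (a, b)" by fastforce
    have "coprime a b"
      using coprime_sqrt_m3[of "fst u" "snd u"] u ab by (cases u) (auto simp: eis_mult_sqrt_m3)
    moreover have "m dvd X * a" "m dvd X * b"
    proof -
      have "X * a = m * - fst y" "X * b = m * - snd y"
        using my by (auto simp: ab eis_scale_def)
      then show "m dvd X * a" "m dvd X * b" by simp_all
    qed
    then have "m dvd gcd (X * a) (X * b)" by simp
    ultimately have "m dvd X" by (simp add: gcd_mult_left)
    then obtain t where "X = m * t" by blast
    moreover have "m \<noteq> 0" using u(2) by (auto simp: m_def)
    ultimately have "m * fst y = m * - (t * fst (\<theta> u))" "m * snd y = m * - (t * snd (\<theta> u))"
      using my by (auto simp: eis_scale_def prod_eq_iff mult.assoc)
    then have "y = eis_scale (- t) (\<theta> u)"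
      using \<open>m \<noteq> 0\<close> unfolding mult_left_cancel[OF \<open>m \<noteq> 0\<close>] by (simp add: eis_scale_def prod_eq_iff)
    then show ?thesis by blast
  qed
  show "ebil u y = 0 \<Longrightarrow> \<exists>r. y = eis_scale r (\<theta> u)" by (rule *)
  assume "ebil (\<theta> u) y = 0"
  moreover have "ebil u (\<theta> y) = - ebil (\<theta> u) y"
    by (simp add: eis_defs case_prod_beta algebra_simps)
  ultimately obtain r where "\<theta> y = eis_scale r (\<theta> u)" using *[of "\<theta> y"] by auto
  then have "\<theta> y = \<theta> (eis_scale r u)" by (simp add: eis_mult_bilinear(5))
  then show "\<exists>r. y = eis_scale r u" using inj_sqrt_m3 by (auto dest: injD)
qed

text \<open>Converse of \<open>rhombic_basis\<close>. The norms of the diagonals are twice the norm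
  of \<open>v\<close> plus or minus \<open>ebil v w\<close>, so the bound on \<open>ebil\<close>
  returns the inequalities between \<open>P\<close> and \<open>Q\<close>.\<close>

lemma rhombic_paramsI:
  fixes P Q :: nat
  assumes "v + w = eis_scale (int P) z" "v - w = eis_scale (int Q) (\<theta> z)" "P > 0" "Q > 0"
    and z: "coprime (fst z) (snd z)" "\<not> 3 dvd eis_norm z"
    and wr: "wr_basis n v w" "\<bar>ebil v w\<bar> < eis_norm v"
  shows "plat v w \<in> rhombic_lat ` rhombic_params n"
proof -
  obtain a b where ab: "z = (a, b)" by fastforce
  define m where "m = nat (eis_norm z)"
  have m: "eis_norm z = int m" using eis_norm_nonneg by (simp add: m_def)
  have mpos: "m > 0" using z(2) m by (cases m) auto
  have N: "eis_norm v = eis_norm w" using wr by (simp add: wr_basis_def)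
  have "eis_norm (v + w) = eis_norm v + ebil v w + eis_norm w" "eis_norm (v - w) = eis_norm v - ebil v w + eis_norm w"
    by (cases v; cases w; simp add: eis_defs power2_eq_square algebra_simps)+
  moreover have "eis_norm (eis_scale k x) = k\<^sup>2 * eis_norm x" for k x
    by (cases x) (simp add: eis_defs power2_eq_square algebra_simps)
  ultimately have e: "2 * eis_norm v + ebil v w = (int P)\<^sup>2 * int m" "2 * eis_norm v - ebil v w = 3 * (int Q)\<^sup>2 * int m"
    using N m by (simp_all add: assms(1,2) eis_norm_sqrt_m3)
  have "3 * (int Q)\<^sup>2 * int m < 3 * ((int P)\<^sup>2 * int m)" "(int P)\<^sup>2 * int m < 3 * (3 * (int Q)\<^sup>2 * int m)"
    unfolding e[symmetric] using wr(2) by (simp_all add: abs_less_iff)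
  then have "(int Q)\<^sup>2 < (int P)\<^sup>2" "(int P)\<^sup>2 < (3 * int Q)\<^sup>2"
    using mpos by (simp_all add: power_mult_distrib)
  then have "int Q < int P" "int P < 3 * int Q"
    using power_less_imp_less_base[of "int Q" 2 "int P"] power_less_imp_less_base[of "int P" 2 "3 * int Q"] by simp_all
  then have QP: "Q < P" "P < 3 * Q" by auto
  \<comment> \<open>Parity: twice \<open>v\<close> has even coordinates, while one coordinate of the
    primitive \<open>z\<close> is odd.\<close>
  have "2 * fst v = int P * a - int Q * (a + 2 * b)" "2 * snd v = int P * b + int Q * (2 * a + b)"
    using assms(1,2) by (auto simp: ab eis_defs prod_eq_iff algebra_simps)
  then have "2 dvd (int P * a - int Q * (a + 2 * b))" "2 dvd int P * b + int Q * (2 * a + b)"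
    by (metis dvd_triv_left)+
  moreover have "odd a \<or> odd b" using z(1) coprime_common_divisor[of a b 2] by (auto simp: ab)
  ultimately have even: "even (P + Q)" by auto
  then have pq: "(P, Q) \<in> PQ_pairs" using QP by (simp add: PQ_pairs_def)
  note r = rho_P_M[OF pq]
  define v' w' where "v' = eis_mult z (rho_P (P, Q))" and "w' = eis_mult z (rho_M (P, Q))"
  have "v' + w' = v + w"
    unfolding v'_def w'_def eis_mult_bilinear(1)[symmetric] r(1) assms(1)
    by (cases z) (simp add: eis_defs algebra_simps)
  moreover have "v' - w' = v - w"
    unfolding v'_def w'_def eis_mult_bilinear(2)[symmetric] r(2) eis_mult_bilinear(5) assms(2)
    by (simp add: eis_mult_commute)
  ultimately have vw: "v' = v" "w' = w" by (auto simp: prod_eq_iff)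
  have "int n = \<bar>edet v' w'\<bar>" using wr(1) by (simp add: vw wr_basis_def)
  also have "\<dots> = int (P * Q * m)"
    unfolding v'_def w'_def eis_mult_bilinear r(6) m by (simp add: abs_mult)
  finally have "P * Q * m = n" by linarith
  then have "(((P, Q), m), z) \<in> rhombic_params n"
    using pq m mpos z by (simp add: rhombic_params_def conv_pairs_def eis_red_def eis_reps_def int_dvd_int_iff[of 3, simplified])
  moreover have "rhombic_lat (((P, Q), m), z) = plat v w"
    unfolding vw[symmetric] by (simp add: rhombic_lat_def v'_def w'_def)
  ultimately show ?thesis by force
qed

lemma wr_basis_swap:
  assumes "wr_basis n v w" "\<bar>ebil v w\<bar> < eis_norm v"
  shows "wr_basis n w v" "\<bar>ebil w v\<bar> < eis_norm w" "wr_basis n v (- w)" "\<bar>ebil v (- w)\<bar> < eis_norm v"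
proof -
  have "ebil w v = ebil v w" "edet w v = - edet v w" "ebil v (- w) = - ebil v w" "edet v (- w) = - edet v w"
    "eis_norm (- w) = eis_norm w"
    by (cases v; cases w; simp add: eis_defs)+
  then show "wr_basis n w v" "\<bar>ebil w v\<bar> < eis_norm w" "wr_basis n v (- w)" "\<bar>ebil v (- w)\<bar> < eis_norm v"
    using assms by (auto simp: wr_basis_def)
qed

text \<open>All sign patterns reduce to positive \<open>r\<close> and \<open>s\<close>: replacing
  \<open>z\<close> by \<open>- z\<close> changes both signs, exchanging \<open>v\<close> and
  \<open>w\<close> changes that of \<open>s\<close> alone.\<close>

lemma rhombic_paramsI':
  fixes r s :: int
  assumes vw: "v + w = eis_scale r z" "v - w = eis_scale s (\<theta> z)"
    and z: "coprime (fst z) (snd z)" "\<not> 3 dvd eis_norm z"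
    and wr: "wr_basis n v w" "\<bar>ebil v w\<bar> < eis_norm v"
  shows "plat v w \<in> rhombic_lat ` rhombic_params n"
proof -
  have N: "eis_norm v = eis_norm w" using wr by (simp add: wr_basis_def)
  have sc0: "eis_scale 0 x = 0" for x by (simp add: eis_scale_def zero_prod_def)
  have "eis_norm (v + w) = eis_norm v + ebil v w + eis_norm w" "eis_norm (v - w) = eis_norm v - ebil v w + eis_norm w"
    by (cases v; cases w; simp add: eis_defs power2_eq_square algebra_simps)+
  then have "eis_norm (v + w) \<noteq> 0" "eis_norm (v - w) \<noteq> 0" using N wr(2) by auto
  then have "v + w \<noteq> 0" "v - w \<noteq> 0" by (auto simp: eis_norm_def zero_prod_def)
  then have "r \<noteq> 0" "s \<noteq> 0" using vw sc0 by metis+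
  have z': "coprime (fst (- z)) (snd (- z))" "\<not> 3 dvd eis_norm (- z)"
    using z by (cases z; simp add: eis_norm_def)+
  note sc = eis_scale_simps eis_mult_bilinear(4)
  have p: "int (nat \<bar>x\<bar>) = \<bar>x\<bar>" "nat \<bar>x\<bar> > 0" if "x \<noteq> 0" for x using that by auto
  note wr' = wr_basis_swap[OF wr]
  have vw': "w + v = eis_scale r z" "w - v = - eis_scale s (\<theta> z)"
    using vw by (simp_all add: add.commute flip: minus_diff_eq[of v w])
  consider "r > 0" "s > 0" | "r < 0" "s < 0" | "r > 0" "s < 0" | "r < 0" "s > 0"
    using \<open>r \<noteq> 0\<close> \<open>s \<noteq> 0\<close> by linarith
  then show ?thesis
  proof cases
    case 1
    then show ?thesis
      using rhombic_paramsI[of v w "nat \<bar>r\<bar>" z "nat \<bar>s\<bar>" n] vw z wr by simp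
  next
    case 2
    then show ?thesis
      using rhombic_paramsI[of v w "nat \<bar>r\<bar>" "- z" "nat \<bar>s\<bar>" n] vw z' wr by (simp add: sc)
  next
    case 3
    then show ?thesis
      using rhombic_paramsI[of w v "nat \<bar>r\<bar>" z "nat \<bar>s\<bar>" n] vw' z wr' by (simp add: sc plat_commute)
  next
    case 4
    then show ?thesis
      using rhombic_paramsI[of w v "nat \<bar>r\<bar>" "- z" "nat \<bar>s\<bar>" n] vw' z' wr' by (simp add: sc plat_commute)
  qed
qed

text \<open>Equal norms make \<open>v + w\<close> and \<open>v - w\<close> orthogonal. Decomposing
  the sum yields \<open>z\<close>, and \<open>eis_orthogonal\<close> then gives the direction of the
  difference.\<close>

lemma rhombic_lats_eq: "rhombic_lats n = rhombic_lat ` rhombic_params n"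
proof (intro equalityI subsetI)
  fix \<Gamma> assume "\<Gamma> \<in> rhombic_lats n"
  then obtain v w where \<Gamma>: "\<Gamma> = plat v w" and wr: "wr_basis n v w" "\<bar>ebil v w\<bar> < eis_norm v"
    by (auto simp: rhombic_lats_def)
  have N: "eis_norm v = eis_norm w" using wr by (simp add: wr_basis_def)
  have "eis_norm (v + w) = eis_norm v + ebil v w + eis_norm w"
    by (cases v; cases w; simp add: eis_defs power2_eq_square algebra_simps)
  then have "eis_norm (v + w) \<noteq> 0" using N wr(2) by auto
  then have s0: "(fst (v + w), snd (v + w)) \<noteq> (0, 0)" unfolding prod.collapse eis_norm_eq_0_iff .
  obtain d :: nat and e x y where h: "d \<ge> 1" "e \<in> {0, 1 :: nat}" "coprime x y" "\<not> 3 dvd eis_norm (x, y)"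
    "(fst (v + w), snd (v + w)) = (case (\<theta> ^^ e) (x, y) of (x, y) \<Rightarrow> (int d * x, int d * y))"
    by (rule eis_decompose[OF s0])
  define z where "z = (x, y)"
  have z: "coprime (fst z) (snd z)" "\<not> 3 dvd eis_norm z" using h by (simp_all add: z_def)
  have s: "v + w = eis_scale (int d) ((\<theta> ^^ e) z)"
    using h(5) by (simp add: z_def eis_scale_def case_prod_beta prod_eq_iff)
  have "ebil (v + w) (v - w) = 2 * eis_norm v - 2 * eis_norm w"
    by (cases v; cases w) (simp add: eis_defs power2_eq_square algebra_simps)
  moreover have "ebil (v + w) (v - w) = int d * ebil ((\<theta> ^^ e) z) (v - w)"
    unfolding s by (simp add: ebil_def eis_scale_def algebra_simps)
  ultimately have o: "ebil ((\<theta> ^^ e) z) (v - w) = 0" using N h(1) by simp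
  show "\<Gamma> \<in> rhombic_lat ` rhombic_params n"
  proof (cases "e = 0")
    case True
    then obtain r where "v - w = eis_scale r (\<theta> z)" using o eis_orthogonal(1)[OF z, of "v - w"] by auto
    then show ?thesis using True s rhombic_paramsI'[OF _ _ z wr] unfolding \<Gamma> by auto
  next
    case False
    then have e: "e = 1" using h(2) by simp
    then obtain r where "v - w = eis_scale r z" using o eis_orthogonal(2)[OF z, of "v - w"] by auto
    \<comment> \<open>Here the sum lies along \<open>\<theta> z\<close> and the difference along
      \<open>z\<close>; passing to \<open>- w\<close> exchanges the diagonals without changing the
      lattice.\<close>
    then have "plat v (- w) \<in> rhombic_lat ` rhombic_params n"
      using e s by (intro rhombic_paramsI'[OF _ _ z wr_basis_swap(3,4)[OF wr], of r "int d"]) auto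
    then show ?thesis by (simp add: \<Gamma> plat_uminus_right)
  qed
next
  fix \<Gamma> assume "\<Gamma> \<in> rhombic_lat ` rhombic_params n"
  then obtain k where k: "k \<in> rhombic_params n" "\<Gamma> = rhombic_lat k" by blast
  obtain P Q m z where k': "k = (((P, Q), m), z)" by (metis prod.exhaust)
  have "\<Gamma> = plat (eis_mult z (rho_P (P, Q))) (eis_mult z (rho_M (P, Q)))"
    by (simp add: k k' rhombic_lat_def)
  then show "\<Gamma> \<in> rhombic_lats n"
    using rhombic_basis(1,2)[OF k(1)[unfolded k']] unfolding rhombic_lats_def by blast
qed

lemma PQ_pairs_finite: "finite {k \<in> PQ_pairs. (case k of (P, Q) \<Rightarrow> P * Q) \<le> n}"
proof (rule finite_subset)
  show "{k \<in> PQ_pairs. (case k of (P, Q) \<Rightarrow> P * Q) \<le> n} \<subseteq> {..n} \<times> {..n}"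
  proof clarify
    fix P Q assume "(P, Q) \<in> PQ_pairs" "P * Q \<le> n"
    then have "Q \<ge> 1" "P \<ge> 1" by (auto simp: PQ_pairs_def)
    then have "P \<le> P * Q" "Q \<le> P * Q" by simp_all
    then show "P \<in> {..n} \<and> Q \<in> {..n}"
      using le_trans[OF _ \<open>P * Q \<le> n\<close>] unfolding atMost_iff by blast
  qed
qed simp

lemma card_rhombic_lats:
  assumes n: "n > 0"
  shows "2 * card (rhombic_lats n) = (\<Sum>(k, m) \<in> conv_pairs PQ_pairs (\<lambda>(P, Q). P * Q) n. card (eis_red m))"
    "finite (rhombic_lats n)"
proof -
  have fin: "finite (conv_pairs PQ_pairs (\<lambda>(P, Q). P * Q) n)"
    using n PQ_pairs_finite by (intro finite_conv_pairs) auto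
  then have fp: "finite (rhombic_params n)"
    unfolding rhombic_params_def by (intro finite_SigmaI) auto
  have "card (rhombic_params n) = (\<Sum>\<Gamma>\<in>rhombic_lats n. card {k \<in> rhombic_params n. rhombic_lat k = \<Gamma>})"
    unfolding rhombic_lats_eq card_eq_sum by (rule sum.image_gen[OF fp])
  also have "\<dots> = (\<Sum>\<Gamma>\<in>rhombic_lats n. 2)"
  proof (rule sum.cong[OF refl])
    fix \<Gamma> assume "\<Gamma> \<in> rhombic_lats n"
    then obtain k where k: "k \<in> rhombic_params n" "\<Gamma> = rhombic_lat k" by (auto simp: rhombic_lats_eq)
    have "- snd k \<noteq> snd k"
    proof
      assume "- snd k = snd k"
      then have "snd k = (0, 0)" by (simp add: prod_eq_iff)
      then show False using k(1) by (auto simp: rhombic_params_def eis_red_def)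
    qed
    then have "k \<noteq> (fst k, - snd k)" by (metis snd_conv)
    then show "card {l \<in> rhombic_params n. rhombic_lat l = \<Gamma>} = 2"
      unfolding k(2) rhombic_lat_fibre[OF k(1)] by simp
  qed
  finally have "2 * card (rhombic_lats n) = card (rhombic_params n)" by simp
  also have "\<dots> = (\<Sum>k \<in> conv_pairs PQ_pairs (\<lambda>(P, Q). P * Q) n. card (eis_red (snd k)))"
    unfolding rhombic_params_def using fin by (intro card_SigmaI) auto
  finally show "2 * card (rhombic_lats n) = (\<Sum>(k, m) \<in> conv_pairs PQ_pairs (\<lambda>(P, Q). P * Q) n. card (eis_red m))"
    by (simp add: case_prod_beta)
  show "finite (rhombic_lats n)" unfolding rhombic_lats_eq using fp by simp
qed

section \<open>Sublattices in the complex plane: index and minimal vectors\<close>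

definition eis_val :: "int \<times> int \<Rightarrow> complex" where
  "eis_val z = of_int (fst z) + of_int (snd z) * rho"

lemma rho_components: "Re rho = 1 / 2" "Im rho = sqrt 3 / 2"
  by (simp_all add: rho_def)

lemma eis_val_components:
  "Re (eis_val z) = of_int (fst z) + of_int (snd z) / 2" "Im (eis_val z) = of_int (snd z) * (sqrt 3 / 2)"
  by (simp_all add: eis_val_def rho_components)

lemma inj_eis_val: "inj eis_val"
  by (rule injI) (simp add: complex_eq_iff eis_val_components prod_eq_iff)

lemma eis_val_arith:
  "eis_val (z + w) = eis_val z + eis_val w" "eis_val (z - w) = eis_val z - eis_val w"
  "eis_val (- z) = - eis_val z" "eis_val 0 = 0" "eis_val (eis_scale k z) = of_int k * eis_val z"
  by (simp_all add: eis_val_def algebra_simps eis_scale_def)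

lemma eis_val_eq_0_iff: "eis_val z = 0 \<longleftrightarrow> z = 0"
  by (metis inj_eis_val eis_val_arith(4) injD)

lemma norm_eis_val: "(norm (eis_val z))\<^sup>2 = of_int (eis_norm z)"
  unfolding cmod_power2 eis_val_components
  by (simp add: eis_norm_def case_prod_beta power_mult_distrib power_divide power2_sum field_simps)

lemma norm_eis_val_le_iff: "norm (eis_val z) \<le> norm (eis_val w) \<longleftrightarrow> eis_norm z \<le> eis_norm w"
proof -
  have "norm (eis_val z) \<le> norm (eis_val w) \<longleftrightarrow> (norm (eis_val z))\<^sup>2 \<le> (norm (eis_val w))\<^sup>2"
    by (simp add: power2_le_iff_abs_le)
  then show ?thesis by (simp add: norm_eis_val)
qed

lemma hexagonal_lattice_eq: "hexagonal_lattice = range eis_val"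
proof (intro equalityI subsetI)
  fix x assume "x \<in> hexagonal_lattice"
  then obtain a b where "x = of_int a + of_int b * rho" by (auto simp: hexagonal_lattice_def)
  then have "x = eis_val (a, b)" by (simp add: eis_val_def)
  then show "x \<in> range eis_val" by simp
qed (auto simp: hexagonal_lattice_def eis_val_def)

lemma edet_eis_val: "Im (cnj (eis_val v) * eis_val w) = of_int (edet v w) * (sqrt 3 / 2)"
  by (simp add: eis_val_components edet_def field_simps)

lemma eis_norm_add_diff:
  "eis_norm (v + w) = eis_norm v + ebil v w + eis_norm w" "eis_norm (v - w) = eis_norm v - ebil v w + eis_norm w"
  by (cases v; cases w; simp add: eis_defs power2_eq_square algebra_simps)+

lemma hexagonal_lattice_closed:
  "0 \<in> hexagonal_lattice"
  "x \<in> hexagonal_lattice \<Longrightarrow> y \<in> hexagonal_lattice \<Longrightarrow> x + y \<in> hexagonal_lattice"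
  "x \<in> hexagonal_lattice \<Longrightarrow> - x \<in> hexagonal_lattice"
proof -
  show "0 \<in> hexagonal_lattice"
    unfolding hexagonal_lattice_eq using eis_val_arith(4) by (rule range_eqI[OF sym])
next
  assume "x \<in> hexagonal_lattice" "y \<in> hexagonal_lattice"
  then obtain z w where "x = eis_val z" "y = eis_val w" unfolding hexagonal_lattice_eq by blast
  then have "x + y = eis_val (z + w)" by (simp only: eis_val_arith)
  then show "x + y \<in> hexagonal_lattice" unfolding hexagonal_lattice_eq by (rule range_eqI)
next
  assume "x \<in> hexagonal_lattice"
  then obtain z where "x = eis_val z" unfolding hexagonal_lattice_eq by blast
  then have "- x = eis_val (- z)" by (simp only: eis_val_arith)
  then show "- x \<in> hexagonal_lattice" unfolding hexagonal_lattice_eq by (rule range_eqI)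
qed

lemma hexagonal_group_simps:
  "carrier hexagonal_group = hexagonal_lattice"
  "x \<otimes>\<^bsub>hexagonal_group\<^esub> y = x + y" "\<one>\<^bsub>hexagonal_group\<^esub> = 0"
  by (simp_all add: hexagonal_group_def)

interpretation hex: comm_group hexagonal_group
proof (rule comm_groupI)
  fix x assume x: "x \<in> carrier hexagonal_group"
  then have "- x \<in> carrier hexagonal_group"
    unfolding hexagonal_group_simps by (rule hexagonal_lattice_closed)
  moreover have "- x \<otimes>\<^bsub>hexagonal_group\<^esub> x = \<one>\<^bsub>hexagonal_group\<^esub>"
    by (simp add: hexagonal_group_simps)
  ultimately show "\<exists>y\<in>carrier hexagonal_group. y \<otimes>\<^bsub>hexagonal_group\<^esub> x = \<one>\<^bsub>hexagonal_group\<^esub>"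
    by blast
qed (simp_all add: hexagonal_group_simps hexagonal_lattice_closed)

lemma hex_inv: "x \<in> hexagonal_lattice \<Longrightarrow> inv\<^bsub>hexagonal_group\<^esub> x = - x"
proof -
  assume x: "x \<in> hexagonal_lattice"
  then have "- x \<in> hexagonal_lattice" by (rule hexagonal_lattice_closed)
  with x show ?thesis
    using hex.inv_equality[of "- x" x] by (simp only: hexagonal_group_simps add.left_inverse)
qed

lemma subgroup_hexagonal_iff:
  "subgroup \<Gamma> hexagonal_group \<longleftrightarrow> \<Gamma> \<subseteq> hexagonal_lattice \<and> 0 \<in> \<Gamma> \<and> (\<forall>x\<in>\<Gamma>. \<forall>y\<in>\<Gamma>. x - y \<in> \<Gamma>)"
  (is "_ \<longleftrightarrow> ?R")
proof
  assume s: "subgroup \<Gamma> hexagonal_group"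
  then interpret subgroup \<Gamma> hexagonal_group .
  have sub: "\<Gamma> \<subseteq> hexagonal_lattice" using subset by (simp add: hexagonal_group_simps)
  moreover have "0 \<in> \<Gamma>" using one_closed by (simp add: hexagonal_group_simps)
  moreover have "x - y \<in> \<Gamma>" if "x \<in> \<Gamma>" "y \<in> \<Gamma>" for x y
  proof -
    have "inv\<^bsub>hexagonal_group\<^esub> y = - y" using that sub hex_inv by blast
    then show ?thesis
      using m_closed[OF that(1) m_inv_closed[OF that(2)]] by (simp add: hexagonal_group_simps)
  qed
  ultimately show ?R by blast
next
  assume R: ?R
  have neg: "- y \<in> \<Gamma>" if "y \<in> \<Gamma>" for y
  proof -
    have "0 - y \<in> \<Gamma>" using R that by blast
    then show ?thesis by simp
  qed
  have plus: "x + y \<in> \<Gamma>" if "x \<in> \<Gamma>" "y \<in> \<Gamma>" for x y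
  proof -
    have "x - (- y) \<in> \<Gamma>" using R that neg by blast
    then show ?thesis by simp
  qed
  show "subgroup \<Gamma> hexagonal_group"
  proof (rule hex.subgroupI)
    show "\<Gamma> \<subseteq> carrier hexagonal_group" using R by (simp add: hexagonal_group_simps)
    show "\<Gamma> \<noteq> {}" using R by blast
  next
    fix x assume "x \<in> \<Gamma>"
    then have "inv\<^bsub>hexagonal_group\<^esub> x = - x" using R hex_inv by blast
    then show "inv\<^bsub>hexagonal_group\<^esub> x \<in> \<Gamma>" using neg \<open>x \<in> \<Gamma>\<close> by simp
  qed (simp add: hexagonal_group_simps plus)
qed

lemma subgroup_plat: "subgroup (eis_val ` plat v w) hexagonal_group"
  unfolding subgroup_hexagonal_iff
proof (intro conjI ballI)
  show "eis_val ` plat v w \<subseteq> hexagonal_lattice" by (auto simp: hexagonal_lattice_eq)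
  show "0 \<in> eis_val ` plat v w"
    using plat_memI[of 0 v 0 w] eis_val_arith(4) by (force simp: eis_scale_def zero_prod_def)
  fix x y assume "x \<in> eis_val ` plat v w" "y \<in> eis_val ` plat v w"
  then obtain i j k l where "x = eis_val (eis_scale i v + eis_scale j w)" "y = eis_val (eis_scale k v + eis_scale l w)"
    by (auto elim!: plat_memE)
  then have "x - y = eis_val (eis_scale (i - k) v + eis_scale (j - l) w)"
    by (simp add: eis_val_arith algebra_simps)
  then show "x - y \<in> eis_val ` plat v w" by (simp add: plat_memI)
qed

text \<open>Hermite normal form from a Bezout relation between the second coordinates;
  \<open>x * p + y * q = 1\<close> says that the change of basis is unimodular.\<close>

lemma plat_hnf:
  assumes "edet v w \<noteq> 0"
  obtains a b d where "a > 0" "d > 0" "plat v w = plat (a, 0) (b, d)" "a * d = \<bar>edet v w\<bar>"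
proof -
  define g where "g = gcd (snd v) (snd w)"
  have g: "g > 0" using assms by (auto simp: g_def edet_def)
  obtain x y where xy: "x * snd v + y * snd w = g" unfolding g_def by (metis bezout_int)
  obtain p q where pq: "snd v = g * p" "snd w = g * q" unfolding g_def by (metis gcd_dvd1 gcd_dvd2 dvdE)
  have one: "x * p + y * q = 1"
  proof -
    have "g * (x * p + y * q) = g * 1" using xy by (simp add: pq algebra_simps)
    then show ?thesis using g by simp
  qed
  define c where "c = q * fst v - p * fst w"
  define b where "b = x * fst v + y * fst w"
  have e1: "(c, 0) = eis_scale q v + eis_scale (- p) w" "(b, g) = eis_scale x v + eis_scale y w"
    using xy pq by (auto simp: eis_scale_def c_def b_def prod_eq_iff)
  have "v = eis_scale (x * p + y * q) v" "w = eis_scale (x * p + y * q) w"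
    unfolding one by (simp_all add: eis_scale_def)
  then have e2: "v = eis_scale y (c, 0) + eis_scale p (b, g)" "w = eis_scale (- x) (c, 0) + eis_scale q (b, g)"
    unfolding e1 by (auto simp: eis_scale_def prod_eq_iff algebra_simps)
  have "plat v w = plat (c, 0) (b, g)"
  proof (rule equalityI)
    show "plat v w \<subseteq> plat (c, 0) (b, g)"
      by (rule plat_subsetI) (use plat_memI e2 in metis)+
    show "plat (c, 0) (b, g) \<subseteq> plat v w"
      by (rule plat_subsetI) (use plat_memI e1 in metis)+
  qed
  also have "\<dots> = plat (\<bar>c\<bar>, 0) (b, g)"
  proof (cases "c \<ge> 0")
    case False
    then have "(\<bar>c\<bar>, 0 :: int) = - (c, 0)" by simp
    then show ?thesis by (metis plat_commute plat_uminus_right)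
  qed simp
  finally have eq: "plat v w = plat (\<bar>c\<bar>, 0) (b, g)" .
  have "edet v w = c * g" by (simp add: edet_def c_def pq algebra_simps)
  then have "\<bar>c\<bar> * g = \<bar>edet v w\<bar>" using g by (simp add: abs_mult)
  moreover from this have "\<bar>c\<bar> > 0" using assms by auto
  ultimately show ?thesis using that eq g by blast
qed

text \<open>The box \<open>{0..<a} \<times> {0..<d}\<close> represents the cosets: the second
  coordinate is reduced modulo \<open>d\<close> by subtracting \<open>j\<close> times
  \<open>(b, d)\<close>, afterwards the first one modulo \<open>a\<close>.\<close>

lemma hnf_index:
  fixes a b d :: int
  assumes a: "a > 0" and d: "d > 0"
  defines "\<Gamma> \<equiv> eis_val ` plat (a, 0) (b, d)"
  shows "finite (rcosets\<^bsub>hexagonal_group\<^esub> \<Gamma>)" "int (card (rcosets\<^bsub>hexagonal_group\<^esub> \<Gamma>)) = a * d"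
proof -
  have sg: "subgroup \<Gamma> hexagonal_group" unfolding \<Gamma>_def by (rule subgroup_plat)
  have coset: "\<Gamma> #>\<^bsub>hexagonal_group\<^esub> x = {g + x | g. g \<in> \<Gamma>}" for x
    by (auto simp: r_coset_def hexagonal_group_simps)
  have eq_iff: "\<Gamma> #>\<^bsub>hexagonal_group\<^esub> eis_val z = \<Gamma> #>\<^bsub>hexagonal_group\<^esub> eis_val z' \<longleftrightarrow> z - z' \<in> plat (a, 0) (b, d)" for z z'
  proof
    assume eq: "\<Gamma> #>\<^bsub>hexagonal_group\<^esub> eis_val z = \<Gamma> #>\<^bsub>hexagonal_group\<^esub> eis_val z'"
    have "0 + eis_val z \<in> \<Gamma> #>\<^bsub>hexagonal_group\<^esub> eis_val z"
      using sg unfolding coset subgroup_hexagonal_iff by blast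
    then have "eis_val z \<in> {g + eis_val z' | g. g \<in> \<Gamma>}"
      unfolding eq coset[symmetric] by simp
    then obtain u where "u \<in> plat (a, 0) (b, d)" "eis_val z = eis_val u + eis_val z'"
      unfolding \<Gamma>_def by blast
    moreover from this have "eis_val (z - z') = eis_val u" by (simp add: eis_val_arith)
    ultimately show "z - z' \<in> plat (a, 0) (b, d)" using inj_eis_val by (metis injD)
  next
    assume "z - z' \<in> plat (a, 0) (b, d)"
    then have "eis_val (z - z') \<in> \<Gamma>" by (simp add: \<Gamma>_def)
    then have m: "eis_val z - eis_val z' \<in> \<Gamma>" by (simp add: eis_val_arith)
    have "eis_val z \<in> \<Gamma> #>\<^bsub>hexagonal_group\<^esub> eis_val z'"
      unfolding coset using m by (metis (mono_tags, lifting) diff_add_cancel mem_Collect_eq)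
    then show "\<Gamma> #>\<^bsub>hexagonal_group\<^esub> eis_val z = \<Gamma> #>\<^bsub>hexagonal_group\<^esub> eis_val z'"
      using hex.repr_independence[OF _ _ sg] by (metis hexagonal_group_simps(1) hexagonal_lattice_eq rangeI)
  qed
  have mem: "(x, y) \<in> plat (a, 0) (b, d) \<longleftrightarrow> (\<exists>j. y = j * d \<and> a dvd x - j * b)" for x y
  proof
    assume "(x, y) \<in> plat (a, 0) (b, d)"
    then show "\<exists>j. y = j * d \<and> a dvd x - j * b" by (auto elim!: plat_memE simp: eis_scale_def)
  next
    assume "\<exists>j. y = j * d \<and> a dvd x - j * b"
    then obtain j i where "y = j * d" "x - j * b = a * i" by blast
    then have "(x, y) = eis_scale i (a, 0) + eis_scale j (b, d)" by (simp add: eis_scale_def algebra_simps)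
    then show "(x, y) \<in> plat (a, 0) (b, d)" by (metis plat_memI)
  qed
  have "bij_betw (\<lambda>z. \<Gamma> #>\<^bsub>hexagonal_group\<^esub> eis_val z) ({0..<a} \<times> {0..<d}) (rcosets\<^bsub>hexagonal_group\<^esub> \<Gamma>)"
  proof (rule bij_betwI')
    fix z z' assume z: "z \<in> {0..<a} \<times> {0..<d}" "z' \<in> {0..<a} \<times> {0..<d}"
    obtain x y x' y' where xy: "z = (x, y)" "z' = (x', y')" by fastforce
    have small: "t = 0" if "\<bar>t\<bar> < m" "m dvd t" for t m :: int
      using that by (metis abs_dvd_iff dvd_abs_iff zdvd_not_zless zero_less_abs_iff)
    have "z = z'" if zz: "z - z' \<in> plat (a, 0) (b, d)"
    proof -
      obtain j where j: "y - y' = j * d" "a dvd x - x' - j * b" using zz by (auto simp: xy mem)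
      then have "y - y' = 0" using z by (intro small[of _ d]) (auto simp: xy)
      then have "j = 0" using j d by auto
      then have "x - x' = 0" using j z by (intro small[of _ a]) (auto simp: xy)
      then show ?thesis using \<open>y - y' = 0\<close> by (simp add: xy)
    qed
    then show "(\<Gamma> #>\<^bsub>hexagonal_group\<^esub> eis_val z = \<Gamma> #>\<^bsub>hexagonal_group\<^esub> eis_val z') = (z = z')"
      using eq_iff by blast
  next
    fix z :: "int \<times> int"
    show "\<Gamma> #>\<^bsub>hexagonal_group\<^esub> eis_val z \<in> rcosets\<^bsub>hexagonal_group\<^esub> \<Gamma>"
      unfolding RCOSETS_def hexagonal_group_simps hexagonal_lattice_eq by blast
  next
    fix C assume "C \<in> rcosets\<^bsub>hexagonal_group\<^esub> \<Gamma>"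
    then obtain z where "C = \<Gamma> #>\<^bsub>hexagonal_group\<^esub> eis_val z"
      unfolding RCOSETS_def hexagonal_group_simps hexagonal_lattice_eq by blast
    then obtain x y where C: "C = \<Gamma> #>\<^bsub>hexagonal_group\<^esub> eis_val (x, y)"
      by (cases z) blast
    define j where "j = y div d"
    define x' where "x' = (x - j * b) mod a"
    have "(x, y) - (x', y mod d) \<in> plat (a, 0) (b, d)"
    proof -
      have "y - y mod d = j * d" by (simp add: j_def minus_mod_eq_div_mult)
      moreover have "a dvd x - x' - j * b"
      proof -
        have "x - x' - j * b = (x - j * b) - (x - j * b) mod a" by (simp add: x'_def)
        then show ?thesis by (simp add: minus_mod_eq_mult_div)
      qed
      ultimately show ?thesis by (auto simp: mem)
    qed
    then have "C = \<Gamma> #>\<^bsub>hexagonal_group\<^esub> eis_val (x', y mod d)" unfolding C eq_iff .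
    moreover have "(x', y mod d) \<in> {0..<a} \<times> {0..<d}" using a d by (simp add: x'_def)
    ultimately show "\<exists>z\<in>{0..<a} \<times> {0..<d}. C = \<Gamma> #>\<^bsub>hexagonal_group\<^esub> eis_val z" by blast
  qed
  then have "finite (rcosets\<^bsub>hexagonal_group\<^esub> \<Gamma>) \<longleftrightarrow> finite ({0..<a} \<times> {0..<d})"
    "card (rcosets\<^bsub>hexagonal_group\<^esub> \<Gamma>) = card ({0..<a} \<times> {0..<d})"
    by (metis bij_betw_finite, metis bij_betw_same_card)
  then show "finite (rcosets\<^bsub>hexagonal_group\<^esub> \<Gamma>)" "int (card (rcosets\<^bsub>hexagonal_group\<^esub> \<Gamma>)) = a * d"
    using a d by simp_all
qed

lemma plat_index:
  assumes "edet v w \<noteq> 0"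
  shows "hexagonal_sublattice (eis_val ` plat v w)" "int (hexagonal_index (eis_val ` plat v w)) = \<bar>edet v w\<bar>"
proof -
  obtain a b d where h: "a > 0" "d > 0" "plat v w = plat (a, 0) (b, d)" "a * d = \<bar>edet v w\<bar>"
    by (rule plat_hnf[OF assms])
  show "hexagonal_sublattice (eis_val ` plat v w)"
    using hnf_index(1)[OF h(1,2), of b] subgroup_plat[of v w]
    unfolding hexagonal_sublattice_def h(3) by blast
  show "int (hexagonal_index (eis_val ` plat v w)) = \<bar>edet v w\<bar>"
    using hnf_index(2)[OF h(1,2), of b] unfolding hexagonal_index_def h(3,4) .
qed

text \<open>Cramer's rule, \<open>Im (cnj v * w)\<close> being the determinant of the two
  vectors.\<close>

lemma span_pair_UNIV:
  fixes v w :: complex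
  assumes D: "Im (cnj v * w) \<noteq> 0"
  shows "\<exists>p q. x = p *\<^sub>R v + q *\<^sub>R w"
proof -
  define D where "D = Im (cnj v * w)"
  define p where "p = Im (cnj x * w) / D"
  define q where "q = Im (cnj v * x) / D"
  have D: "D \<noteq> 0" using assms by (simp add: D_def)
  then have "D *\<^sub>R x = (p * D) *\<^sub>R v + (q * D) *\<^sub>R w"
    by (simp add: p_def q_def) (simp add: D_def complex_eq_iff algebra_simps)
  also have "\<dots> = D *\<^sub>R (p *\<^sub>R v + q *\<^sub>R w)"
    by (simp add: scaleR_add_right mult.commute)
  finally have "x = p *\<^sub>R v + q *\<^sub>R w" using D by simp
  then show ?thesis by blast
qed

lemma wr_basis_real:
  assumes "wr_basis n v w" "n > 0"
  shows "minimal_vectors (eis_val ` plat v w) \<supseteq> {eis_val v, eis_val w}" "span {eis_val v, eis_val w} = UNIV"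
proof -
  have N: "eis_norm v = eis_norm w" "\<bar>ebil v w\<bar> \<le> eis_norm v" "edet v w \<noteq> 0"
    using assms by (auto simp: wr_basis_def)
  have "eis_norm v \<le> eis_norm u" if "u \<in> plat v w" "eis_val u \<noteq> 0" for u
    using plat_norm_ge[OF N(1,2) that(1)] that(2) by (simp add: eis_val_eq_0_iff)
  moreover have "v \<noteq> 0" "w \<noteq> 0" using N(3) by (auto simp: edet_def)
  ultimately show "minimal_vectors (eis_val ` plat v w) \<supseteq> {eis_val v, eis_val w}"
    using N(1) plat_gens(1)[of v w] plat_gens(2)[of w v]
    by (simp add: minimal_vectors_def norm_eis_val_le_iff eis_val_eq_0_iff)
  show "span {eis_val v, eis_val w} = UNIV"
  proof -
    have "Im (cnj (eis_val v) * eis_val w) \<noteq> 0" using N(3) unfolding edet_eis_val by simp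
    then have "x \<in> span {eis_val v, eis_val w}" for x
      using span_pair_UNIV[of "eis_val v" "eis_val w" x] by (auto simp: span_add span_base span_scale)
    then show ?thesis by blast
  qed
qed

lemma well_rounded_plat:
  assumes "wr_basis n v w" "n > 0"
  shows "well_rounded (eis_val ` plat v w)"
  using wr_basis_real[OF assms] span_mono[of "{eis_val v, eis_val w}"] unfolding well_rounded_def by blast

text \<open>With \<open>k\<close> the squared length and \<open>c\<close> the inner product of
  \<open>v\<close> and \<open>w\<close>, the squared norm of the combination is at most
  \<open>(k + \<bar>c\<bar>) / 2\<close>. This is below \<open>k\<close>, since Cauchy-Schwarz is
  strict for independent vectors.\<close>

lemma cmod_sum_half_less:
  fixes a b :: real and v w :: complex
  assumes "\<bar>a\<bar> \<le> 1 / 2" "\<bar>b\<bar> \<le> 1 / 2" "norm v = norm w" "Im (cnj v * w) \<noteq> 0"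
  shows "norm (a *\<^sub>R v + b *\<^sub>R w) < norm v"
proof (rule power2_less_imp_less)
  define c where "c = Re (cnj v * w)"
  define k where "k = (norm v)\<^sup>2"
  have "c\<^sup>2 + (Im (cnj v * w))\<^sup>2 = (norm (cnj v * w))\<^sup>2" by (simp add: c_def cmod_power2)
  also have "\<dots> = k\<^sup>2" using assms(3) by (simp add: k_def norm_mult power2_eq_square)
  finally have "c\<^sup>2 < k\<^sup>2" using assms(4) zero_less_power2[of "Im (cnj v * w)"] by linarith
  then have c: "\<bar>c\<bar> < k" using power2_less_imp_less[of "\<bar>c\<bar>" k] by (simp add: k_def)
  have a2: "a\<^sup>2 \<le> (1 / 2)\<^sup>2" "b\<^sup>2 \<le> (1 / 2)\<^sup>2" using assms(1,2) by (metis abs_ge_zero power2_abs power_mono)+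
  have "\<bar>a * b\<bar> \<le> 1 / 2 * (1 / 2)" unfolding abs_mult using assms(1,2) by (intro mult_mono) auto
  then have "\<bar>2 * (a * b) * c\<bar> \<le> 1 / 2 * \<bar>c\<bar>"
    unfolding abs_mult[of _ c] by (intro mult_right_mono) auto
  moreover have "(a\<^sup>2 + b\<^sup>2) * k \<le> (1 / 2) * k"
    using a2 by (intro mult_right_mono) (auto simp: k_def power2_eq_square)
  moreover have "(norm (a *\<^sub>R v + b *\<^sub>R w))\<^sup>2 = (a\<^sup>2 + b\<^sup>2) * k + 2 * (a * b) * c"
  proof -
    have "k = (norm w)\<^sup>2" using assms(3) by (simp add: k_def)
    then have "(a\<^sup>2 + b\<^sup>2) * k + 2 * (a * b) * c = a\<^sup>2 * (norm v)\<^sup>2 + b\<^sup>2 * (norm w)\<^sup>2 + 2 * (a * b) * c"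
      by (simp add: k_def algebra_simps)
    also have "\<dots> = (norm (a *\<^sub>R v + b *\<^sub>R w))\<^sup>2"
      unfolding cmod_power2 c_def by (simp add: power2_eq_square algebra_simps)
    finally show ?thesis by simp
  qed
  ultimately show "(norm (a *\<^sub>R v + b *\<^sub>R w))\<^sup>2 < (norm v)\<^sup>2"
    using c unfolding k_def[symmetric] by linarith
qed simp

text \<open>Two independent minimal vectors even generate the lattice: rounding the real coordinates
  of a lattice vector leaves a remainder shorter than the minimum, hence zero.\<close>

lemma well_rounded_imp_basis:
  assumes "subgroup \<Gamma> hexagonal_group" "well_rounded \<Gamma>"
  obtains v w where "\<Gamma> = eis_val ` plat v w" "eis_norm v = eis_norm w" "\<bar>ebil v w\<bar> \<le> eis_norm v" "edet v w \<noteq> 0"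
proof -
  have sg: "\<Gamma> \<subseteq> hexagonal_lattice" "0 \<in> \<Gamma>" "\<And>x y. x \<in> \<Gamma> \<Longrightarrow> y \<in> \<Gamma> \<Longrightarrow> x - y \<in> \<Gamma>"
    using assms(1) unfolding subgroup_hexagonal_iff by blast+
  have neg: "- y \<in> \<Gamma>" if "y \<in> \<Gamma>" for y using sg(3)[OF sg(2) that] by simp
  have plus: "x + y \<in> \<Gamma>" if "x \<in> \<Gamma>" "y \<in> \<Gamma>" for x y using sg(3)[OF that(1) neg[OF that(2)]] by simp
  have mult_nat: "of_nat k * x \<in> \<Gamma>" if "x \<in> \<Gamma>" for k x
    by (induction k) (use sg(2) plus that in \<open>auto simp: algebra_simps\<close>)
  have mult: "of_int k * x \<in> \<Gamma>" if "x \<in> \<Gamma>" for k x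
    by (cases k) (use mult_nat[OF that] neg in \<open>auto simp del: of_nat_Suc\<close>)
  define M where "M = minimal_vectors \<Gamma>"
  have M: "span M = UNIV" using assms(2) by (simp add: well_rounded_def M_def)
  have "M \<noteq> {}"
  proof
    assume "M = {}"
    then have "(UNIV :: complex set) = {0}" using M by simp
    then have "(1 :: complex) \<in> {0}" by blast
    then show False by simp
  qed
  then obtain V where V: "V \<in> M" by blast
  have V': "V \<in> \<Gamma>" "V \<noteq> 0" "\<And>u. u \<in> \<Gamma> \<Longrightarrow> u \<noteq> 0 \<Longrightarrow> norm V \<le> norm u"
    using V by (auto simp: M_def minimal_vectors_def)
  have "\<exists>W\<in>M. Im (cnj V * W) \<noteq> 0"
  proof (rule ccontr)
    assume "\<not> ?thesis"
    then have "M \<subseteq> {z. Im (cnj V * z) = 0}" by auto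
    moreover have "subspace {z. Im (cnj V * z) = 0}"
      by (auto simp: subspace_def algebra_simps)
    ultimately have "span M \<subseteq> {z. Im (cnj V * z) = 0}" by (rule span_minimal)
    \<comment> \<open>If all minimal vectors were parallel to \<open>V\<close>, so would be their
      span, although \<open>\<i> * V\<close> is orthogonal to \<open>V\<close>.\<close>
    then have "\<i> * V \<in> {z. Im (cnj V * z) = 0}" unfolding M by blast
    then have "(Re V)\<^sup>2 + (Im V)\<^sup>2 = 0" by (simp add: power2_eq_square)
    then show False using V'(2) by (simp add: complex_eq_iff sum_power2_eq_zero_iff)
  qed
  then obtain W where W: "W \<in> M" and D: "Im (cnj V * W) \<noteq> 0" by blast
  have W': "W \<in> \<Gamma>" "W \<noteq> 0" "\<And>u. u \<in> \<Gamma> \<Longrightarrow> u \<noteq> 0 \<Longrightarrow> norm W \<le> norm u"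
    using W by (auto simp: M_def minimal_vectors_def)
  have VW: "norm V = norm W" using V' W' by (meson antisym)
  obtain v w where vw: "V = eis_val v" "W = eis_val w"
    using V'(1) W'(1) sg(1) unfolding hexagonal_lattice_eq by blast
  have det: "edet v w \<noteq> 0" using D unfolding vw edet_eis_val by auto
  have "\<Gamma> = eis_val ` plat v w"
  proof (intro equalityI subsetI)
    fix x assume "x \<in> eis_val ` plat v w"
    then obtain i j where "x = eis_val (eis_scale i v + eis_scale j w)" by (auto elim!: plat_memE)
    then have "x = of_int i * V + of_int j * W" by (simp only: eis_val_arith vw)
    then show "x \<in> \<Gamma>" using plus mult V'(1) W'(1) by blast
  next
    fix x assume x: "x \<in> \<Gamma>"
    obtain p q where pq: "x = p *\<^sub>R V + q *\<^sub>R W" using span_pair_UNIV[OF D] by blast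
    define i j where "i = round p" and "j = round q"
    define y where "y = x - (of_int i * V + of_int j * W)"
    have "y \<in> \<Gamma>" unfolding y_def using sg(3) plus mult V'(1) W'(1) x by blast
    have "y = (p - of_int i) *\<^sub>R V + (q - of_int j) *\<^sub>R W"
      by (simp add: y_def pq scaleR_conv_of_real algebra_simps)
    moreover have "\<bar>p - of_int i\<bar> \<le> 1 / 2" "\<bar>q - of_int j\<bar> \<le> 1 / 2"
      unfolding i_def j_def using of_int_round_abs_le[of p] of_int_round_abs_le[of q] by (simp_all add: abs_minus_commute)
    ultimately have "norm y < norm V" using cmod_sum_half_less[OF _ _ VW D] by simp
    then have "y = 0" using V'(3)[OF \<open>y \<in> \<Gamma>\<close>] by force
    then have "x = of_int i * V + of_int j * W" by (simp add: y_def)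
    then have "x = eis_val (eis_scale i v + eis_scale j w)" by (simp only: eis_val_arith vw)
    then show "x \<in> eis_val ` plat v w" using plat_memI by blast
  qed
  moreover have N: "eis_norm v = eis_norm w"
    using VW unfolding vw by (metis norm_eis_val_le_iff order.antisym order.refl)
  moreover have "\<bar>ebil v w\<bar> \<le> eis_norm v"
  proof -
    \<comment> \<open>The bound on \<open>ebil\<close> expresses that neither the sum nor the
      difference is shorter than the minimum.\<close>
    have "V + W \<noteq> 0" "V - W \<noteq> 0" using D by (auto simp: add_eq_0_iff mult.commute)
    then have "norm V \<le> norm (V + W)" "norm V \<le> norm (V - W)"
      using V'(3) plus sg(3) V'(1) W'(1) by auto
    then have "eis_norm v \<le> eis_norm (v + w)" "eis_norm v \<le> eis_norm (v - w)"
      unfolding vw eis_val_arith[symmetric] norm_eis_val_le_iff .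
    then show ?thesis using N unfolding eis_norm_add_diff by linarith
  qed
  ultimately show ?thesis using that det by blast
qed

lemma well_rounded_sublattices:
  assumes n: "n > 0"
  shows "{\<Gamma>. hexagonal_sublattice \<Gamma> \<and> well_rounded \<Gamma> \<and> hexagonal_index \<Gamma> = n}
    = (\<lambda>\<Lambda>. eis_val ` \<Lambda>) ` {plat v w | v w. wr_basis n v w}"
proof (intro equalityI subsetI)
  fix \<Gamma> assume "\<Gamma> \<in> {\<Gamma>. hexagonal_sublattice \<Gamma> \<and> well_rounded \<Gamma> \<and> hexagonal_index \<Gamma> = n}"
  then have \<Gamma>: "hexagonal_sublattice \<Gamma>" "well_rounded \<Gamma>" "hexagonal_index \<Gamma> = n" by auto
  have sg: "subgroup \<Gamma> hexagonal_group" using \<Gamma>(1) by (simp add: hexagonal_sublattice_def)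
  obtain v w where vw: "\<Gamma> = eis_val ` plat v w" "eis_norm v = eis_norm w" "\<bar>ebil v w\<bar> \<le> eis_norm v" "edet v w \<noteq> 0"
    by (rule well_rounded_imp_basis[OF sg \<Gamma>(2)])
  have "\<bar>edet v w\<bar> = int n" using plat_index(2)[OF vw(4)] \<Gamma>(3) vw(1) by simp
  then have "wr_basis n v w" using vw by (simp add: wr_basis_def)
  then show "\<Gamma> \<in> (\<lambda>\<Lambda>. eis_val ` \<Lambda>) ` {plat v w | v w. wr_basis n v w}" using vw(1) by blast
next
  fix \<Gamma> assume "\<Gamma> \<in> (\<lambda>\<Lambda>. eis_val ` \<Lambda>) ` {plat v w | v w. wr_basis n v w}"
  then obtain v w where vw: "\<Gamma> = eis_val ` plat v w" "wr_basis n v w" by blast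
  then have d: "edet v w \<noteq> 0" "\<bar>edet v w\<bar> = int n" using n by (auto simp: wr_basis_def)
  show "\<Gamma> \<in> {\<Gamma>. hexagonal_sublattice \<Gamma> \<and> well_rounded \<Gamma> \<and> hexagonal_index \<Gamma> = n}"
    using plat_index[OF d(1)] d(2) well_rounded_plat[OF vw(2) n] vw(1) by simp
qed

text \<open>Multiplying by 6 clears both denominators: six units for an ideal, two signs for a
  rhombic lattice.\<close>

theorem a_tri_eq:
  assumes n: "n > 0"
  shows "6 * a_tri n = card (eis_reps n)
    + 3 * (\<Sum>(k, m) \<in> conv_pairs PQ_pairs (\<lambda>(P, Q). P * Q) n. card (eis_red m))"
proof -
  have "inj (\<lambda>\<Lambda>. eis_val ` \<Lambda>)" by (rule inj_image_eq_iff[OF inj_eis_val, THEN iffD1, THEN injI])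
  then have "a_tri n = card {plat v w | v w. wr_basis n v w}"
    unfolding a_tri_def well_rounded_sublattices[OF n] by (intro card_image) (rule inj_on_subset, auto)
  also have "\<dots> = card (hex_lats n) + card (rhombic_lats n)"
    unfolding wr_plat_cases[OF n]
    using card_hex_lats(2)[OF n] card_rhombic_lats(2)[OF n] hex_rhombic_disjoint[OF n] by (rule card_Un_disjoint)
  finally show ?thesis using card_hex_lats(1)[OF n] card_rhombic_lats(1)[OF n] by simp
qed

section \<open>The Dirichlet series\<close>

abbreviation norm_summable_on :: "('a \<Rightarrow> 'b :: real_normed_vector) \<Rightarrow> 'a set \<Rightarrow> bool"
  (infix "norm'_summable'_on" 46) where
  "f norm_summable_on A \<equiv> (\<lambda>x. norm (f x)) summable_on A"

lemma of_nat_mult_powr: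
  fixes s :: complex
  shows "(of_nat (m * n) :: complex) powr s = of_nat m powr s * of_nat n powr s"
  unfolding of_nat_mult by (rule powr_times_real) auto

lemma norm_of_nat_powr: "norm ((of_nat n :: complex) powr s) = real n powr Re s"
  by (subst norm_powr_real_powr) auto

lemma abs_summable_Times:
  fixes f :: "'a \<Rightarrow> complex" and g :: "'b \<Rightarrow> complex"
  assumes f: "f norm_summable_on X" and g: "g norm_summable_on Y"
  shows "(\<lambda>(x, y). f x * g y) norm_summable_on X \<times> Y"
    "((\<lambda>(x, y). f x * g y) has_sum infsum f X * infsum g Y) (X \<times> Y)"
proof -
  have "(\<lambda>x. norm (f x) * infsum (\<lambda>y. norm (g y)) Y) summable_on X"
    using f by (rule summable_on_cmult_left)
  then have "(\<lambda>x. norm (norm (f x) * infsum (\<lambda>y. norm (g y)) Y)) summable_on X"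
    by (simp add: infsum_nonneg abs_mult)
  moreover have "(\<lambda>y. norm (f x) * norm (g y)) summable_on Y" for x
    using g by (rule summable_on_cmult_right)
  ultimately show *: "(\<lambda>(x, y). f x * g y) norm_summable_on X \<times> Y"
    unfolding Infinite_Sum.abs_summable_on_Sigma_iff by (simp add: norm_mult infsum_cmult_right')
  have "((\<lambda>(x, y). f x * g y) has_sum infsum (\<lambda>(x, y). f x * g y) (X \<times> Y)) (X \<times> Y)"
    using Infinite_Sum.abs_summable_summable[OF *] by (rule has_sum_infsum)
  moreover have "((\<lambda>x. f x * infsum g Y) has_sum infsum (\<lambda>(x, y). f x * g y) (X \<times> Y)) X"
    using calculation
  proof (rule has_sum_Sigma')
    fix x assume "x \<in> X"
    have "((\<lambda>y. f x * g y) has_sum f x * infsum g Y) Y"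
      using Infinite_Sum.abs_summable_summable[OF g] by (intro has_sum_cmult_right has_sum_infsum)
    then show "((\<lambda>y. case (x, y) of (x, y) \<Rightarrow> f x * g y) has_sum f x * infsum g Y) Y" by simp
  qed
  moreover have "((\<lambda>x. f x * infsum g Y) has_sum infsum f X * infsum g Y) X"
    using Infinite_Sum.abs_summable_summable[OF f] by (intro has_sum_cmult_left has_sum_infsum)
  ultimately show "((\<lambda>(x, y). f x * g y) has_sum infsum f X * infsum g Y) (X \<times> Y)"
    using has_sum_unique by metis
qed

definition dir_abs :: "(nat \<Rightarrow> complex) \<Rightarrow> complex \<Rightarrow> bool" where
  "dir_abs a s \<longleftrightarrow> (\<lambda>n. a n / of_nat n powr s) norm_summable_on {1..}"

lemma dir_abs_comparison:
  assumes "dir_abs b s" "\<And>n. n \<ge> 1 \<Longrightarrow> norm (a n) \<le> norm (b n)"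
  shows "dir_abs a s"
  unfolding dir_abs_def
  by (rule Infinite_Sum.abs_summable_on_comparison_test[OF assms(1)[unfolded dir_abs_def]])
    (use assms(2) in \<open>auto simp: norm_divide intro!: divide_right_mono\<close>)

text \<open>The product of two absolutely summable families is regrouped according to the value
  \<open>n\<close> of \<open>w x * m\<close>.\<close>

lemma dirichlet_conv:
  fixes u :: "'x \<Rightarrow> complex" and f c :: "nat \<Rightarrow> complex"
  assumes w: "\<And>x. x \<in> X \<Longrightarrow> w x \<ge> 1"
    and su: "(\<lambda>x. u x / of_nat (w x) powr s) norm_summable_on X"
    and sf: "dir_abs f s"
    and fin: "\<And>n. n \<ge> 1 \<Longrightarrow> finite (conv_pairs X w n)"
    and c: "\<And>n. n \<ge> 1 \<Longrightarrow> c n = (\<Sum>(x, m)\<in>conv_pairs X w n. u x * f m)"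
  shows "dir_abs c s"
    "dirichlet_series c s = infsum (\<lambda>x. u x / of_nat (w x) powr s) X * dirichlet_series f s"
proof -
  define F where "F = (\<lambda>(x, m). u x / of_nat (w x) powr s * (f m / of_nat m powr s))"
  note prod = abs_summable_Times[OF su sf[unfolded dir_abs_def], folded F_def]
  \<comment> \<open>The component \<open>n\<close> is determined by the pair, so it can be added to
    the index set at no cost.\<close>
  have bij: "bij_betw snd (SIGMA n:{1..}. conv_pairs X w n) (X \<times> {1..})"
  proof (rule bij_betwI')
    fix y assume y: "y \<in> X \<times> {1::nat..}"
    then have "w (fst y) * snd y \<ge> 1" using w[of "fst y"] by auto
    then show "\<exists>x\<in>SIGMA n:{1..}. conv_pairs X w n. y = snd x"
      using y by (intro bexI[of _ "(w (fst y) * snd y, y)"]) (auto simp: conv_pairs_def)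
  qed (auto simp: conv_pairs_def)
  have snd_eq: "(\<lambda>(n, k). F k) = (\<lambda>x. F (snd x))" by auto
  have abs: "(\<lambda>(n, k). F k) norm_summable_on (SIGMA n:{1..}. conv_pairs X w n)"
    using prod(1) summable_on_reindex_bij_betw[OF bij, of "\<lambda>k. norm (F k)"] unfolding snd_eq by simp
  have hs: "((\<lambda>(n, k). F k) has_sum infsum (\<lambda>x. u x / of_nat (w x) powr s) X * dirichlet_series f s)
    (SIGMA n:{1..}. conv_pairs X w n)"
    using prod(2) has_sum_reindex_bij_betw[OF bij, of F] unfolding snd_eq dirichlet_series_def by simp
  have inner: "(\<Sum>k\<in>conv_pairs X w n. F k) = c n / of_nat n powr s" if "n \<ge> 1" for n
    unfolding c[OF that] sum_divide_distrib
  proof (rule sum.cong[OF refl])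
    fix k assume "k \<in> conv_pairs X w n"
    then obtain x m where "k = (x, m)" "w x * m = n" by (auto simp: conv_pairs_def)
    then show "F k = (case k of (x, m) \<Rightarrow> u x * f m) / of_nat n powr s"
      using of_nat_mult_powr[of "w x" m s] by (simp add: F_def)
  qed
  have "((\<lambda>n. c n / of_nat n powr s) has_sum infsum (\<lambda>x. u x / of_nat (w x) powr s) X * dirichlet_series f s) {1..}"
    using hs by (rule has_sum_Sigma') (use fin inner in \<open>auto intro!: has_sum_finiteI\<close>)
  then show "dirichlet_series c s = infsum (\<lambda>x. u x / of_nat (w x) powr s) X * dirichlet_series f s"
    unfolding dirichlet_series_def[of c] by (rule infsumI)
  have "(\<lambda>n. \<Sum>\<^sub>\<infinity>k\<in>conv_pairs X w n. norm (F k)) summable_on {1..}"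
    using abs unfolding Infinite_Sum.abs_summable_on_Sigma_iff by (auto simp: infsum_nonneg)
  then show "dir_abs c s"
    unfolding dir_abs_def
  proof (rule Infinite_Sum.abs_summable_on_comparison_test')
    fix n :: nat assume "n \<in> {1..}"
    then show "norm (c n / of_nat n powr s) \<le> (\<Sum>\<^sub>\<infinity>k\<in>conv_pairs X w n. norm (F k))"
      using inner[of n] fin[of n] norm_sum[of F "conv_pairs X w n"] by simp
  qed
qed

lemma dir_abs_1:
  assumes "Re s > 1"
  shows "dir_abs (\<lambda>_. 1) s"
proof -
  have "summable (\<lambda>n. real n powr (- Re s))" using assms by (simp add: summable_real_powr_iff)
  then have "(\<lambda>n. real n powr (- Re s)) summable_on UNIV"
    by (subst summable_on_UNIV_nonneg_real_iff) auto
  then have "(\<lambda>n. real n powr (- Re s)) summable_on {1..}"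
    by (rule summable_on_subset_banach) auto
  then show ?thesis
    unfolding dir_abs_def norm_divide norm_of_nat_powr by (simp add: powr_minus field_simps)
qed

lemma dir_abs_bounded:
  assumes "Re s > 1" "\<And>n. norm (a n) \<le> 1"
  shows "dir_abs a s"
  using dir_abs_comparison[OF dir_abs_1[OF assms(1)], of a] assms(2) by simp

text \<open>The series dominates itself by its first term. Non-vanishing is used at
  \<open>2 * s\<close> with \<open>Re s \<ge> 1\<close> only, where this tail estimate is enough; at
  the argument 2 it also gives the bound on \<open>pi\<^sup>2 / 6\<close> behind the
  asymptotics.\<close>

lemma norm_zeta_minus_1:
  fixes s :: complex
  assumes s: "Re s \<ge> 2"
  shows "norm (zeta s - 1) \<le> 3 / 4"
proof -
  have sm: "(\<lambda>n. 1 / of_nat n powr s) norm_summable_on {1..}"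
    using dir_abs_1[of s] s by (simp add: dir_abs_def)
  then have sm2: "(\<lambda>n. 1 / of_nat n powr s) norm_summable_on {2..}"
    by (rule summable_on_subset_banach) auto
  have "zeta s = infsum (\<lambda>n. 1 / of_nat n powr s) ({1} \<union> {2..})"
    unfolding zeta_def dirichlet_series_def by (rule infsum_cong_neutral) auto
  also have "\<dots> = 1 + infsum (\<lambda>n. 1 / of_nat n powr s) {2..}"
    using Infinite_Sum.abs_summable_summable[OF sm2] by (subst infsum_Un_disjoint) auto
  finally have "norm (zeta s - 1) = norm (infsum (\<lambda>n. 1 / of_nat n powr s) {2..})" by simp
  also have "\<dots> \<le> infsum (\<lambda>n. norm (1 / of_nat n powr s)) {2..}"
    using sm2 by (rule norm_infsum_bound)
  also have "\<dots> \<le> 3 / 4"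
  proof (rule infsum_le_finite_sums[OF sm2])
    fix F :: "nat set" assume F: "finite F" "F \<subseteq> {2..}"
    \<comment> \<open>Telescoping against 1 / (N (N + 1)); the constant 3/4 turns the case N = 2
      into an equality.\<close>
    have tel: "N \<ge> 2 \<Longrightarrow> (\<Sum>n = 2..N. 1 / real n ^ 2) \<le> 3 / 4 - 1 / real N" for N :: nat
    proof (induction N rule: nat_induct_at_least)
      case (Suc N)
      have "1 / real (Suc N) ^ 2 \<le> 1 / (real N * real (Suc N))"
        using Suc.hyps by (intro divide_left_mono) (auto simp: power2_eq_square)
      also have "\<dots> = 1 / real N - 1 / real (Suc N)"
        using Suc.hyps by (simp add: field_simps)
      finally have "1 / real (Suc N) ^ 2 \<le> 1 / real N - 1 / real (Suc N)" .
      moreover have "(\<Sum>n = 2..Suc N. 1 / real n ^ 2) = (\<Sum>n = 2..N. 1 / real n ^ 2) + 1 / real (Suc N) ^ 2"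
        using Suc.hyps by simp
      ultimately show ?case using Suc.IH by linarith
    qed simp
    define N where "N = Max (insert 2 F)"
    have "norm (1 / of_nat n powr s) \<le> 1 / real n ^ 2" if "n \<ge> 2" for n
    proof -
      have "real n powr 2 \<le> real n powr Re s" using that s by (intro powr_mono) auto
      then show ?thesis using that unfolding norm_divide norm_of_nat_powr
        by (simp add: powr_numeral frac_le)
    qed
    then have "(\<Sum>n\<in>F. norm (1 / of_nat n powr s)) \<le> (\<Sum>n\<in>F. 1 / real n ^ 2)"
      using F by (intro sum_mono) auto
    also have "\<dots> \<le> (\<Sum>n = 2..N. 1 / real n ^ 2)"
      using F by (intro sum_mono2) (auto simp: N_def)
    also have "\<dots> \<le> 3 / 4 - 1 / real N" using F by (intro tel) (auto simp: N_def)
    also have "\<dots> \<le> 3 / 4" by simp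
    finally show "(\<Sum>n\<in>F. norm (1 / of_nat n powr s)) \<le> 3 / 4" .
  qed
  finally show ?thesis .
qed

lemma zeta_nonzero: "Re s \<ge> 2 \<Longrightarrow> zeta s \<noteq> 0"
  using norm_zeta_minus_1[of s] by auto

lemma one_plus_3_powr_nonzero:
  fixes s :: complex
  assumes "Re s > 0"
  shows "1 + 3 powr (- s) \<noteq> 0"
proof
  assume "1 + 3 powr (- s) = 0"
  then have "norm (3 powr (- s) :: complex) = 1" by (metis add_eq_0_iff norm_minus_cancel norm_one)
  moreover have "norm (3 powr (- s) :: complex) = 3 powr (- Re s)"
    using norm_of_nat_powr[of 3 "- s"] by simp
  moreover have "(3 :: real) powr (- Re s) < 3 powr 0" using assms by (intro powr_less_mono) auto
  ultimately show False by simp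
qed

section \<open>The series of reduced elements and of the pairs \<open>(P, Q)\<close>\<close>

definition red_series :: "complex \<Rightarrow> complex" where
  "red_series = dirichlet_series (\<lambda>n. of_nat (card (eis_red n)))"

definition T_series :: "complex \<Rightarrow> complex" where
  "T_series s = infsum (\<lambda>k. 1 / of_nat ((\<lambda>(P, Q). P * Q) k) powr s) PQ_pairs"

lemma norm_chi3: "norm (of_int (chi3 n) :: complex) \<le> 1"
  by (simp add: chi3_def)

lemma eis_reps_series:
  assumes s: "Re s > 1"
  shows "dir_abs (\<lambda>n. of_nat (card (eis_reps n))) s"
    "dirichlet_series (\<lambda>n. of_nat (card (eis_reps n))) s = 6 * (L_chi3 s * zeta s)"
proof -
  have "dir_abs (\<lambda>n. of_int (chi3 n)) s" by (rule dir_abs_bounded[OF s norm_chi3])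
  then have su: "(\<lambda>x. 6 * of_int (chi3 x) / of_nat (id x) powr s) norm_summable_on {1..}"
    unfolding dir_abs_def using summable_on_cmult_right[of "\<lambda>n. norm (of_int (chi3 n) / of_nat n powr s)" "{1..}" 6]
    by (simp add: norm_mult norm_divide)
  have c: "of_nat (card (eis_reps n)) = (\<Sum>(x, m)\<in>conv_pairs {1..} id n. 6 * of_int (chi3 x) * (1 :: complex))"
    if "n \<ge> 1" for n
  proof -
    have "bij_betw fst (conv_pairs {1..} id n) {d. d dvd n}"
    proof (rule bij_betwI')
      fix d assume "d \<in> {d. d dvd n}"
      then obtain m where "n = d * m" by blast
      then show "\<exists>x\<in>conv_pairs {1..} id n. d = fst x"
        using that by (intro bexI[of _ "(d, m)"]) (auto simp: conv_pairs_def Suc_le_eq)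
    qed (auto simp: conv_pairs_def)
    then have "(\<Sum>x\<in>conv_pairs {1..} id n. 6 * of_int (chi3 (fst x))) = (\<Sum>d | d dvd n. 6 * of_int (chi3 d) :: complex)"
      by (rule sum.reindex_bij_betw)
    also have "\<dots> = of_int (6 * divisor_chi n)" by (simp add: divisor_chi_def sum_distrib_left)
    also have "\<dots> = of_int (int (card (eis_reps n)))" using card_eis_reps[of n] that by simp
    finally show ?thesis by (simp add: case_prod_beta)
  qed
  have fin: "finite (conv_pairs {1..} id n)" if "n \<ge> 1" for n :: nat
    using that by (intro finite_conv_pairs) (auto intro: finite_subset[of _ "{..n}"])
  note cv = dirichlet_conv[OF _ su dir_abs_1[OF s] fin c]
  show "dir_abs (\<lambda>n. of_nat (card (eis_reps n))) s" by (rule cv(1)) auto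
  have "dirichlet_series (\<lambda>n. of_nat (card (eis_reps n))) s =
    infsum (\<lambda>x. 6 * of_int (chi3 x) / of_nat (id x) powr s) {1..} * zeta s"
    unfolding zeta_def by (rule cv(2)) auto
  also have "infsum (\<lambda>x. 6 * of_int (chi3 x) / of_nat (id x) powr s) {1..} = 6 * L_chi3 s"
    unfolding L_chi3_def dirichlet_series_def by (subst infsum_cmult_right'[symmetric]) simp
  finally show "dirichlet_series (\<lambda>n. of_nat (card (eis_reps n))) s = 6 * (L_chi3 s * zeta s)" by simp
qed

lemma dir_abs_red:
  assumes s: "Re s > 1"
  shows "dir_abs (\<lambda>n. of_nat (card (eis_red n))) s"
  by (rule dir_abs_comparison[OF eis_reps_series(1)[OF s]])
    (auto simp: eis_red_def intro!: card_mono finite_eis_reps)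

text \<open>In the weight \<open>d\<^sup>2 * 3 ^ e\<close> the square produces
  \<open>zeta (2 * s)\<close>, and the two values of \<open>e\<close> produce
  \<open>1 + 3 powr (- s)\<close>.\<close>

lemma red_series_eq:
  assumes s: "Re s > 1"
  shows "zeta (2 * s) * (1 + 3 powr (- s)) * red_series s = 6 * (L_chi3 s * zeta s)"
proof -
  let ?X = "{1..} \<times> {0, 1 :: nat}" and ?w = "\<lambda>(d :: nat, e :: nat). d\<^sup>2 * 3 ^ e"
  have z2: "(\<lambda>d. 1 / of_nat d powr (2 * s)) norm_summable_on {1..}"
    using dir_abs_1[of "2 * s"] s by (simp add: dir_abs_def)
  have e2: "(\<lambda>e :: nat. 1 / of_nat (3 ^ e) powr s :: complex) norm_summable_on {0, 1}" by simp
  have eq: "(case (d, e) of (d, e) \<Rightarrow> 1 / of_nat d powr (2 * s) * (1 / of_nat (3 ^ e) powr s)) = 1 / of_nat (?w (d, e)) powr s"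
    for d e
  proof -
    have "(of_nat (d\<^sup>2 * 3 ^ e) :: complex) powr s = of_nat d powr s * of_nat d powr s * of_nat (3 ^ e) powr s"
      unfolding of_nat_mult_powr power2_eq_square ..
    also have "(of_nat d :: complex) powr s * of_nat d powr s = of_nat d powr (2 * s)"
      by (simp flip: powr_add)
    finally show ?thesis by simp
  qed
  have eq': "(\<lambda>(d, e). 1 / of_nat d powr (2 * s) * (1 / of_nat (3 ^ e) powr s)) = (\<lambda>x. 1 / of_nat (?w x) powr s)"
    using eq by (auto simp: fun_eq_iff)
  note prod = abs_summable_Times[OF z2 e2, unfolded eq']
  have fin: "finite (conv_pairs ?X ?w n)" if "n \<ge> 1" for n
  proof -
    have "d \<le> d\<^sup>2 * 3 ^ e" for d e :: nat
    proof -
      have "d * 1 \<le> d * (d * 3 ^ e)" by (cases "d = 0") auto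
      then show ?thesis by (simp add: power2_eq_square mult.assoc)
    qed
    then show ?thesis using that by (intro finite_conv_pairs finite_mult_le) auto
  qed
  have c: "of_nat (card (eis_reps n)) = (\<Sum>(x, m)\<in>conv_pairs ?X ?w n. 1 * of_nat (card (eis_red m)) :: complex)"
    if "n \<ge> 1" for n
    using card_eis_reps_red[of n] that by (simp add: case_prod_beta)
  have "dirichlet_series (\<lambda>n. of_nat (card (eis_reps n))) s
    = infsum (\<lambda>x. 1 / of_nat (?w x) powr s) ?X * red_series s"
    unfolding red_series_def by (rule dirichlet_conv(2)[OF _ prod(1) dir_abs_red[OF s] fin c]) auto
  also have "infsum (\<lambda>x. 1 / of_nat (?w x) powr s) ?X = zeta (2 * s) * (1 + 3 powr (- s))"
    using infsumI[OF prod(2)] by (simp add: zeta_def dirichlet_series_def powr_minus field_simps)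
  finally show ?thesis using eis_reps_series(2)[OF s] by simp
qed

lemma PQ_abs_summable:
  assumes s: "Re s > 1"
  shows "(\<lambda>k. 1 / of_nat ((\<lambda>(P, Q). P * Q) k) powr s) norm_summable_on PQ_pairs"
proof -
  have z: "(\<lambda>d. 1 / of_nat d powr s) norm_summable_on {1..}"
    using dir_abs_1[of s] s by (simp add: dir_abs_def)
  have "(\<lambda>(P, Q). 1 / of_nat P powr s * (1 / of_nat Q powr s)) = (\<lambda>k. 1 / of_nat ((\<lambda>(P, Q). P * Q) k) powr s)"
    using of_nat_mult_powr[of _ _ s] by (auto simp: fun_eq_iff)
  then have "(\<lambda>k. 1 / of_nat ((\<lambda>(P, Q). P * Q) k) powr s) norm_summable_on {1..} \<times> {1..}"
    using abs_summable_Times(1)[OF z z] by simp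
  then show ?thesis by (rule summable_on_subset_banach) (auto simp: PQ_pairs_def)
qed

lemma Phi_wr_T:
  assumes s: "Re s > 1"
  shows "dir_abs (\<lambda>n. of_nat (a_tri n)) s"
    "Phi_wr s = Phi_tri s + 1 / 2 * (T_series s * red_series s)"
proof -
  define c where "c = (\<lambda>n. \<Sum>(k, m) \<in> conv_pairs PQ_pairs (\<lambda>(P, Q). P * Q) n. 1 * of_nat (card (eis_red m)) :: complex)"
  have fin: "finite (conv_pairs PQ_pairs (\<lambda>(P, Q). P * Q) n)" if "n \<ge> 1" for n
    using that PQ_pairs_finite by (intro finite_conv_pairs) auto
  have w: "(\<lambda>(P, Q). P * Q) k \<ge> 1" if "k \<in> PQ_pairs" for k
    using that by (auto simp: PQ_pairs_def Suc_le_eq)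
  have c: "c n = (\<Sum>(k, m) \<in> conv_pairs PQ_pairs (\<lambda>(P, Q). P * Q) n. 1 * of_nat (card (eis_red m)))" for n
    by (simp add: c_def)
  note cv = dirichlet_conv[OF w PQ_abs_summable[OF s] dir_abs_red[OF s] fin c]
  have cc: "dir_abs c s" "dirichlet_series c s = T_series s * red_series s"
    unfolding T_series_def red_series_def by (rule cv(1), assumption+, rule cv(2), assumption+)
  have a: "of_nat (a_tri n) = of_nat (card (eis_reps n)) / 6 + c n / 2" if "n \<ge> 1" for n
  proof -
    have "(of_nat (6 * a_tri n) :: complex) = of_nat (card (eis_reps n)) + 3 * c n"
      using a_tri_eq[of n] that by (simp add: c_def case_prod_beta)
    then show ?thesis by (simp add: field_simps)
  qed
  have s1: "((\<lambda>n. of_nat (card (eis_reps n)) / of_nat n powr s) has_sum 6 * (L_chi3 s * zeta s)) {1..}"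
    using eis_reps_series[OF s] has_sum_infsum[OF Infinite_Sum.abs_summable_summable] unfolding dir_abs_def dirichlet_series_def by metis
  have s2: "((\<lambda>n. c n / of_nat n powr s) has_sum T_series s * red_series s) {1..}"
    using cc has_sum_infsum[OF Infinite_Sum.abs_summable_summable] unfolding dir_abs_def dirichlet_series_def by metis
  have "((\<lambda>n. 1 / 6 * (of_nat (card (eis_reps n)) / of_nat n powr s) + 1 / 2 * (c n / of_nat n powr s)) has_sum
    1 / 6 * (6 * (L_chi3 s * zeta s)) + 1 / 2 * (T_series s * red_series s)) {1..}"
    by (intro has_sum_add has_sum_cmult_right s1 s2)
  also have "?this \<longleftrightarrow> ((\<lambda>n. of_nat (a_tri n) / of_nat n powr s) has_sum
    1 / 6 * (6 * (L_chi3 s * zeta s)) + 1 / 2 * (T_series s * red_series s)) {1..}"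
    by (rule has_sum_cong) (simp add: a add_divide_distrib)
  finally have hs: "((\<lambda>n. of_nat (a_tri n) / of_nat n powr s) has_sum
    1 / 6 * (6 * (L_chi3 s * zeta s)) + 1 / 2 * (T_series s * red_series s)) {1..}" .
  show "Phi_wr s = Phi_tri s + 1 / 2 * (T_series s * red_series s)"
    unfolding Phi_wr_def dirichlet_series_def using infsumI[OF hs] by (simp add: Phi_tri_def)
  have "(\<lambda>n. norm (1 / 6 * (of_nat (card (eis_reps n)) / of_nat n powr s)) + norm (1 / 2 * (c n / of_nat n powr s))) summable_on {1..}"
    unfolding norm_mult using eis_reps_series(1)[OF s] cc(1) unfolding dir_abs_def
    by (intro summable_on_add summable_on_cmult_right)
  then show "dir_abs (\<lambda>n. of_nat (a_tri n)) s"
    unfolding dir_abs_def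
  proof (rule Infinite_Sum.abs_summable_on_comparison_test')
    fix n :: nat assume "n \<in> {1..}"
    then have "of_nat (a_tri n) / of_nat n powr s = 1 / 6 * (of_nat (card (eis_reps n)) / of_nat n powr s) + 1 / 2 * (c n / of_nat n powr s)"
      by (simp add: a add_divide_distrib)
    then show "norm (of_nat (a_tri n) / of_nat n powr s) \<le>
      norm (1 / 6 * (of_nat (card (eis_reps n)) / of_nat n powr s)) + norm (1 / 2 * (c n / of_nat n powr s))"
      using norm_triangle_ineq by metis
  qed
qed

lemma red_series_Phi_pr:
  assumes s: "Re s > 1"
  shows "red_series s = 6 / (1 + 3 powr (- s)) * Phi_pr s"
proof -
  have "zeta (2 * s) \<noteq> 0" using s by (intro zeta_nonzero) simp
  moreover have "1 + 3 powr (- s) \<noteq> 0" using s by (intro one_plus_3_powr_nonzero) simp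
  ultimately have "zeta (2 * s) * (1 + 3 powr (- s)) \<noteq> 0" by simp
  then have "red_series s = 6 * (L_chi3 s * zeta s) / (zeta (2 * s) * (1 + 3 powr (- s)))"
    using red_series_eq[OF s] by (metis nonzero_mult_div_cancel_left)
  then show ?thesis by (simp add: Phi_pr_def)
qed

lemma infsum_Sigma_finite:
  fixes f :: "'a \<times> 'b \<Rightarrow> 'c :: banach"
  assumes "f summable_on Sigma A B" "\<And>x. x \<in> A \<Longrightarrow> finite (B x)"
  shows "infsum f (Sigma A B) = infsum (\<lambda>x. \<Sum>y\<in>B x. f (x, y)) A"
    "(\<lambda>x. \<Sum>y\<in>B x. f (x, y)) summable_on A"
proof -
  have "((\<lambda>x. \<Sum>y\<in>B x. f (x, y)) has_sum infsum f (Sigma A B)) A"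
    using has_sum_infsum[OF assms(1)] by (rule has_sum_SigmaD) (use assms(2) in \<open>auto intro!: has_sum_finiteI\<close>)
  then show "infsum f (Sigma A B) = infsum (\<lambda>x. \<Sum>y\<in>B x. f (x, y)) A"
    "(\<lambda>x. \<Sum>y\<in>B x. f (x, y)) summable_on A"
    by (auto simp: infsumI has_sum_imp_summable)
qed

definition pq_term :: "complex \<Rightarrow> nat \<times> nat \<Rightarrow> complex" where
  "pq_term s k = 1 / of_nat ((\<lambda>(P, Q). P * Q) k) powr s"

lemma T_series_pq_term: "T_series s = infsum (pq_term s) PQ_pairs"
  unfolding T_series_def pq_term_def ..

lemma T_series_image:
  assumes s: "Re s > 1" and inj: "inj_on \<phi> (Sigma A B)" and sub: "\<phi> ` Sigma A B \<subseteq> PQ_pairs"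
    and fin: "\<And>x. x \<in> A \<Longrightarrow> finite (B x)"
  shows "infsum (pq_term s) (\<phi> ` Sigma A B) = infsum (\<lambda>x. \<Sum>y\<in>B x. pq_term s (\<phi> (x, y))) A"
    "(\<lambda>x. \<Sum>y\<in>B x. norm (pq_term s (\<phi> (x, y)))) summable_on A"
    "pq_term s summable_on \<phi> ` Sigma A B"
proof -
  have ns: "(pq_term s) norm_summable_on \<phi> ` Sigma A B"
    unfolding pq_term_def by (rule summable_on_subset_banach[OF PQ_abs_summable[OF s] sub])
  then show sm: "pq_term s summable_on \<phi> ` Sigma A B" by (rule Infinite_Sum.abs_summable_summable)
  have sm': "(\<lambda>x. pq_term s (\<phi> x)) summable_on Sigma A B"
    using sm inj by (simp add: summable_on_reindex o_def)
  have "infsum (pq_term s) (\<phi> ` Sigma A B) = infsum (\<lambda>x. pq_term s (\<phi> x)) (Sigma A B)"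
    using inj by (simp add: infsum_reindex o_def)
  then show "infsum (pq_term s) (\<phi> ` Sigma A B) = infsum (\<lambda>x. \<Sum>y\<in>B x. pq_term s (\<phi> (x, y))) A"
    using infsum_Sigma_finite(1)[OF sm' fin] by simp
  have "(\<lambda>x. norm (pq_term s (\<phi> x))) summable_on Sigma A B"
    using ns inj by (simp add: summable_on_reindex o_def)
  then show "(\<lambda>x. \<Sum>y\<in>B x. norm (pq_term s (\<phi> (x, y)))) summable_on A"
    using infsum_Sigma_finite(2)[of "\<lambda>x. norm (pq_term s (\<phi> x))" A B] fin by simp
qed

text \<open>\<open>P\<close> and \<open>Q\<close> have the same parity: both even gives
  \<open>(2 * q, 2 * p)\<close>, both odd gives \<open>(2 * l + 1, 2 * k + 1)\<close>. No odd
  \<open>P\<close> lies strictly between 1 and 3, so \<open>k = 0\<close> does not occur and the sum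
  over \<open>k\<close> may start at 1.\<close>

lemma T_series_even_odd:
  assumes s: "Re s > 1"
  shows "T_series s =
    (\<Sum>\<^sub>\<infinity>p\<in>{1::nat..}. \<Sum>q\<in>{p<..<3*p}. 1 / (of_nat p powr s * of_nat q powr s)) / 4 powr s
    + (\<Sum>\<^sub>\<infinity>k\<in>{1::nat..}. \<Sum>l\<in>{k<..<3*k+1}. 1 / (of_nat (2*k+1) powr s * of_nat (2*l+1) powr s))"
proof -
  define h where "h = pq_term s"
  define f1 where "f1 = (\<lambda>(p :: nat, q :: nat). (2 * q, 2 * p))"
  define f2 where "f2 = (\<lambda>(k :: nat, l :: nat). (2 * l + 1, 2 * k + 1))"
  let ?S1 = "Sigma {1..} (\<lambda>p. {p<..<3*p})" and ?S2 = "Sigma {1..} (\<lambda>k. {k<..<3*k+1})"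
  have sub1: "f1 ` ?S1 \<subseteq> PQ_pairs" and sub2: "f2 ` ?S2 \<subseteq> PQ_pairs"
    by (auto simp: f1_def f2_def PQ_pairs_def)
  have inj: "inj_on f1 ?S1" "inj_on f2 ?S2" by (auto simp: f1_def f2_def inj_on_def)
  have un: "PQ_pairs = f1 ` ?S1 \<union> f2 ` ?S2"
  proof (intro equalityI subsetI)
    fix x assume x: "x \<in> PQ_pairs"
    obtain P Q where PQ: "x = (P, Q)" "Q < P" "P < 3 * Q" "even (P + Q)" using x by (auto simp: PQ_pairs_def)
    show "x \<in> f1 ` ?S1 \<union> f2 ` ?S2"
    proof (cases "even Q")
      case True
      then obtain p q where "Q = 2 * p" "P = 2 * q" using PQ(4) by (auto elim!: evenE)
      then have "(p, q) \<in> ?S1" "x = f1 (p, q)" using PQ by (auto simp: f1_def)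
      then show ?thesis by blast
    next
      case False
      moreover have "odd P" using False PQ(4) by simp
      ultimately obtain k l where "Q = 2 * k + 1" "P = 2 * l + 1" by (auto elim!: oddE)
      then have "(k, l) \<in> ?S2" "x = f2 (k, l)" using PQ by (auto simp: f2_def)
      then show ?thesis by blast
    qed
  qed (use sub1 sub2 in blast)
  have dis: "f1 ` ?S1 \<inter> f2 ` ?S2 = {}" by (auto simp: f1_def f2_def) presburger
  note t1 = T_series_image[OF s inj(1) sub1, folded h_def]
  note t2 = T_series_image[OF s inj(2) sub2, folded h_def]
  have four: "(4 :: complex) powr s = 2 powr s * 2 powr s"
    using of_nat_mult_powr[of 2 2 s] by simp
  have "T_series s = infsum h (f1 ` ?S1) + infsum h (f2 ` ?S2)"
    unfolding T_series_pq_term h_def[symmetric] un using t1(3) t2(3) dis by (intro infsum_Un_disjoint) auto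
  also have "infsum h (f1 ` ?S1) = (\<Sum>\<^sub>\<infinity>p\<in>{1::nat..}. \<Sum>q\<in>{p<..<3*p}. h (f1 (p, q)))"
    by (rule t1(1)) simp
  also have "\<dots> = (\<Sum>\<^sub>\<infinity>p\<in>{1::nat..}. (\<Sum>q\<in>{p<..<3*p}. 1 / (of_nat p powr s * of_nat q powr s)) * (1 / 4 powr s))"
  proof (rule infsum_cong)
    fix p :: nat
    have "h (f1 (p, q)) = 1 / (of_nat p powr s * of_nat q powr s) * (1 / 4 powr s)" for q
      using of_nat_mult_powr[of "2 * q" "2 * p" s] of_nat_mult_powr[of 2 q s] of_nat_mult_powr[of 2 p s]
      by (simp add: h_def pq_term_def f1_def four)
    then show "(\<Sum>q\<in>{p<..<3*p}. h (f1 (p, q))) = (\<Sum>q\<in>{p<..<3*p}. 1 / (of_nat p powr s * of_nat q powr s)) * (1 / 4 powr s)"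
      by (simp only: sum_distrib_right)
  qed
  also have "\<dots> = (\<Sum>\<^sub>\<infinity>p\<in>{1::nat..}. \<Sum>q\<in>{p<..<3*p}. 1 / (of_nat p powr s * of_nat q powr s)) / 4 powr s"
    by (subst infsum_cmult_left') simp
  also have "infsum h (f2 ` ?S2) = (\<Sum>\<^sub>\<infinity>k\<in>{1::nat..}. \<Sum>l\<in>{k<..<3*k+1}. h (f2 (k, l)))"
    by (rule t2(1)) simp
  also have "\<dots> = (\<Sum>\<^sub>\<infinity>k\<in>{1::nat..}. \<Sum>l\<in>{k<..<3*k+1}. 1 / (of_nat (2*k+1) powr s * of_nat (2*l+1) powr s))"
  proof -
    have "h (f2 (k, l)) = 1 / (of_nat (2*k+1) powr s * of_nat (2*l+1) powr s)" for k l
      using of_nat_mult_powr[of "2 * l + 1" "2 * k + 1" s] by (simp add: h_def pq_term_def f2_def)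
    then show ?thesis by simp
  qed
  finally show ?thesis .
qed

text \<open>For fixed \<open>Q\<close> the values of \<open>P\<close> are the points strictly
  between \<open>Q\<close> and \<open>3 Q\<close> in steps of two, the form needed for comparison
  with an integral.\<close>

lemma PQ_pairs_Sigma: "PQ_pairs = (\<lambda>(Q, j). (Q + 2 * j, Q)) ` (SIGMA Q:{1..}. {1..<Q})"
proof (intro equalityI subsetI)
  fix x assume "x \<in> PQ_pairs"
  then obtain P Q where PQ: "x = (P, Q)" "Q < P" "P < 3 * Q" "even (P + Q)" by (auto simp: PQ_pairs_def)
  define j where "j = (P - Q) div 2"
  have "P = Q + 2 * j" using PQ unfolding j_def by presburger
  then have "(Q, j) \<in> (SIGMA Q:{1..}. {1..<Q})" "x = (\<lambda>(Q, j). (Q + 2 * j, Q)) (Q, j)" using PQ by auto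
  then show "x \<in> (\<lambda>(Q, j). (Q + 2 * j, Q)) ` (SIGMA Q:{1..}. {1..<Q})" by blast
qed (auto simp: PQ_pairs_def)

lemma inj_PQ_Sigma: "inj_on (\<lambda>(Q, j). (Q + 2 * j, Q :: nat)) A"
  by (auto simp: inj_on_def)

lemma T_series_Sigma:
  assumes s: "Re s > 1"
  shows "((\<lambda>Q. 1 / of_nat Q powr s * (\<Sum>j\<in>{1..<Q}. 1 / of_nat (Q + 2 * j) powr s)) has_sum T_series s) {1..}"
    "(\<lambda>Q. 1 / of_nat Q powr s * (\<Sum>j\<in>{1..<Q}. 1 / of_nat (Q + 2 * j) powr s)) norm_summable_on {1..}"
proof -
  define h where "h = pq_term s"
  let ?\<phi> = "\<lambda>(Q, j). (Q + 2 * j, Q :: nat)"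
  note t = T_series_image[OF s inj_PQ_Sigma, of "{1..}" "\<lambda>Q. {1..<Q}", unfolded PQ_pairs_Sigma[symmetric], folded h_def]
  have eq: "(\<Sum>j\<in>{1..<Q}. h (?\<phi> (Q, j))) = 1 / of_nat Q powr s * (\<Sum>j\<in>{1..<Q}. 1 / of_nat (Q + 2 * j) powr s)" for Q
  proof -
    have "h (?\<phi> (Q, j)) = 1 / of_nat Q powr s * (1 / of_nat (Q + 2 * j) powr s)" for j
      using of_nat_mult_powr[of "Q + 2 * j" Q s] by (simp add: h_def pq_term_def del: of_nat_mult of_nat_add)
    then show ?thesis by (simp only: sum_distrib_left)
  qed
  have sm: "(\<lambda>Q. \<Sum>j\<in>{1..<Q}. norm (h (?\<phi> (Q, j)))) summable_on {1..}" by (rule t(2)) auto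
  show ns: "(\<lambda>Q. 1 / of_nat Q powr s * (\<Sum>j\<in>{1..<Q}. 1 / of_nat (Q + 2 * j) powr s)) norm_summable_on {1..}"
    by (rule Infinite_Sum.abs_summable_on_comparison_test'[OF sm]) (auto simp only: eq[symmetric] intro: norm_sum)
  have "T_series s = infsum (\<lambda>Q. 1 / of_nat Q powr s * (\<Sum>j\<in>{1..<Q}. 1 / of_nat (Q + 2 * j) powr s)) {1..}"
    unfolding T_series_pq_term h_def[symmetric] eq[symmetric] by (rule t(1)) auto
  then show "((\<lambda>Q. 1 / of_nat Q powr s * (\<Sum>j\<in>{1..<Q}. 1 / of_nat (Q + 2 * j) powr s)) has_sum T_series s) {1..}"
    using has_sum_infsum[OF Infinite_Sum.abs_summable_summable[OF ns]] by simp
qed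

theorem Phi_wr_identity:
  fixes s :: complex
  assumes s: "Re s > 1"
  shows "Phi_wr s = Phi_tri s + Phi_wr_even s + Phi_wr_odd s"
proof -
  have *: "1 / 2 * ((A / c + B) * (6 / d * f)) = 3 / (c * d) * A * f + 3 / d * B * f" for A B c d f :: complex
  proof -
    have "1 / 2 * ((A / c + B) * (2 * y)) = A / c * y + B * y" for y
      by (simp add: distrib_right)
    from this[of "3 / d * f"]
    have "1 / 2 * ((A / c + B) * (6 / d * f)) = (A / c) * (3 / d * f) + B * (3 / d * f)"
      by simp
    also have "\<dots> = 3 / (c * d) * A * f + 3 / d * B * f"
      by (simp add: mult.commute mult.left_commute)
    finally show ?thesis .
  qed
  show ?thesis
    unfolding Phi_wr_T(2)[OF s] red_series_Phi_pr[OF s] T_series_even_odd[OF s] Phi_wr_even_def Phi_wr_odd_def * add.assoc ..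
qed

section \<open>Real bounds\<close>

text \<open>A primitive of \<open>x powr (- s)\<close>; integrals appear below as differences of its
  values.\<close>

definition prim_powr :: "real \<Rightarrow> real \<Rightarrow> real" where
  "prim_powr s x = - (x powr (1 - s)) / (s - 1)"

lemma prim_powr_deriv:
  assumes "s > 1" "x > 0"
  shows "(prim_powr s has_real_derivative x powr (- s)) (at x)"
proof -
  have "((\<lambda>x. - (x powr (1 - s)) / (s - 1)) has_real_derivative - ((1 - s) * x powr (1 - s - 1)) / (s - 1)) (at x)"
    using assms by (auto intro!: derivative_eq_intros)
  moreover have "- ((1 - s) * x powr (1 - s - 1)) / (s - 1) = x powr (- s)"
    using assms(1) by (simp add: field_simps)
  ultimately show ?thesis by (simp add: prim_powr_def[abs_def])
qed

lemma prim_powr_bounds: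
  assumes s: "s > 1" and x: "0 < x" "x < y"
  shows "prim_powr s y - prim_powr s x \<le> (y - x) * x powr (- s)"
    "(y - x) * y powr (- s) \<le> prim_powr s y - prim_powr s x"
proof -
  obtain z where z: "x < z" "z < y" "prim_powr s y - prim_powr s x = (y - x) * z powr (- s)"
    using MVT2[OF x(2), of "prim_powr s" "\<lambda>z. z powr (- s)"] prim_powr_deriv[OF s] x by auto
  have "z powr (- s) \<le> x powr (- s)" "y powr (- s) \<le> z powr (- s)"
    using z x s by (auto intro!: powr_mono2')
  then show "prim_powr s y - prim_powr s x \<le> (y - x) * x powr (- s)"
    "(y - x) * y powr (- s) \<le> prim_powr s y - prim_powr s x"
    using x z by simp_all
qed

text \<open>Convexity at the midpoint, from the inequality between arithmetic and geometric mean and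
  \<open>(x + h) * (x - h) \<le> x * x\<close>.\<close>

lemma powr_midpoint:
  fixes x h s :: real
  assumes "s > 0" "0 \<le> h" "h < x"
  shows "2 * x powr (- s) \<le> (x + h) powr (- s) + (x - h) powr (- s)"
proof -
  define u v where "u = (x + h) powr (- s / 2)" and "v = (x - h) powr (- s / 2)"
  have uv: "u\<^sup>2 = (x + h) powr (- s)" "v\<^sup>2 = (x - h) powr (- s)"
    unfolding u_def v_def power2_eq_square powr_add[symmetric] by simp_all
  have "2 * (u * v) \<le> u\<^sup>2 + v\<^sup>2" using sum_squares_bound[of u v] by simp
  then have "2 * (u * v) \<le> (x + h) powr (- s) + (x - h) powr (- s)" by (simp only: uv)
  moreover have "x powr (- s) \<le> u * v"
  proof -
    have "x powr (- s) = (x * x) powr (- s / 2)" using assms by (simp add: powr_mult flip: powr_add)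
    also have "\<dots> \<le> ((x + h) * (x - h)) powr (- s / 2)"
    proof (rule powr_mono2')
      show "0 < (x + h) * (x - h)" using assms by (intro mult_pos_pos) auto
    qed (use assms in \<open>auto simp: algebra_simps\<close>)
    also have "\<dots> = u * v" using assms by (simp add: u_def v_def powr_mult)
    finally show ?thesis .
  qed
  ultimately show ?thesis by simp
qed

text \<open>For a convex function the midpoint rule stays below the integral: as a function of
  \<open>h\<close> the difference has a non-negative derivative and vanishes at 0.\<close>

lemma prim_powr_midpoint:
  assumes s: "s > 1" and h: "0 \<le> h" "h < x"
  shows "2 * h * x powr (- s) \<le> prim_powr s (x + h) - prim_powr s (x - h)"
proof -
  define \<phi> where "\<phi> = (\<lambda>t. prim_powr s (x + t) - prim_powr s (x - t) - 2 * t * x powr (- s))"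
  have "\<phi> 0 \<le> \<phi> h"
  proof (rule DERIV_nonneg_imp_nondecreasing[OF h(1)])
    fix t assume t: "0 \<le> t" "t \<le> h"
    have d1: "((\<lambda>t. prim_powr s (x + t)) has_real_derivative (x + t) powr (- s) * 1) (at t)"
      using t h s by (intro DERIV_chain2[OF prim_powr_deriv]) (auto intro!: derivative_eq_intros)
    have d2: "((\<lambda>t. prim_powr s (x - t)) has_real_derivative (x - t) powr (- s) * (- 1)) (at t)"
      using t h s by (intro DERIV_chain2[OF prim_powr_deriv]) (auto intro!: derivative_eq_intros)
    have "(\<phi> has_real_derivative (x + t) powr (- s) * 1 - (x - t) powr (- s) * (- 1) - 2 * x powr (- s)) (at t)"
      unfolding \<phi>_def by (intro DERIV_diff d1 d2) (auto intro!: derivative_eq_intros)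
    moreover have "(x + t) powr (- s) * 1 - (x - t) powr (- s) * (- 1) - 2 * x powr (- s) \<ge> 0"
      using powr_midpoint[of s t x] s t h by simp
    ultimately show "\<exists>y. (\<phi> has_real_derivative y) (at t) \<and> 0 \<le> y" by blast
  qed
  then show ?thesis by (simp add: \<phi>_def)
qed

text \<open>The excess of half the integral of \<open>x powr (- s)\<close> over
  \<open>[Q, 3 Q]\<close> over the sum on the values of \<open>P\<close>. The integral is halved
  because \<open>P\<close> moves in steps of two. All bounds for \<open>Phi_wr\<close> become bounds
  for this quantity.\<close>

definition step_defect :: "real \<Rightarrow> nat \<Rightarrow> real" where
  "step_defect s Q = (prim_powr s (3 * Q) - prim_powr s Q) / 2 - (\<Sum>j\<in>{1..<Q}. real (Q + 2 * j) powr (- s))"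

text \<open>The integrand decreases, so the integral lies between the right and the left step sum.
  Compared with the sum over \<open>1 \<le> j < Q\<close>, the left one has the extra term at
  \<open>Q\<close>, the right one that at \<open>3 Q\<close>.\<close>

lemma step_defect_bounds:
  assumes s: "s > 1" and Q: "Q \<ge> 1"
  shows "step_defect s Q \<le> real Q powr (- s)" "(3 * real Q) powr (- s) \<le> step_defect s Q"
proof -
  define g where "g = (\<lambda>j. prim_powr s (real (Q + 2 * j)))"
  have "(\<Sum>j<Q. g (Suc j) - g j) = g Q - g 0" by (rule sum_lessThan_telescope)
  then have tel: "prim_powr s (3 * Q) - prim_powr s Q = (\<Sum>j<Q. g (Suc j) - g j)"
    by (simp add: g_def)
  have b: "g (Suc j) - g j \<le> 2 * real (Q + 2 * j) powr (- s)" "2 * real (Q + 2 * Suc j) powr (- s) \<le> g (Suc j) - g j" for j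
  proof -
    have e: "real (Q + 2 * Suc j) = real (Q + 2 * j) + 2" by simp
    show "g (Suc j) - g j \<le> 2 * real (Q + 2 * j) powr (- s)" "2 * real (Q + 2 * Suc j) powr (- s) \<le> g (Suc j) - g j"
      using prim_powr_bounds[OF s, of "real (Q + 2 * j)" "real (Q + 2 * j) + 2"] Q unfolding g_def e by auto
  qed
  have "(prim_powr s (3 * Q) - prim_powr s Q) / 2 \<le> (\<Sum>j<Q. real (Q + 2 * j) powr (- s))"
    unfolding tel sum_divide_distrib by (intro sum_mono) (use b(1) in \<open>simp add: field_simps\<close>)
  also have "(\<Sum>j<Q. real (Q + 2 * j) powr (- s)) = real Q powr (- s) + (\<Sum>j\<in>{1..<Q}. real (Q + 2 * j) powr (- s))"
    using Q by (simp add: lessThan_atLeast0 sum.atLeast_Suc_lessThan)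
  finally show "step_defect s Q \<le> real Q powr (- s)" unfolding step_defect_def by linarith
  have "(\<Sum>j<Q. real (Q + 2 * Suc j) powr (- s)) \<le> (prim_powr s (3 * Q) - prim_powr s Q) / 2"
    unfolding tel sum_divide_distrib by (intro sum_mono) (use b(2) in \<open>simp add: field_simps\<close>)
  also have "(\<Sum>j<Q. real (Q + 2 * Suc j) powr (- s)) = (\<Sum>j\<in>{1..<Suc Q}. real (Q + 2 * j) powr (- s))"
    by (rule sum.reindex_bij_witness[of _ "\<lambda>j. j - 1" Suc]) auto
  also have "\<dots> = (\<Sum>j\<in>{1..<Q}. real (Q + 2 * j) powr (- s)) + (3 * real Q) powr (- s)"
    using Q by (simp add: sum.atLeastLessThan_Suc)
  finally show "(3 * real Q) powr (- s) \<le> step_defect s Q" unfolding step_defect_def by linarith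
qed

text \<open>Cells of length 2 around the points \<open>Q + 2 * j\<close> fill
  \<open>[Q + 1, 3 Q - 1]\<close>, where the midpoint rule does not exceed the integral. The gain
  comes from the unit intervals left over at the ends, bounded by the midpoint value on the left and
  by the endpoint value on the right.\<close>

lemma step_defect_large:
  assumes s: "1 < s" "s \<le> 3 / 2" and Q: "Q \<ge> 2"
  shows "(1 + 3 powr (- s)) * real Q powr (- s) < 3 * step_defect s Q"
proof -
  define g where "g = (\<lambda>j. prim_powr s (real (Q + 2 * j) - 1))"
  have tel: "(\<Sum>j\<in>{1..<Q}. g (Suc j) - g j) = g Q - g 1"
    using Q by (intro sum_Suc_diff') auto
  have "2 * real (Q + 2 * j) powr (- s) \<le> g (Suc j) - g j" for j
    using prim_powr_midpoint[OF s(1), of 1 "real (Q + 2 * j)"] Q by (simp add: g_def algebra_simps)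
  then have "(\<Sum>j\<in>{1..<Q}. 2 * real (Q + 2 * j) powr (- s)) \<le> g Q - g 1"
    unfolding tel[symmetric] by (intro sum_mono)
  then have m: "2 * (\<Sum>j\<in>{1..<Q}. real (Q + 2 * j) powr (- s)) \<le> prim_powr s (3 * real Q - 1) - prim_powr s (real Q + 1)"
    using Q by (simp add: g_def sum_distrib_left algebra_simps of_nat_diff)
  have l: "(real Q + 1 / 2) powr (- s) \<le> prim_powr s (real Q + 1) - prim_powr s Q"
    using prim_powr_midpoint[OF s(1), of "1 / 2" "real Q + 1 / 2"] Q by (simp add: algebra_simps)
  have r: "(3 * real Q) powr (- s) \<le> prim_powr s (3 * real Q) - prim_powr s (3 * real Q - 1)"
    using prim_powr_bounds(2)[OF s(1), of "3 * real Q - 1" "3 * real Q"] Q by simp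
  have e: "(3 * real Q) powr (- s) = 3 powr (- s) * real Q powr (- s)" by (simp add: powr_mult)
  have "2 * step_defect s Q \<ge> (real Q + 1 / 2) powr (- s) + 3 powr (- s) * real Q powr (- s)"
  proof -
    have "2 * step_defect s Q = prim_powr s (3 * real Q) - prim_powr s Q - 2 * (\<Sum>j\<in>{1..<Q}. real (Q + 2 * j) powr (- s))"
      by (simp add: step_defect_def field_simps)
    then show ?thesis using m l r unfolding e by linarith
  qed
  \<comment> \<open>The factor 2/3 compensates the 3/2 that arises from
    \<open>3 * step_defect s Q\<close>. As \<open>Q \<ge> 2\<close>, \<open>Q + 1 / 2\<close> is at
    most \<open>5 / 4\<close> times \<open>Q\<close>, and the restriction
    \<open>s \<le> 3 / 2\<close> enters through (4/5)^(3/2) > 2/3.\<close>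
  moreover have "(real Q + 1 / 2) powr (- s) > 2 / 3 * real Q powr (- s)"
  proof -
    have "(2 / 3 :: real) < (4 / 5) powr (3 / 2)"
    proof (rule power2_less_imp_less)
      have "((4 / 5 :: real) powr (3 / 2))\<^sup>2 = (4 / 5) powr 3"
        unfolding power2_eq_square powr_add[symmetric] by simp
      also have "\<dots> = (4 / 5) ^ 3" by simp
      finally show "(2 / 3 :: real)\<^sup>2 < ((4 / 5) powr (3 / 2))\<^sup>2" by (simp add: power2_eq_square power3_eq_cube)
    qed simp
    also have "(4 / 5 :: real) powr (3 / 2) \<le> (4 / 5) powr s"
      using s by (intro powr_mono') auto
    also have "\<dots> = (5 / 4) powr (- s)" by (simp add: powr_minus powr_divide field_simps)
    finally have "2 / 3 * real Q powr (- s) < (5 / 4) powr (- s) * real Q powr (- s)"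
      using Q by (intro mult_strict_right_mono) auto
    also have "\<dots> = (5 / 4 * real Q) powr (- s)" by (simp add: powr_mult del: times_divide_eq_left)
    also have "\<dots> \<le> (real Q + 1 / 2) powr (- s)"
      using Q s by (intro powr_mono2') auto
    finally show ?thesis .
  qed
  moreover have "3 powr (- s) * real Q powr (- s) > 0" using Q by simp
  ultimately show ?thesis by (simp add: distrib_right)
qed

text \<open>For \<open>Q = 1\<close> the sum is empty and the claim concerns the integral over
  [1, 3] alone, which decreases in \<open>s\<close>. On each of the ranges up to 5/4 and from 5/4 to
  3/2 the integral is taken at the right end and the left-hand side is bounded at the left
  end.\<close>

lemma step_defect_1:
  assumes s: "1 < s" "s \<le> 3 / 2"
  shows "1 + 3 powr (- s) < 3 * step_defect s 1"
proof -
  have mono: "prim_powr t 3 - prim_powr t 1 \<le> prim_powr s 3 - prim_powr s 1" if "s \<le> t" "1 < s" for s t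
  proof -
    have "prim_powr s 1 - prim_powr t 1 \<le> prim_powr s 3 - prim_powr t 3"
    proof (rule DERIV_nonneg_imp_nondecreasing[of 1 3 "\<lambda>x. prim_powr s x - prim_powr t x"])
      fix x :: real assume x: "1 \<le> x" "x \<le> 3"
      have "((\<lambda>x. prim_powr s x - prim_powr t x) has_real_derivative x powr (- s) - x powr (- t)) (at x)"
        using that x by (intro DERIV_diff prim_powr_deriv) auto
      moreover have "x powr (- t) \<le> x powr (- s)" using that x by (intro powr_mono) auto
      ultimately show "\<exists>y. ((\<lambda>x. prim_powr s x - prim_powr t x) has_real_derivative y) (at x) \<and> 0 \<le> y"
        by (intro exI[of _ "x powr (- s) - x powr (- t)"]) auto
    qed simp
    then show ?thesis by simp
  qed
  \<comment> \<open>At exponents that are multiples of 1/4 all powers of 3 become powers of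
    \<open>y\<close>, so rational bounds for \<open>y\<close> decide the inequalities.\<close>
  define y :: real where "y = 3 powr (- 1 / 4)"
  have y: "y > 0" "y ^ 4 = 1 / 3"
  proof -
    have "y ^ 4 = 3 powr (- 1 / 4 * real 4)" unfolding y_def by (subst powr_powr[symmetric]) (simp add: powr_realpow)
    then show "y ^ 4 = 1 / 3" by (simp add: powr_minus)
  qed (simp add: y_def)
  have y_less: "y < c" if "c > 0" "c ^ 4 > 1 / 3" for c
    using power_less_imp_less_base[of y 4 c] y that by simp
  have yp: "y ^ n = 3 powr (- real n / 4)" for n
  proof -
    have "y ^ n = 3 powr (- 1 / 4 * real n)" unfolding y_def by (subst powr_powr[symmetric]) (simp add: powr_realpow)
    then show ?thesis by simp
  qed
  have sd: "step_defect s 1 = (prim_powr s 3 - prim_powr s 1) / 2" by (simp add: step_defect_def)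
  show ?thesis
  proof (cases "s \<le> 5 / 4")
    case True
    have "prim_powr (5 / 4) 3 - prim_powr (5 / 4) 1 = 4 * (1 - y)"
      using yp[of 1] by (simp add: prim_powr_def)
    then have "3 * step_defect s 1 \<ge> 6 * (1 - y)"
      using mono[OF True s(1)] unfolding sd by simp
    \<comment> \<open>Chosen because 6 (1 - 7/9) = 4/3 = 1 + 1/3.\<close>
    moreover have "y < 7 / 9" by (rule y_less) (simp_all add: power4_eq_xxxx)
    moreover have "(3 :: real) powr (- s) \<le> 3 powr (- 1)" using s by (intro powr_mono) auto
    ultimately show ?thesis by (simp add: powr_minus)
  next
    case False
    have "prim_powr (3 / 2) 3 - prim_powr (3 / 2) 1 = 2 * (1 - y\<^sup>2)"
      using yp[of 2] by (simp add: prim_powr_def)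
    then have "3 * step_defect s 1 \<ge> 3 * (1 - y\<^sup>2)"
      using mono[OF s(2,1)] unfolding sd by simp
    moreover have "(3 :: real) powr (- s) \<le> y ^ 5" unfolding yp using False by (intro powr_mono) auto
    moreover have "y ^ 5 = y / 3" using y(2) by (simp add: eval_nat_numeral)
    \<comment> \<open>Sharp enough that 3 (1 - 0.76^2) exceeds 1 + 0.76 / 3.\<close>
    moreover have yb: "y < 76 / 100" by (rule y_less) (simp_all add: power4_eq_xxxx)
    moreover have "y\<^sup>2 < (76 / 100)\<^sup>2" using y(1) yb by (intro power_strict_mono) auto
    ultimately show ?thesis by (simp add: power2_eq_square)
  qed
qed

lemma step_defect_lower:
  assumes "1 < s" "s \<le> 3 / 2" "Q \<ge> 1"
  shows "(1 + 3 powr (- s)) * real Q powr (- s) < 3 * step_defect s Q"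
  using step_defect_1[OF assms(1,2)] step_defect_large[OF assms(1,2), of Q] assms(3) by (cases "Q = 1") auto

section \<open>Transfer of the series from complex to real arguments\<close>

lemma dirichlet_series_real:
  fixes a :: "nat \<Rightarrow> real"
  assumes "dir_abs (\<lambda>n. of_real (a n)) (of_real s)"
  shows "((\<lambda>n. a n / real n powr s) has_sum dirichlet_series a s) {1..}"
    "complex_of_real (dirichlet_series a s) = dirichlet_series (\<lambda>n. of_real (a n)) (of_real s)"
proof -
  have "(\<lambda>n. norm (a n / real n powr s)) summable_on {1..}"
    using assms unfolding dir_abs_def norm_divide norm_of_nat_powr by simp
  then have "(\<lambda>n. a n / real n powr s) summable_on {1..}" by (rule Infinite_Sum.abs_summable_summable)
  then show hs: "((\<lambda>n. a n / real n powr s) has_sum dirichlet_series a s) {1..}"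
    unfolding dirichlet_series_def by (simp add: has_sum_infsum)
  have eq: "complex_of_real (a n / real n powr s) = of_real (a n) / of_nat n powr of_real s" for n
    using powr_of_real[of "real n" s] by simp
  have "((\<lambda>n. of_real (a n) / of_nat n powr of_real s) has_sum complex_of_real (dirichlet_series a s)) {1..}"
    using has_sum_of_real[OF hs, where 'a = complex] unfolding eq .
  then show "complex_of_real (dirichlet_series a s) = dirichlet_series (\<lambda>n. of_real (a n)) (of_real s)"
    unfolding dirichlet_series_def[of "\<lambda>n. complex_of_real (a n)"] by (simp add: infsumI)
qed

lemma real_zeta:
  assumes s: "s > 1"
  shows "((\<lambda>n. 1 / real n powr s) has_sum zeta s) {1..}" "zeta (complex_of_real s) = of_real (zeta s)" "zeta s > 0"
proof -
  note d = dirichlet_series_real[of "\<lambda>_. 1" s] 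
  have a: "dir_abs (\<lambda>n. of_real 1) (of_real s)" using dir_abs_1[of "of_real s"] s by simp
  show hs: "((\<lambda>n. 1 / real n powr s) has_sum zeta s) {1..}" using d(1)[OF a] by (simp add: zeta_def)
  show "zeta (complex_of_real s) = of_real (zeta s)" using d(2)[OF a] by (simp add: zeta_def)
  have "(\<Sum>n\<in>{1}. 1 / real n powr s) \<le> zeta s"
    by (rule has_sum_mono_neutral[OF has_sum_finite hs]) auto
  then show "zeta s > 0" by simp
qed

text \<open>Positivity is read off the series of \<open>card (eis_reps n)\<close>, which equals six
  times the product, has non-negative coefficients and begins with 6.\<close>

lemma real_L_zeta:
  assumes s: "s > 1"
  shows "L_chi3 (complex_of_real s) = of_real (L_chi3 s)" "L_chi3 s * zeta s > 0"
proof -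
  have "dir_abs (\<lambda>n. of_real (of_int (chi3 n))) (of_real s)"
    using dir_abs_bounded[of "of_real s" "\<lambda>n. of_int (chi3 n)"] norm_chi3 s by simp
  then show L: "L_chi3 (complex_of_real s) = of_real (L_chi3 s)"
    using dirichlet_series_real(2)[of "\<lambda>n. of_int (chi3 n)" s] by (simp add: L_chi3_def)
  define R where "R = dirichlet_series (\<lambda>n. real (card (eis_reps n))) s"
  have a: "dir_abs (\<lambda>n. of_real (real (card (eis_reps n)))) (of_real s)"
    using eis_reps_series(1)[of "of_real s"] s by simp
  note d = dirichlet_series_real[OF a, folded R_def]
  have "(\<Sum>n\<in>{1}. real (card (eis_reps n)) / real n powr s) \<le> R"
    by (rule has_sum_mono_neutral[OF has_sum_finite d(1)]) auto
  moreover have "card (eis_reps 1) = 6" unfolding eis_reps_1 by simp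
  ultimately have "R > 0" by simp
  moreover have "complex_of_real R = of_real (6 * (L_chi3 s * zeta s))"
    using d(2) eis_reps_series(2)[of "of_real s"] s L real_zeta(2)[OF s] by simp
  then have "R = 6 * (L_chi3 s * zeta s)" by (simp only: of_real_eq_iff)
  ultimately show "L_chi3 s * zeta s > 0" by simp
qed

definition T_real :: "real \<Rightarrow> real" where
  "T_real s = infsum (\<lambda>Q. real Q powr (- s) * (\<Sum>j\<in>{1..<Q}. real (Q + 2 * j) powr (- s))) {1..}"

lemma T_real:
  assumes s: "s > 1"
  shows "((\<lambda>Q. real Q powr (- s) * (\<Sum>j\<in>{1..<Q}. real (Q + 2 * j) powr (- s))) has_sum T_real s) {1..}"
    "T_series (of_real s) = of_real (T_real s)"
proof -
  define f where "f = (\<lambda>Q. real Q powr (- s) * (\<Sum>j\<in>{1..<Q}. real (Q + 2 * j) powr (- s)))"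
  have p: "1 / complex_of_real (real n) powr of_real s = of_real (real n powr (- s))" for n
    by (subst powr_of_real) (simp_all add: powr_minus divide_inverse)
  have p': "1 / complex_of_nat n powr of_real s = of_real (real n powr (- s))" for n
    using p[of n] by simp
  have eq: "1 / of_nat Q powr of_real s * (\<Sum>j\<in>{1..<Q}. 1 / of_nat (Q + 2 * j) powr of_real s) = complex_of_real (f Q)" for Q
    unfolding p' f_def by (simp only: of_real_mult of_real_sum)
  have s': "Re (of_real s) > 1" using s by simp
  note t = T_series_Sigma[OF s', unfolded eq]
  have "(\<lambda>Q. norm (f Q)) summable_on {1..}" using t(2) by simp
  then have "f summable_on {1..}" by (rule Infinite_Sum.abs_summable_summable)
  then have hs: "(f has_sum T_real s) {1..}" unfolding T_real_def f_def[symmetric] by simp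
  then show "((\<lambda>Q. real Q powr (- s) * (\<Sum>j\<in>{1..<Q}. real (Q + 2 * j) powr (- s))) has_sum T_real s) {1..}"
    unfolding f_def .
  show "T_series (of_real s) = of_real (T_real s)"
    using has_sum_unique[OF t(1) has_sum_of_real[OF hs]] .
qed

lemma Phi_wr_real:
  assumes s: "s > 1"
  shows "Phi_wr s = L_chi3 s * zeta s + 3 / (1 + 3 powr (- s)) * (L_chi3 s * zeta s / zeta (2 * s)) * T_real s"
proof -
  have s': "Re (of_real s) > 1" using s by simp
  have three: "(3 :: complex) powr (- of_real s) = of_real (3 powr (- s))"
    using powr_of_real[of 3 "- s"] by simp
  have a: "dir_abs (\<lambda>n. of_real (real (a_tri n))) (of_real s)" using Phi_wr_T(1)[OF s'] by simp
  have "complex_of_real (Phi_wr s) = Phi_wr (of_real s)"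
    using dirichlet_series_real(2)[OF a] by (simp add: Phi_wr_def)
  also have "\<dots> = Phi_tri (of_real s) + 1 / 2 * (T_series (of_real s) * (6 / (1 + 3 powr (- of_real s)) * Phi_pr (of_real s)))"
    unfolding Phi_wr_T(2)[OF s'] red_series_Phi_pr[OF s'] ..
  also have "\<dots> = of_real (L_chi3 s * zeta s + 1 / 2 * (T_real s * (6 / (1 + 3 powr (- s)) * (L_chi3 s * zeta s / zeta (2 * s)))))"
    unfolding Phi_tri_def Phi_pr_def T_real(2)[OF s] three real_L_zeta(1)[OF s] real_zeta(2)[OF s]
    using real_zeta(2)[of "2 * s"] s by simp
  finally have "Phi_wr s = L_chi3 s * zeta s + 1 / 2 * (T_real s * (6 / (1 + 3 powr (- s)) * (L_chi3 s * zeta s / zeta (2 * s))))"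
    by (simp only: of_real_eq_iff)
  then show ?thesis by simp
qed

text \<open>The integral over \<open>[Q, 3 Q]\<close> scales like \<open>Q powr (1 - s)\<close>;
  together with the outer factor \<open>Q powr (- s)\<close> it sums to
  \<open>zeta (2 * s - 1)\<close>.\<close>

lemma step_defect_sum:
  assumes s: "s > 1"
  shows "((\<lambda>Q. real Q powr (- s) * step_defect s Q) has_sum
    (1 / 2 * ((1 - 3 powr (1 - s)) / (s - 1)) * zeta (2 * s - 1) - T_real s)) {1..}"
proof -
  have z: "((\<lambda>n. 1 / real n powr (2 * s - 1)) has_sum zeta (2 * s - 1)) {1..}"
    using s by (intro real_zeta(1)) simp
  have "((\<lambda>Q. 1 / 2 * ((1 - 3 powr (1 - s)) / (s - 1)) * (1 / real Q powr (2 * s - 1))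
      - real Q powr (- s) * (\<Sum>j\<in>{1..<Q}. real (Q + 2 * j) powr (- s))) has_sum
    (1 / 2 * ((1 - 3 powr (1 - s)) / (s - 1)) * zeta (2 * s - 1) - T_real s)) {1..}"
    unfolding diff_conv_add_uminus[of "_ * zeta _"] diff_conv_add_uminus[of "_ * (1 / _)"]
    by (rule has_sum_add[OF has_sum_cmult_right[OF z] has_sum_uminusI[OF T_real(1)[OF s]]])
  also have "?this \<longleftrightarrow> ?thesis"
  proof (rule has_sum_cong)
    fix Q :: nat assume "Q \<in> {1..}"
    have p: "prim_powr s (3 * Q) - prim_powr s Q = (1 - 3 powr (1 - s)) / (s - 1) * real Q powr (1 - s)"
    proof -
      have "(3 * real Q) powr (1 - s) = 3 powr (1 - s) * real Q powr (1 - s)" by (simp add: powr_mult)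
      moreover have "- (t * q) / d - - q / d = (1 - t) / d * q" for t q d :: real
        by (simp add: left_diff_distrib diff_divide_distrib)
      ultimately show ?thesis by (simp add: prim_powr_def)
    qed
    have q: "1 / real Q powr (2 * s - 1) = real Q powr (- s) * real Q powr (1 - s)"
    proof -
      have e: "- s + (1 - s) = - (2 * s - 1)" by simp
      show ?thesis unfolding powr_add[symmetric] e powr_minus_divide[of "real Q" "2 * s - 1"] ..
    qed
    have gen: "1 / 2 * V * (m * q) - m * S = m * ((V * q) / 2 - S)" for V m q S :: real
      by (simp add: algebra_simps)
    show "1 / 2 * ((1 - 3 powr (1 - s)) / (s - 1)) * (1 / real Q powr (2 * s - 1))
      - real Q powr (- s) * (\<Sum>j\<in>{1..<Q}. real (Q + 2 * j) powr (- s)) = real Q powr (- s) * step_defect s Q"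
      unfolding step_defect_def p q by (rule gen)
  qed
  finally show ?thesis .
qed

text \<open>In terms of \<open>G\<close>, \<open>\<Delta>\<close>, \<open>z = zeta (2 * s)\<close>
  and \<open>c = 1 + 3 powr (- s)\<close> one has
  \<open>D_tri s = 3 * G * (\<Delta> + T_real s)\<close>, \<open>E_tri s = 3 * G * z\<close> and
  \<open>Phi_wr s = G * z * c + 3 * G * T_real s\<close>. The claims thus follow from
  \<open>\<Delta> \<le> z\<close>, \<open>\<Delta> > 0\<close> and
  \<open>c * z < 3 * \<Delta>\<close>, each of which is proved term by term in
  \<open>Q\<close>.\<close>

theorem Phi_wr_bounds:
  assumes s: "s > 1"
  shows "D_tri s - E_tri s < Phi_wr s" "Phi_wr s < D_tri s + Phi_tri s"
    "s \<le> 3 / 2 \<Longrightarrow> Phi_wr s < D_tri s"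
proof -
  define z where "z = zeta (2 * s)"
  define Lz where "Lz = L_chi3 s * zeta s"
  define c where "c = 1 + 3 powr (- s)"
  define G where "G = Lz / (z * c)"
  define \<Delta> where "\<Delta> = 1 / 2 * ((1 - 3 powr (1 - s)) / (s - 1)) * zeta (2 * s - 1) - T_real s"
  have pos: "z > 0" "Lz > 0" "c > 0"
    using real_zeta(3)[of "2 * s"] real_L_zeta(2)[OF s] s by (auto simp: z_def Lz_def c_def add_pos_pos)
  then have G: "G > 0" "Lz = G * z * c" by (simp_all add: G_def)
  have Phi: "Phi_wr s = Lz + 3 * G * T_real s"
    unfolding Phi_wr_real[OF s] G_def Lz_def[symmetric] c_def[symmetric] z_def[symmetric] by (simp add: mult.commute)
  have D: "D_tri s = 3 * G * (\<Delta> + T_real s)"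
  proof -
    have *: "1 / 2 * (3 / c) * V * (L / z) * y * w = 3 * (L * y / (z * c)) * (1 / 2 * V * w)" for V L y w
      by (simp add: mult_ac)
    show ?thesis
      unfolding D_tri_def G_def Lz_def \<Delta>_def c_def[symmetric] z_def[symmetric] * by simp
  qed
  have E: "E_tri s = 3 * G * z"
    unfolding E_tri_def c_def[symmetric] mult.assoc Lz_def[symmetric] using pos by (simp add: G(2))
  have hz: "((\<lambda>Q. real Q powr (- s) * real Q powr (- s)) has_sum z) {1..}"
  proof -
    have "1 / real n powr (2 * s) = real n powr (- s) * real n powr (- s)" for n
    proof -
      have e: "- s + - s = - (2 * s)" by simp
      show ?thesis unfolding powr_add[symmetric] e powr_minus_divide[of "real n" "2 * s"] ..
    qed
    then show ?thesis using real_zeta(1)[of "2 * s"] s unfolding z_def by simp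
  qed
  note h\<Delta> = step_defect_sum[OF s, folded \<Delta>_def]
  have "\<Delta> \<le> z"
    by (rule has_sum_mono[OF h\<Delta> hz]) (use step_defect_bounds(1)[OF s] in \<open>auto intro!: mult_left_mono\<close>)
  then have "3 * G * \<Delta> \<le> 3 * G * z" using G by (intro mult_left_mono) auto
  then show "D_tri s - E_tri s < Phi_wr s"
    unfolding D E Phi using pos by (simp add: algebra_simps)
  have "((\<lambda>Q. real Q powr (- s) * step_defect s Q) has_sum real 1 powr (- s) * step_defect s 1) {1}"
    by (rule has_sum_finiteI) auto
  then have "real 1 powr (- s) * step_defect s 1 \<le> \<Delta>"
  proof (rule has_sum_mono_neutral[OF _ h\<Delta>])
    fix Q assume "Q \<in> {1..} - {1 :: nat}"
    then show "0 \<le> real Q powr (- s) * step_defect s Q"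
      using step_defect_bounds(2)[OF s, of Q] by (intro mult_nonneg_nonneg) (auto intro: order_trans[rotated])
  qed auto
  moreover have "step_defect s 1 > 0" using step_defect_bounds(2)[OF s, of 1] powr_gt_zero[of "3 * real 1" "- s"] by linarith
  ultimately have "\<Delta> > 0" by simp
  then have "3 * G * \<Delta> > 0" using G by simp
  then show "Phi_wr s < D_tri s + Phi_tri s"
    unfolding D Phi Phi_tri_def Lz_def[symmetric] by (simp add: algebra_simps)
  assume s2: "s \<le> 3 / 2"
  have "((\<lambda>Q. c * (real Q powr (- s) * real Q powr (- s))) has_sum c * z) {1..}"
    by (intro has_sum_cmult_right hz)
  then have "c * z < 3 * \<Delta>"
  proof (rule has_sum_strict_mono[OF _ has_sum_cmult_right[OF h\<Delta>], of _ _ 3 1])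
    have *: "c * (real Q powr (- s) * real Q powr (- s)) < 3 * (real Q powr (- s) * step_defect s Q)" if "Q \<ge> 1" for Q
    proof -
      have "real Q powr (- s) * (c * real Q powr (- s)) < real Q powr (- s) * (3 * step_defect s Q)"
        using step_defect_lower[OF s s2 that] that unfolding c_def by (intro mult_strict_left_mono) auto
      then show ?thesis by (simp add: algebra_simps)
    qed
    show "c * (real Q powr (- s) * real Q powr (- s)) \<le> 3 * (real Q powr (- s) * step_defect s Q)" if "Q \<in> {1..}" for Q
      using *[of Q] that by auto
    show "c * (real 1 powr (- s) * real 1 powr (- s)) < 3 * (real 1 powr (- s) * step_defect s 1)"
      by (rule *) simp
  qed simp
  then have "G * (c * z) < G * (3 * \<Delta>)" using G by (intro mult_strict_left_mono)
  then show "Phi_wr s < D_tri s"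
    unfolding D Phi G(2) by (simp add: algebra_simps)
qed

section \<open>The value of L at 1\<close>

lemma deriv_power_div:
  "((\<lambda>t. t ^ Suc n / real (Suc n)) has_real_derivative t ^ n) (at t)"
proof -
  have "((\<lambda>t. t ^ Suc n / real (Suc n)) has_real_derivative (real (Suc n) * t ^ (Suc n - Suc 0)) / real (Suc n)) (at t)"
    by (intro DERIV_cdivide DERIV_pow)
  then show ?thesis by simp
qed

text \<open>The series is the integral of 1 / (1 + t + t^2) over [0, 1], with primitive
  \<open>A\<close>. Truncating the geometric expansion after \<open>N\<close> blocks leaves at most
  t^(3N) in the integrand, whence the error 1 / (3 N + 1). Integrals are compared through the signs
  of derivatives.\<close>

lemma L_chi3_at_1: "(\<lambda>j. 1 / (3 * real j + 1) - 1 / (3 * real j + 2)) sums (pi / (3 * sqrt 3))"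
proof -
  define A where "A = (\<lambda>t. 2 / sqrt 3 * arctan ((2 * t + 1) / sqrt 3))"
  define \<phi> where "\<phi> = (\<lambda>N t. \<Sum>j<N. t ^ (3 * j + 1) / (3 * real j + 1) - t ^ (3 * j + 2) / (3 * real j + 2))"
  have q: "1 + t + t\<^sup>2 > 0" for t :: real
    using zero_le_power2[of "t + 1 / 2"] by (simp add: power2_eq_square algebra_simps)
  have dA: "(A has_real_derivative 1 / (1 + t + t\<^sup>2)) (at t)" for t
  proof -
    have "(A has_real_derivative 2 / sqrt 3 * (inverse (1 + ((2 * t + 1) / sqrt 3)\<^sup>2) * (2 / sqrt 3))) (at t)"
      unfolding A_def by (auto intro!: derivative_eq_intros)
    moreover have "1 + ((2 * t + 1) / sqrt 3)\<^sup>2 = 4 / 3 * (1 + t + t\<^sup>2)"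
    proof -
      have "((2 * t + 1) / sqrt 3)\<^sup>2 = (2 * t + 1)\<^sup>2 / 3" by (simp add: power_divide)
      then show ?thesis by (simp add: power2_eq_square algebra_simps)
    qed
    moreover have "2 / sqrt 3 * (inverse (4 / 3 * y) * (2 / sqrt 3)) = 1 / y" for y :: real
    proof -
      have "2 / sqrt 3 * (inverse (4 / 3 * y) * (2 / sqrt 3)) = (2 / sqrt 3 * (2 / sqrt 3)) * inverse (4 / 3 * y)"
        by (simp only: mult_ac)
      also have "2 / sqrt 3 * (2 / sqrt 3) = (4 / 3 :: real)" by simp
      finally show ?thesis by (cases "y = 0") (simp_all add: field_simps)
    qed
    ultimately show ?thesis by (simp only:)
  qed
  have d\<phi>: "(\<phi> N has_real_derivative (1 - t ^ (3 * N)) / (1 + t + t\<^sup>2)) (at t)" for N t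
  proof -
    have "((\<lambda>t. t ^ (3 * j + 1) / (3 * real j + 1) - t ^ (3 * j + 2) / (3 * real j + 2))
      has_real_derivative t ^ (3 * j) - t ^ (3 * j + 1)) (at t)" for j
    proof -
      have "((\<lambda>t. t ^ (3 * j + 1) / (3 * real j + 1)) has_real_derivative t ^ (3 * j)) (at t)"
        using deriv_power_div[of "3 * j" t] by (simp add: add.commute)
      moreover have "((\<lambda>t. t ^ (3 * j + 2) / (3 * real j + 2)) has_real_derivative t ^ (3 * j + 1)) (at t)"
        using deriv_power_div[of "3 * j + 1" t] by (simp add: add.commute)
      ultimately show ?thesis by (rule DERIV_diff)
    qed
    then have "(\<phi> N has_real_derivative (\<Sum>j<N. t ^ (3 * j) - t ^ (3 * j + 1))) (at t)"
      unfolding \<phi>_def by (intro DERIV_sum)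
    moreover have "(1 + t + t\<^sup>2) * (\<Sum>j<N. t ^ (3 * j) - t ^ (3 * j + 1)) = 1 - t ^ (3 * N)"
    proof (induction N)
      case (Suc N)
      have "(1 + t + t\<^sup>2) * (t ^ (3 * N) - t ^ (3 * N + 1)) = t ^ (3 * N) - t ^ (3 * Suc N)"
      proof -
        have "t ^ (3 * N + 1) = t ^ (3 * N) * t" "t ^ (3 * Suc N) = t ^ (3 * N) * t * t * t"
          by (simp_all add: power_add power3_eq_cube)
        then show ?thesis by (simp only: power2_eq_square) (simp add: algebra_simps)
      qed
      then show ?case using Suc by (simp add: distrib_left)
    qed simp
    moreover have "x = z / y" if "y \<noteq> 0" "y * x = z" for x y z :: real
      using that by (simp add: eq_divide_eq mult.commute)
    then have "(\<Sum>j<N. t ^ (3 * j) - t ^ (3 * j + 1)) = (1 - t ^ (3 * N)) / (1 + t + t\<^sup>2)"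
      using less_imp_neq[OF q[of t], symmetric] calculation(2) by blast
    ultimately show ?thesis by (simp only:)
  qed
  have lim: "A 1 - A 0 = pi / (3 * sqrt 3)"
  proof -
    have s3: "3 / sqrt 3 = sqrt 3" by (simp add: real_div_sqrt)
    have a1: "arctan (sqrt 3) = pi / 3" "arctan (1 / sqrt 3) = pi / 6"
      using arctan_unique[of "pi / 3" "sqrt 3"] arctan_unique[of "pi / 6" "1 / sqrt 3"] pi_gt_zero
      by (simp_all add: tan_60 tan_30)
    have "A 1 = 2 / sqrt 3 * arctan (3 / sqrt 3)" "A 0 = 2 / sqrt 3 * arctan (1 / sqrt 3)"
      by (simp_all add: A_def)
    then have "A 1 = 2 / sqrt 3 * (pi / 3)" "A 0 = 2 / sqrt 3 * (pi / 6)"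
      by (simp_all only: s3 a1)
    then have "A 1 - A 0 = 2 / sqrt 3 * (pi / 3 - pi / 6)" by (simp only: right_diff_distrib)
    then show ?thesis by simp
  qed
  have lower: "\<phi> N 1 - \<phi> N 0 \<le> A 1 - A 0" for N
  proof -
    have "A 0 - \<phi> N 0 \<le> A 1 - \<phi> N 1"
    proof (rule DERIV_nonneg_imp_nondecreasing[of 0 1 "\<lambda>t. A t - \<phi> N t"])
      fix t :: real assume t: "0 \<le> t" "t \<le> 1"
      have "1 / (1 + t + t\<^sup>2) - (1 - t ^ (3 * N)) / (1 + t + t\<^sup>2) \<ge> 0"
        using t q[of t] by (simp add: diff_divide_distrib)
      then show "\<exists>y. ((\<lambda>t. A t - \<phi> N t) has_real_derivative y) (at t) \<and> 0 \<le> y"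
        using DERIV_diff[OF dA d\<phi>] by blast
    qed simp
    then show ?thesis by simp
  qed
  have upper: "A 1 - A 0 \<le> \<phi> N 1 - \<phi> N 0 + 1 / (3 * real N + 1)" for N
  proof -
    have "\<phi> N 0 + 0 ^ (3 * N + 1) / (3 * real N + 1) - A 0 \<le> \<phi> N 1 + 1 ^ (3 * N + 1) / (3 * real N + 1) - A 1"
    proof (rule DERIV_nonneg_imp_nondecreasing[of 0 1 "\<lambda>t. \<phi> N t + t ^ (3 * N + 1) / (3 * real N + 1) - A t"])
      fix t :: real assume t: "0 \<le> t" "t \<le> 1"
      have d: "((\<lambda>t. t ^ (3 * N + 1) / (3 * real N + 1)) has_real_derivative t ^ (3 * N)) (at t)"
        using deriv_power_div[of "3 * N" t] by (simp add: add.commute)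
      have "t ^ (3 * N) / (1 + t + t\<^sup>2) \<le> t ^ (3 * N) / 1"
        using t q[of t] by (intro divide_left_mono) auto
      then have "(1 - t ^ (3 * N)) / (1 + t + t\<^sup>2) + t ^ (3 * N) - 1 / (1 + t + t\<^sup>2) \<ge> 0"
        by (simp add: diff_divide_distrib)
      then show "\<exists>y. ((\<lambda>t. \<phi> N t + t ^ (3 * N + 1) / (3 * real N + 1) - A t) has_real_derivative y) (at t) \<and> 0 \<le> y"
        using DERIV_diff[OF DERIV_add[OF d\<phi> d] dA] by blast
    qed simp
    then show ?thesis by simp
  qed
  have \<phi>01: "\<phi> N 0 = 0" "\<phi> N 1 = (\<Sum>j<N. 1 / (3 * real j + 1) - 1 / (3 * real j + 2))" for N
    by (simp_all add: \<phi>_def)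
  have "(\<lambda>N. \<phi> N 1) \<longlonglongrightarrow> pi / (3 * sqrt 3)"
  proof (rule tendsto_sandwich)
    show "\<forall>\<^sub>F N in sequentially. pi / (3 * sqrt 3) - 1 / (3 * real N + 1) \<le> \<phi> N 1"
      using upper lim \<phi>01(1) by (intro always_eventually) (simp add: algebra_simps)
    show "\<forall>\<^sub>F N in sequentially. \<phi> N 1 \<le> pi / (3 * sqrt 3)"
      using lower lim \<phi>01(1) by (intro always_eventually) simp
    have "(\<lambda>N. c - 1 / (3 * real N + 1)) \<longlonglongrightarrow> c" for c by real_asymp
    then show "(\<lambda>N. pi / (3 * sqrt 3) - 1 / (3 * real N + 1)) \<longlonglongrightarrow> pi / (3 * sqrt 3)" .
  qed simp
  then show ?thesis unfolding sums_def \<phi>01(2) .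
qed

section \<open>Meromorphic continuation\<close>

text \<open>The Weierstrass test with a majorant that may depend on the point;
  \<open>powr_majorant\<close> provides such majorants.\<close>

lemma holomorphic_suminf_local:
  fixes f :: "nat \<Rightarrow> complex \<Rightarrow> complex"
  assumes A: "open A" and hol: "\<And>n. f n holomorphic_on A"
    and bnd: "\<And>x. x \<in> A \<Longrightarrow> \<exists>d h. 0 < d \<and> summable h \<and> (\<forall>n. \<forall>y\<in>ball x d \<inter> A. norm (f n y) \<le> h n)"
  shows "(\<lambda>z. \<Sum>n. f n z) holomorphic_on A" "\<And>z. z \<in> A \<Longrightarrow> summable (\<lambda>n. f n z)"
proof -
  have d: "(f n has_field_derivative deriv (f n) x) (at x)" if "x \<in> A" for n x
    using holomorphic_derivI[OF hol A that] .
  have "\<exists>g g'. \<forall>x\<in>A. ((\<lambda>n. f n x) sums g x) \<and> ((\<lambda>n. deriv (f n) x) sums g' x) \<and> (g has_field_derivative g' x) (at x)"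
    by (rule series_and_derivative_comparison_local[OF A d]) (use bnd in \<open>force intro: always_eventually\<close>)+
  then obtain g g' where g: "\<And>x. x \<in> A \<Longrightarrow> (\<lambda>n. f n x) sums g x"
    "\<And>x. x \<in> A \<Longrightarrow> (g has_field_derivative g' x) (at x)" by blast
  show "summable (\<lambda>n. f n z)" if "z \<in> A" for z using g(1)[OF that] by (rule sums_summable)
  have "g holomorphic_on A" using g(2) A by (auto simp: holomorphic_on_open)
  then show "(\<lambda>z. \<Sum>n. f n z) holomorphic_on A"
    by (rule holomorphic_transform) (use g(1) sums_unique in blast)
qed

lemma powr_holomorphic:
  assumes "g holomorphic_on A" "n > 0"
  shows "(\<lambda>s. of_nat n powr g s) holomorphic_on A"
  using assms by (intro holomorphic_intros) auto

lemma closed_segment_realE: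
  assumes "z \<in> closed_segment (complex_of_real a) (of_real b)" "a \<le> b"
  obtains t where "z = of_real t" "a \<le> t" "t \<le> b"
  using assms unfolding closed_segment_of_real closed_segment_eq_real_ivl by auto

lemma powr_segment_bound:
  fixes s :: complex
  assumes a: "a > 0" and h: "h \<ge> 0" and s: "Re s > -1"
  shows "norm (of_real (a + h) powr (- s) - of_real a powr (- s)) \<le> norm s * a powr (- Re s - 1) * h"
proof -
  let ?S = "closed_segment (complex_of_real a) (of_real (a + h))"
  have "norm (of_real (a + h) powr (- s) - of_real a powr (- s)) \<le> (norm s * a powr (- Re s - 1)) * norm (complex_of_real (a + h) - of_real a)"
  proof (rule field_differentiable_bound[where S = ?S])
    fix z assume "z \<in> ?S"
    then obtain t where t: "z = of_real t" "a \<le> t" "t \<le> a + h"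
      using h by (auto elim: closed_segment_realE simp del: of_real_add)
    then have "z \<notin> \<real>\<^sub>\<le>\<^sub>0" using a by (simp add: complex_nonpos_Reals_iff)
    then show "((\<lambda>z. z powr (- s)) has_field_derivative (- s) * z powr (- s - 1)) (at z within ?S)"
      by (rule has_field_derivative_at_within[OF has_field_derivative_powr])
    have "norm (z powr (- s - 1)) = t powr (- Re s - 1)"
      using t a by (simp add: norm_powr_real_powr)
    also have "\<dots> \<le> a powr (- Re s - 1)" using t a s by (intro powr_mono2') auto
    finally show "norm (- s * z powr (- s - 1)) \<le> norm s * a powr (- Re s - 1)"
      by (simp add: norm_mult mult_left_mono)
  qed auto
  then show ?thesis using h by simp
qed

text \<open>A Taylor estimate by applying the mean value inequality twice: \<open>G\<close> has the
  linear part removed, so its derivative is a difference of powers, which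
  \<open>powr_segment_bound\<close> controls.\<close>

lemma powr_second_order_bound:
  fixes s :: complex
  assumes a: "a > 0" and h: "h \<ge> 0" and s: "Re s > -1"
  shows "norm (of_real (a + h) powr (1 - s) - of_real a powr (1 - s) - of_real h * (1 - s) * of_real a powr (- s))
    \<le> norm (1 - s) * norm s * a powr (- Re s - 1) * h\<^sup>2"
proof -
  let ?S = "closed_segment (complex_of_real a) (of_real (a + h))"
  define G where "G = (\<lambda>z :: complex. z powr (1 - s) - (1 - s) * of_real a powr (- s) * z)"
  have "norm (G (of_real (a + h)) - G (of_real a)) \<le> (norm (1 - s) * (norm s * a powr (- Re s - 1) * h)) * norm (complex_of_real (a + h) - of_real a)"
  proof (rule field_differentiable_bound[where S = ?S])
    fix z assume "z \<in> ?S"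
    then obtain t where t: "z = of_real t" "t \<ge> a" "t \<le> a + h"
      using h by (auto elim: closed_segment_realE simp del: of_real_add)
    then have "z \<notin> \<real>\<^sub>\<le>\<^sub>0" using a by (simp add: complex_nonpos_Reals_iff)
    then have "((\<lambda>z. z powr (1 - s)) has_field_derivative (1 - s) * z powr (1 - s - 1)) (at z within ?S)"
      by (rule has_field_derivative_at_within[OF has_field_derivative_powr])
    then have "(G has_field_derivative (1 - s) * z powr (1 - s - 1) - (1 - s) * of_real a powr (- s) * 1) (at z within ?S)"
      unfolding G_def by (intro DERIV_diff DERIV_cmult DERIV_ident)
    then show "(G has_field_derivative (1 - s) * z powr (- s) - (1 - s) * of_real a powr (- s)) (at z within ?S)"
      by simp
    have "norm (z powr (- s) - of_real a powr (- s)) \<le> norm s * a powr (- Re s - 1) * (t - a)"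
      using powr_segment_bound[OF a _ s, of "t - a"] t by simp
    also have "\<dots> \<le> norm s * a powr (- Re s - 1) * h" using t by (intro mult_left_mono) auto
    finally show "norm ((1 - s) * z powr (- s) - (1 - s) * of_real a powr (- s)) \<le> norm (1 - s) * (norm s * a powr (- Re s - 1) * h)"
      unfolding right_diff_distrib[symmetric] norm_mult by (intro mult_left_mono) auto
  qed auto
  also have "G (of_real (a + h)) - G (of_real a) = of_real (a + h) powr (1 - s) - of_real a powr (1 - s) - of_real h * (1 - s) * of_real a powr (- s)"
    by (simp add: G_def algebra_simps)
  also have "norm (complex_of_real (a + h) - of_real a) = h" using h by simp
  finally show ?thesis by (simp add: power2_eq_square mult_ac)
qed

lemma has_sum_imp_sums_Suc:
  fixes f :: "nat \<Rightarrow> 'a :: {comm_monoid_add, t2_space}"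
  assumes "(f has_sum S) {1..}"
  shows "(\<lambda>n. f (Suc n)) sums S"
proof -
  have "bij_betw Suc UNIV {1..}"
    by (rule bij_betw_byWitness[where f' = "\<lambda>n. n - 1"]) auto
  then have "((\<lambda>n. f (Suc n)) has_sum S) UNIV"
    using has_sum_reindex_bij_betw[of Suc UNIV "{1..}" f S] assms by simp
  then show ?thesis by (rule has_sum_imp_sums)
qed

text \<open>By continuity, near \<open>x\<close> the coefficient stays below a constant
  \<open>K\<close> and the exponent above \<open>\<sigma>\<close>, the mean of 1 and
  \<open>e x\<close>.\<close>

lemma powr_majorant:
  fixes C :: "complex \<Rightarrow> real"
  assumes A: "open A" and x: "x \<in> A" and C: "continuous_on A C" and e: "continuous_on A e" "e x > 1"
    and bnd: "\<And>n y. y \<in> A \<Longrightarrow> norm (f n y) \<le> C y * real (Suc n) powr (- e y)"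
  shows "\<exists>d h. 0 < d \<and> summable h \<and> (\<forall>n. \<forall>y\<in>ball x d \<inter> A. norm (f n y) \<le> h n)"
proof -
  define K where "K = \<bar>C x\<bar> + 1"
  define \<sigma> where "\<sigma> = (e x + 1) / 2"
  have cont: "isCont C x" "isCont e x" using C e A x continuous_on_eq_continuous_at by blast+
  have "\<forall>\<^sub>F y in nhds x. C y < K \<and> e y > \<sigma>"
  proof (rule eventually_conj)
    show "\<forall>\<^sub>F y in nhds x. C y < K"
      using cont(1) unfolding continuous_at tendsto_at_iff_tendsto_nhds by (rule order_tendstoD) (simp add: K_def)
    show "\<forall>\<^sub>F y in nhds x. e y > \<sigma>"
      using cont(2) unfolding continuous_at tendsto_at_iff_tendsto_nhds by (rule order_tendstoD) (use e(2) in \<open>simp add: \<sigma>_def\<close>)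
  qed
  then obtain d where d: "d > 0" "\<And>y. dist y x < d \<Longrightarrow> C y < K \<and> e y > \<sigma>"
    unfolding eventually_nhds_metric by blast
  have "summable (\<lambda>n. real n powr (- \<sigma>))" using e(2) by (simp add: summable_real_powr_iff \<sigma>_def)
  then have "summable (\<lambda>n. K * real (Suc n) powr (- \<sigma>))"
    by (intro summable_mult) (subst summable_Suc_iff[of "\<lambda>n. real n powr (- \<sigma>)"])
  moreover have "norm (f n y) \<le> K * real (Suc n) powr (- \<sigma>)" if "y \<in> ball x d \<inter> A" for n y
  proof -
    have y: "C y < K" "e y > \<sigma>" using d(2)[of y] that by (auto simp: dist_commute)
    have "norm (f n y) \<le> C y * real (Suc n) powr (- e y)" using bnd that by auto
    also have "\<dots> \<le> K * real (Suc n) powr (- e y)" using y by (intro mult_right_mono) auto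
    also have "\<dots> \<le> K * real (Suc n) powr (- \<sigma>)" using y by (intro mult_left_mono powr_mono) (auto simp: K_def)
    finally show ?thesis .
  qed
  ultimately show ?thesis using d(1) by blast
qed

text \<open>\<open>s - 1\<close> times the error in replacing a term of the zeta series by the
  integral over the following unit interval, the index being shifted to start at 1. The factor
  removes the denominator of the integral, so that \<open>zeta_cont\<close> represents (s - 1)
  \<zeta>(s), also at 1.\<close>

definition zeta_term :: "nat \<Rightarrow> complex \<Rightarrow> complex" where
  "zeta_term n s = (s - 1) * of_nat (Suc n) powr (- s) + of_nat (Suc (Suc n)) powr (1 - s) - of_nat (Suc n) powr (1 - s)"

definition zeta_cont :: "complex \<Rightarrow> complex" where
  "zeta_cont s = 1 + (\<Sum>n. zeta_term n s)"

lemma zeta_term_bound: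
  assumes "Re s > 0"
  shows "norm (zeta_term n s) \<le> norm (1 - s) * norm s * real (Suc n) powr (- (Re s + 1))"
proof -
  have "zeta_term n s = of_real (real (Suc n) + 1) powr (1 - s) - of_real (real (Suc n)) powr (1 - s) - of_real 1 * (1 - s) * of_real (real (Suc n)) powr (- s)"
    by (simp add: zeta_term_def algebra_simps)
  moreover have "- (Re s + 1) = - Re s - 1" by simp
  ultimately show ?thesis
    using powr_second_order_bound[of "real (Suc n)" 1 s] assms by (simp only:) simp
qed

lemma open_Re_gt: "open {s. c < Re s}"
  by (intro open_Collect_less continuous_intros)

lemma zeta_cont_holomorphic: "zeta_cont holomorphic_on {s. Re s > 0}"
proof -
  have hol: "zeta_term n holomorphic_on {s. Re s > 0}" for n
    unfolding zeta_term_def by (intro holomorphic_intros powr_holomorphic) auto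
  have maj: "\<exists>d h. 0 < d \<and> summable h \<and> (\<forall>n. \<forall>y\<in>ball x d \<inter> {s. Re s > 0}. norm (zeta_term n y) \<le> h n)"
    if "x \<in> {s. Re s > 0}" for x
    by (rule powr_majorant[OF open_Re_gt that, of "\<lambda>s. norm (1 - s) * norm s" "\<lambda>s. Re s + 1"])
      (use that zeta_term_bound in \<open>auto intro!: continuous_intros\<close>)
  note h = holomorphic_suminf_local[of "{s. Re s > 0}" zeta_term, OF open_Re_gt hol maj]
  show "zeta_cont holomorphic_on {s. Re s > 0}"
    unfolding zeta_cont_def by (intro holomorphic_intros h)
qed

lemma zeta_cont_1: "zeta_cont 1 = 1"
  by (simp add: zeta_cont_def zeta_term_def del: of_nat_Suc)

lemma inverse_powr_complex: "1 / (x :: complex) powr s = x powr (- s)"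
  unfolding powr_minus by (rule inverse_eq_divide[symmetric])

lemma zeta_sums:
  assumes "Re s > 1"
  shows "(\<lambda>n. of_nat (Suc n) powr (- s)) sums zeta (s :: complex)"
proof -
  have "((\<lambda>n. 1 / of_nat n powr s) has_sum zeta s) {1..}"
    using dir_abs_1[OF assms] unfolding dir_abs_def zeta_def dirichlet_series_def
    by (rule has_sum_infsum[OF Infinite_Sum.abs_summable_summable])
  from has_sum_imp_sums_Suc[OF this] show ?thesis by (simp only: inverse_powr_complex)
qed

lemma zeta_cont_eq:
  assumes s: "Re s > 1"
  shows "zeta_cont s = (s - 1) * zeta s"
proof -
  have part: "(\<Sum>n<N. zeta_term n s) = (s - 1) * (\<Sum>n<N. of_nat (Suc n) powr (- s)) + of_nat (Suc N) powr (1 - s) - 1" for N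
    by (induction N) (simp_all add: zeta_term_def algebra_simps)
  have "(\<lambda>N. real (Suc N) powr (1 - Re s)) \<longlonglongrightarrow> 0"
    using s by real_asymp
  then have "(\<lambda>N. norm ((of_nat (Suc N) :: complex) powr (1 - s))) \<longlonglongrightarrow> 0"
    unfolding norm_of_nat_powr by simp
  then have "(\<lambda>N. (of_nat (Suc N) :: complex) powr (1 - s)) \<longlonglongrightarrow> 0" by (rule tendsto_norm_zero_cancel)
  then have "(\<lambda>N. (s - 1) * (\<Sum>n<N. of_nat (Suc n) powr (- s)) + of_nat (Suc N) powr (1 - s) - 1) \<longlonglongrightarrow> (s - 1) * zeta s + 0 - 1"
    using zeta_sums[OF s] unfolding sums_def by (intro tendsto_intros)
  then have "(\<lambda>n. zeta_term n s) sums ((s - 1) * zeta s - 1)"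
    unfolding sums_def part by simp
  then show ?thesis by (simp add: zeta_cont_def sums_unique[symmetric])
qed

lemma zeta_holomorphic: "zeta holomorphic_on {s. Re s > 1}"
proof -
  have "(\<lambda>s. zeta_cont s / (s - 1)) holomorphic_on {s. Re s > 1}"
    by (intro holomorphic_intros holomorphic_on_subset[OF zeta_cont_holomorphic]) auto
  then show ?thesis
    by (rule holomorphic_transform) (auto simp: zeta_cont_eq)
qed

text \<open>Pairing the character values 1 and -1 gives terms of order j^(-Re s - 1), so that the
  series converges for Re s > 0.\<close>

definition L_term :: "nat \<Rightarrow> complex \<Rightarrow> complex" where
  "L_term j s = of_nat (3 * j + 1) powr (- s) - of_nat (3 * j + 2) powr (- s)"

definition L_cont :: "complex \<Rightarrow> complex" where
  "L_cont s = (\<Sum>j. L_term j s)"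

lemma L_cont_holomorphic: "L_cont holomorphic_on {s. Re s > 0}"
proof -
  have bnd: "norm (L_term j s) \<le> norm s * real (Suc j) powr (- (Re s + 1))" if "Re s > 0" for j s
  proof -
    have "norm (L_term j s) = norm (of_real (real (3 * j + 1) + 1) powr (- s) - of_real (real (3 * j + 1)) powr (- s))"
      by (simp add: L_term_def norm_minus_commute add.commute)
    also have "\<dots> \<le> norm s * real (3 * j + 1) powr (- Re s - 1) * 1"
      using that by (intro powr_segment_bound) auto
    also have "\<dots> \<le> norm s * real (Suc j) powr (- (Re s + 1))"
      using that by (simp add: mult_left_mono powr_mono2')
    finally show ?thesis .
  qed
  have hol: "L_term n holomorphic_on {s. Re s > 0}" for n
    unfolding L_term_def by (intro holomorphic_intros powr_holomorphic) auto
  have maj: "\<exists>d h. 0 < d \<and> summable h \<and> (\<forall>n. \<forall>y\<in>ball x d \<inter> {s. Re s > 0}. norm (L_term n y) \<le> h n)"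
    if "x \<in> {s. Re s > 0}" for x
    by (rule powr_majorant[OF open_Re_gt that, of "\<lambda>s. norm s" "\<lambda>s. Re s + 1"])
      (use that bnd in \<open>auto intro!: continuous_intros\<close>)
  show ?thesis
    unfolding L_cont_def by (rule holomorphic_suminf_local(1)[OF open_Re_gt hol maj])
qed

lemma L_cont_1: "L_cont 1 = of_real (pi / (3 * sqrt 3))"
proof -
  have "(\<lambda>j. complex_of_real (1 / (3 * real j + 1) - 1 / (3 * real j + 2))) sums of_real (pi / (3 * sqrt 3))"
    using L_chi3_at_1 by (rule sums_of_real)
  also have "(\<lambda>j. complex_of_real (1 / (3 * real j + 1) - 1 / (3 * real j + 2))) = (\<lambda>j. L_term j 1)"
    by (simp add: L_term_def powr_minus fun_eq_iff divide_inverse del: of_nat_Suc) (simp add: add.commute)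
  finally show ?thesis by (simp add: L_cont_def sums_unique[symmetric])
qed

lemma L_cont_eq:
  assumes s: "Re s > 1"
  shows "L_cont s = L_chi3 s"
proof -
  have a: "dir_abs (\<lambda>n. of_int (chi3 n)) s" by (rule dir_abs_bounded[OF s norm_chi3])
  define f where "f = (\<lambda>n. of_int (chi3 n) / (of_nat n :: complex) powr s)"
  have hs: "(f has_sum L_chi3 s) {1..}"
    using a unfolding dir_abs_def L_chi3_def dirichlet_series_def f_def
    by (rule has_sum_infsum[OF Infinite_Sum.abs_summable_summable])
  \<comment> \<open>Residues 1, 2, 3 instead of 0, 1, 2, since summation starts at 1.\<close>
  have "bij_betw (\<lambda>(j, r). 3 * j + r) (UNIV \<times> {1, 2, 3}) {1 :: nat..}"
  proof (rule bij_betwI')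
    fix n :: nat assume "n \<in> {1..}"
    then obtain m where m: "n = Suc m" by (cases n) auto
    have "m mod 3 = 0 \<or> m mod 3 = 1 \<or> m mod 3 = 2" by presburger
    then have "(m div 3, Suc (m mod 3)) \<in> UNIV \<times> {1, 2, 3}" by auto
    moreover have "n = (case (m div 3, Suc (m mod 3)) of (j, r) \<Rightarrow> 3 * j + r)" by (simp add: m)
    ultimately show "\<exists>x\<in>UNIV \<times> {1, 2, 3}. n = (case x of (j, r) \<Rightarrow> 3 * j + r)" by blast
  qed (auto, presburger+)
  then have "((\<lambda>x. f (case x of (j, r) \<Rightarrow> 3 * j + r)) has_sum L_chi3 s) (UNIV \<times> {1, 2, 3})"
    using hs by (simp add: has_sum_reindex_bij_betw)
  then have "((\<lambda>j. \<Sum>r\<in>{1, 2, 3}. f (3 * j + r)) has_sum L_chi3 s) UNIV"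
    by (rule has_sum_SigmaD) (auto intro!: has_sum_finiteI)
  also have "(\<lambda>j. \<Sum>r\<in>{1, 2, 3}. f (3 * j + r)) = (\<lambda>j. L_term j s)"
  proof
    fix j
    have "chi3 (3 * j + 1) = 1" "chi3 (3 * j + 2) = -1" "chi3 (3 * j + 3) = 0"
      unfolding chi3_def by presburger+
    then show "(\<Sum>r\<in>{1, 2, 3}. f (3 * j + r)) = L_term j s"
      by (simp add: f_def L_term_def inverse_powr_complex[symmetric] del: of_nat_add of_nat_mult of_nat_Suc)
  qed
  finally have "(\<lambda>j. L_term j s) sums L_chi3 s" by (rule has_sum_imp_sums)
  then show ?thesis by (simp add: L_cont_def sums_unique[symmetric])
qed

text \<open>With \<open>Q = Suc n\<close>, the complex form of \<open>step_defect\<close> times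
  \<open>- 2 * (1 - s)\<close>, which removes the denominator of the integral, and times the outer
  factor \<open>Q powr (- s)\<close>.\<close>

definition U_term :: "nat \<Rightarrow> complex \<Rightarrow> complex" where
  "U_term n s = of_nat (Suc n) powr (- s) *
    (2 * (1 - s) * (\<Sum>j\<in>{1..<Suc n}. of_nat (Suc n + 2 * j) powr (- s))
      - (of_nat (3 * Suc n) powr (1 - s) - of_nat (Suc n) powr (1 - s)))"

definition U_cont :: "complex \<Rightarrow> complex" where
  "U_cont s = (\<Sum>n. U_term n s)"

text \<open>There are \<open>Q\<close> steps with an error of order Q^(-Re s - 1) each, the constant
  4 being the squared step length, and the term \<open>j = 0\<close> is absent from the sum. Both
  effects have order Q^(-Re s), and the outer factor doubles the exponent.\<close>

lemma U_term_bound: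
  assumes s: "Re s > 0"
  shows "norm (U_term n s) \<le> (4 * (norm (1 - s) * norm s) + 2 * norm (1 - s)) * real (Suc n) powr (- (2 * Re s))"
proof -
  define Q where "Q = Suc n"
  have Q: "Q > 0" by (simp add: Q_def)
  define g where "g = (\<lambda>j. (of_nat (Q + 2 * j) :: complex) powr (1 - s))"
  define t where "t = (\<lambda>j. (of_nat (Q + 2 * j) :: complex) powr (- s))"
  define W where "W = 2 * (1 - s) * (\<Sum>j\<in>{1..<Q}. t j) - (of_nat (3 * Q) powr (1 - s) - of_nat Q powr (1 - s))"
  have "(\<Sum>j<Q. g (Suc j) - g j) = g Q - g 0" by (rule sum_lessThan_telescope)
  then have tel: "of_nat (3 * Q) powr (1 - s) - of_nat Q powr (1 - s) = (\<Sum>j<Q. g (Suc j) - g j)"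
    by (simp add: g_def)
  have sp: "(\<Sum>j<Q. t j) = t 0 + (\<Sum>j\<in>{1..<Q}. t j)"
    using Q by (simp add: lessThan_atLeast0 sum.atLeast_Suc_lessThan)
  have W: "W = - (\<Sum>j<Q. g (Suc j) - g j - 2 * (1 - s) * t j) - 2 * (1 - s) * t 0"
    unfolding W_def tel sum_subtractf[of _ "\<lambda>j. 2 * (1 - s) * t j"] sum_distrib_left[symmetric] sp
    by (simp add: algebra_simps)
  have e: "norm (g (Suc j) - g j - 2 * (1 - s) * t j) \<le> norm (1 - s) * norm s * real Q powr (- Re s - 1) * 4" for j
  proof -
    have "g (Suc j) - g j - 2 * (1 - s) * t j = of_real (real (Q + 2 * j) + 2) powr (1 - s) - of_real (real (Q + 2 * j)) powr (1 - s)
      - of_real 2 * (1 - s) * of_real (real (Q + 2 * j)) powr (- s)"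
      by (simp add: g_def t_def add_ac)
    also have "norm \<dots> \<le> norm (1 - s) * norm s * real (Q + 2 * j) powr (- Re s - 1) * 2\<^sup>2"
      using Q s by (intro powr_second_order_bound) auto
    also have "\<dots> \<le> norm (1 - s) * norm s * real Q powr (- Re s - 1) * 2\<^sup>2"
      using Q s by (intro mult_right_mono mult_left_mono powr_mono2') auto
    finally show ?thesis by simp
  qed
  have "norm W \<le> (\<Sum>j<Q. norm (g (Suc j) - g j - 2 * (1 - s) * t j)) + norm (2 * (1 - s) * t 0)"
    unfolding W using norm_triangle_ineq4[of "- (\<Sum>j<Q. g (Suc j) - g j - 2 * (1 - s) * t j)" "2 * (1 - s) * t 0"]
      norm_sum[of "\<lambda>j. g (Suc j) - g j - 2 * (1 - s) * t j" "{..<Q}"] by simp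
  also have "\<dots> \<le> (\<Sum>j<Q. norm (1 - s) * norm s * real Q powr (- Re s - 1) * 4) + norm (2 * (1 - s) * t 0)"
    by (intro add_right_mono sum_mono e)
  also have "norm (2 * (1 - s) * t 0) = 2 * norm (1 - s) * real Q powr (- Re s)"
    unfolding norm_mult t_def by (simp add: norm_of_nat_powr)
  also have "(\<Sum>j<Q. norm (1 - s) * norm s * real Q powr (- Re s - 1) * 4) = 4 * (norm (1 - s) * norm s) * (real Q * real Q powr (- Re s - 1))"
    by simp
  also have "real Q * real Q powr (- Re s - 1) = real Q powr (- Re s)"
    using Q powr_mult_base[of "real Q" "- Re s - 1"] by simp
  finally have "norm W \<le> (4 * (norm (1 - s) * norm s) + 2 * norm (1 - s)) * real Q powr (- Re s)"
    by (simp add: distrib_right)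
  then have "real Q powr (- Re s) * norm W \<le> real Q powr (- Re s) * ((4 * (norm (1 - s) * norm s) + 2 * norm (1 - s)) * real Q powr (- Re s))"
    by (intro mult_left_mono) auto
  also have "\<dots> = (4 * (norm (1 - s) * norm s) + 2 * norm (1 - s)) * real Q powr (- (2 * Re s))"
  proof -
    have "- (2 * Re s) = - Re s + - Re s" by simp
    then show ?thesis by (simp only: powr_add mult_ac)
  qed
  also have "real Q powr (- Re s) * norm W = norm (U_term n s)"
    unfolding U_term_def Q_def[symmetric] norm_mult norm_of_nat_powr by (simp add: W_def t_def)
  finally show ?thesis unfolding Q_def .
qed

lemma U_cont_holomorphic: "U_cont holomorphic_on {s. Re s > 1 / 2}"
proof -
  have hol: "U_term n holomorphic_on {s. Re s > 1 / 2}" for n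
    unfolding U_term_def by (intro holomorphic_intros powr_holomorphic) auto
  have maj: "\<exists>d h. 0 < d \<and> summable h \<and> (\<forall>n. \<forall>y\<in>ball x d \<inter> {s. Re s > 1 / 2}. norm (U_term n y) \<le> h n)"
    if "x \<in> {s. Re s > 1 / 2}" for x
    by (rule powr_majorant[OF open_Re_gt that, of "\<lambda>s. 4 * (norm (1 - s) * norm s) + 2 * norm (1 - s)" "\<lambda>s. 2 * Re s"])
      (use that U_term_bound in \<open>auto intro!: continuous_intros\<close>)
  show ?thesis
    unfolding U_cont_def by (rule holomorphic_suminf_local(1)[OF open_Re_gt hol maj])
qed

lemma U_cont_1: "U_cont 1 = 0"
  by (simp add: U_cont_def U_term_def del: of_nat_Suc of_nat_mult mult_Suc_right)

lemma U_cont_eq: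
  assumes s: "Re s > 1"
  shows "U_cont s = 2 * (1 - s) * T_series s - (3 powr (1 - s) - 1) * zeta (2 * s - 1)"
proof -
  have "Re (2 * s - 1) > 1" using s by simp
  note z = zeta_sums[OF this]
  note t = has_sum_imp_sums_Suc[OF T_series_Sigma(1)[OF s], unfolded inverse_powr_complex]
  have "(\<lambda>n. 2 * (1 - s) * (of_nat (Suc n) powr - s * (\<Sum>j = 1..<Suc n. of_nat (Suc n + 2 * j) powr - s))
      - (3 powr (1 - s) - 1) * of_nat (Suc n) powr - (2 * s - 1)) sums
      (2 * (1 - s) * T_series s - (3 powr (1 - s) - 1) * zeta (2 * s - 1))"
    by (intro sums_diff sums_mult t z)
  also have "(\<lambda>n. 2 * (1 - s) * (of_nat (Suc n) powr - s * (\<Sum>j = 1..<Suc n. of_nat (Suc n + 2 * j) powr - s))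
      - (3 powr (1 - s) - 1) * of_nat (Suc n) powr - (2 * s - 1)) = (\<lambda>n. U_term n s)"
  proof
    fix n
    define q where "q = (of_nat (Suc n) :: complex)"
    have "q \<noteq> 0" unfolding q_def by (simp del: of_nat_Suc)
    have e: "- (2 * s - 1) = - s + (1 - s)" by simp
    have "of_nat (3 * Suc n) powr (1 - s) = 3 powr (1 - s) * q powr (1 - s)"
      using of_nat_mult_powr[of 3 "Suc n" "1 - s"] by (simp add: q_def)
    moreover have "q powr (- (2 * s - 1)) = q powr (- s) * q powr (1 - s)"
      unfolding e powr_add ..
    moreover have "a * (x * y) - (b - 1) * (x * z) = x * (a * y - (b * z - z))" for a b x y z :: complex
      by (simp add: algebra_simps)
    ultimately show "2 * (1 - s) * (of_nat (Suc n) powr - s * (\<Sum>j = 1..<Suc n. of_nat (Suc n + 2 * j) powr - s))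
      - (3 powr (1 - s) - 1) * of_nat (Suc n) powr - (2 * s - 1) = U_term n s"
      unfolding U_term_def q_def[symmetric] by (simp only:)
  qed
  finally show ?thesis unfolding U_cont_def by (rule sums_unique[symmetric])
qed

section \<open>The continuation of the whole series and its pole at 1\<close>

definition T_cont :: "complex \<Rightarrow> complex" where
  "T_cont s = (U_cont s + (3 powr (1 - s) - 1) * (zeta_cont (2 * s - 1) / (2 * s - 2))) / (2 * (1 - s))"

text \<open>\<open>zeta (2 * s)\<close> is still the plain series, which converges for Re s > 1/2.
  Its possible zeros with Re s < 1 are the reason why the function is only claimed to be meromorphic
  there.\<close>

definition Phi_cont :: "complex \<Rightarrow> complex" where
  "Phi_cont s = L_cont s * (zeta_cont s / (s - 1)) * (1 + 3 * T_cont s / (zeta (2 * s) * (1 + 3 powr (- s))))"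

lemma Phi_cont_eq:
  assumes s: "Re s > 1"
  shows "Phi_cont s = Phi_wr s"
proof -
  have s1: "s \<noteq> 1" using s by auto
  have s2: "Re (2 * s - 1) > 1" using s by simp
  have z: "zeta_cont s / (s - 1) = zeta s" using zeta_cont_eq[OF s] s1 by simp
  have z2: "zeta_cont (2 * s - 1) / (2 * s - 2) = zeta (2 * s - 1)"
  proof -
    have "2 * s - 1 - 1 \<noteq> 0" using s1 by simp
    moreover have "2 * s - 1 - 1 = 2 * s - 2" by simp
    ultimately show ?thesis unfolding zeta_cont_eq[OF s2] by (metis nonzero_mult_div_cancel_left)
  qed
  have T: "T_cont s = T_series s"
    unfolding T_cont_def z2 U_cont_eq[OF s] using s1 by simp
  have "red_series s = 6 * (L_chi3 s * zeta s) / (zeta (2 * s) * (1 + 3 powr (- s)))"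
    unfolding red_series_Phi_pr[OF s] Phi_pr_def by simp
  then show ?thesis
    unfolding Phi_cont_def z T L_cont_eq[OF s] Phi_wr_T(2)[OF s] Phi_tri_def
    by (simp add: distrib_left mult_ac)
qed

lemma zeta_cont_shift_holomorphic: "(\<lambda>s. zeta_cont (2 * s - 1)) holomorphic_on {s. Re s > 1 / 2}"
proof -
  have "(zeta_cont \<circ> (\<lambda>s. 2 * s - 1)) holomorphic_on {s. Re s > 1 / 2}"
    by (rule holomorphic_on_compose_gen[OF _ zeta_cont_holomorphic]) (auto intro!: holomorphic_intros)
  then show ?thesis by (simp add: o_def)
qed

definition euler_factor :: "complex \<Rightarrow> complex" where
  "euler_factor s = zeta (2 * s) * (1 + 3 powr (- s))"

lemma euler_factor_holomorphic: "euler_factor holomorphic_on {s. Re s > 1 / 2}"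
proof -
  have "(zeta \<circ> (\<lambda>s. 2 * s)) holomorphic_on {s. Re s > 1 / 2}"
    by (rule holomorphic_on_compose_gen[OF _ zeta_holomorphic]) (auto intro!: holomorphic_intros)
  then show ?thesis unfolding euler_factor_def[abs_def] o_def
    by (intro holomorphic_intros) auto
qed

lemma euler_factor_nonzero: "Re s \<ge> 1 \<Longrightarrow> euler_factor s \<noteq> 0"
  unfolding euler_factor_def using zeta_nonzero[of "2 * s"] one_plus_3_powr_nonzero[of s] by simp

lemma open_euler_factor_nonzero: "open {s. Re s > 1 / 2 \<and> euler_factor s \<noteq> 0}"
proof -
  have "open ({s. Re s > 1 / 2} \<inter> euler_factor -` (- {0}))"
    using holomorphic_on_imp_continuous_on[OF euler_factor_holomorphic] open_Re_gt
    by (rule continuous_open_preimage) auto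
  moreover have "{s. Re s > 1 / 2 \<and> euler_factor s \<noteq> 0} = {s. Re s > 1 / 2} \<inter> euler_factor -` (- {0})"
    by blast
  ultimately show ?thesis by (simp only:)
qed

text \<open>The polynomial denominators vanish only at 1, and \<open>euler_factor\<close> has no
  zero with \<open>Re s \<ge> 1\<close>.\<close>

lemma Phi_cont_not_pole:
  assumes "Re s \<ge> 1" "s \<noteq> 1"
  shows "\<not> is_pole Phi_cont s"
proof -
  let ?S = "{s. Re s > 1 / 2 \<and> euler_factor s \<noteq> 0} - {1}"
  have 1: "L_cont holomorphic_on ?S" "zeta_cont holomorphic_on ?S" "U_cont holomorphic_on ?S"
    "euler_factor holomorphic_on ?S" "(\<lambda>s. zeta_cont (2 * s - 1)) holomorphic_on ?S"
    by (rule holomorphic_on_subset[OF L_cont_holomorphic] holomorphic_on_subset[OF zeta_cont_holomorphic]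
      holomorphic_on_subset[OF U_cont_holomorphic] holomorphic_on_subset[OF euler_factor_holomorphic]
      holomorphic_on_subset[OF zeta_cont_shift_holomorphic]; auto)+
  have "Phi_cont holomorphic_on ?S"
    unfolding Phi_cont_def[abs_def] T_cont_def euler_factor_def[symmetric]
    by (intro holomorphic_intros 1) auto
  moreover have "open ?S" using open_euler_factor_nonzero by (rule open_Diff) simp
  moreover have "s \<in> ?S" using assms euler_factor_nonzero by auto
  ultimately show ?thesis by (rule not_is_pole_holomorphic[rotated 2])
qed

lemma Phi_cont_meromorphic: "Phi_cont meromorphic_on {s. Re s > 1 / 2}"
proof -
  let ?S = "{s. Re s > 1 / 2}"
  have an: "f meromorphic_on ?S" if "f holomorphic_on ?S" for f
    using analytic_on_open[OF open_Re_gt, of f "1 / 2"] that analytic_on_imp_meromorphic_on by blast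
  have sub: "?S \<subseteq> {s. Re s > 0}" by auto
  have "(\<lambda>s. 3 powr (1 - s)) holomorphic_on ?S" "(\<lambda>s. 3 powr (- s)) holomorphic_on ?S"
    by (intro holomorphic_intros; simp)+
  note 1 = this[THEN an] holomorphic_on_subset[OF L_cont_holomorphic sub, THEN an]
    holomorphic_on_subset[OF zeta_cont_holomorphic sub, THEN an] U_cont_holomorphic[THEN an]
    euler_factor_holomorphic[THEN an] zeta_cont_shift_holomorphic[THEN an]
  show ?thesis
    unfolding Phi_cont_def[abs_def] T_cont_def euler_factor_def[symmetric]
    by (intro meromorphic_intros 1)
qed

definition log3_quotient :: "complex \<Rightarrow> complex" where
  "log3_quotient s = (if s = 1 then of_real (ln 3) else (1 - 3 powr (1 - s)) / (s - 1))"

text \<open>This is the difference quotient at 1 of \<open>- (3 powr (1 - s))\<close>, continued by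
  the derivative \<open>ln 3\<close>.\<close>

lemma log3_quotient_holomorphic: "log3_quotient holomorphic_on UNIV"
proof -
  define f where "f = (\<lambda>s :: complex. - (3 powr (1 - s)))"
  have d: "(f has_field_derivative of_real (ln 3)) (at 1)"
  proof -
    have "((\<lambda>s :: complex. 3 powr (1 - s)) has_field_derivative (Ln 3 * 3 powr (1 - 1)) * (0 - 1)) (at 1)"
      by (rule DERIV_chain2[OF has_field_derivative_powr_right]) (auto intro!: derivative_eq_intros)
    then have "(f has_field_derivative - ((Ln 3 * 3 powr (1 - 1)) * (0 - 1))) (at 1)"
      unfolding f_def by (rule DERIV_minus)
    moreover have "Ln 3 = complex_of_real (ln 3)" using Ln_of_real[of 3] by simp
    ultimately show ?thesis by simp
  qed
  have "f holomorphic_on UNIV" unfolding f_def by (intro holomorphic_intros) auto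
  then have "(\<lambda>z. if z = 1 then deriv f 1 else (f z - f 1) / (z - 1)) holomorphic_on UNIV"
    by (rule pole_lemma_open) simp
  also have "(\<lambda>z. if z = 1 then deriv f 1 else (f z - f 1) / (z - 1)) = log3_quotient"
    using DERIV_imp_deriv[OF d] by (auto simp: log3_quotient_def f_def fun_eq_iff)
  finally show ?thesis .
qed

text \<open>\<open>(s - 1)\<^sup>2\<close> times \<open>Phi_cont s\<close>, rearranged so that the
  removable singularity at 1 is filled in.\<close>

definition Phi_num :: "complex \<Rightarrow> complex" where
  "Phi_num s = L_cont s * zeta_cont s *
    ((s - 1) + 3 * (log3_quotient s * zeta_cont (2 * s - 1) / 4 - U_cont s / 2) / euler_factor s)"

lemma Phi_num_holomorphic: "Phi_num holomorphic_on {s. Re s > 1 / 2 \<and> euler_factor s \<noteq> 0}"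
proof -
  let ?S = "{s. Re s > 1 / 2 \<and> euler_factor s \<noteq> 0}"
  have 1: "L_cont holomorphic_on ?S" "zeta_cont holomorphic_on ?S" "U_cont holomorphic_on ?S"
    "euler_factor holomorphic_on ?S" "(\<lambda>s. zeta_cont (2 * s - 1)) holomorphic_on ?S" "log3_quotient holomorphic_on ?S"
    by (rule holomorphic_on_subset[OF L_cont_holomorphic] holomorphic_on_subset[OF zeta_cont_holomorphic]
      holomorphic_on_subset[OF U_cont_holomorphic] holomorphic_on_subset[OF euler_factor_holomorphic]
      holomorphic_on_subset[OF zeta_cont_shift_holomorphic] holomorphic_on_subset[OF log3_quotient_holomorphic]; auto)+
  show ?thesis unfolding Phi_num_def by (intro holomorphic_intros 1) auto
qed

text \<open>At 1 the summand \<open>s - 1\<close> and \<open>U_cont\<close> vanish, leaving 3/4 L(1)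
  ln 3 divided by the Euler factor; the pole has order exactly 2 because this is not zero.\<close>

lemma Phi_num_1: "Phi_num 1 \<noteq> 0"
proof -
  have "pi / (3 * sqrt 3) \<noteq> 0" "ln (3 :: real) \<noteq> 0" by auto
  then show ?thesis
    using euler_factor_nonzero[of 1] unfolding Phi_num_def by (simp add: L_cont_1 zeta_cont_1 U_cont_1 log3_quotient_def)
qed

lemma Phi_cont_eq_Phi_num:
  assumes "s \<noteq> 1"
  shows "Phi_cont s = Phi_num s / (s - 1)\<^sup>2"
proof -
  define d where "d = s - 1"
  have d: "d \<noteq> 0" using assms by (simp add: d_def)
  have "2 * s - 2 = 2 * d" "2 * (1 - s) = - 2 * d" by (simp_all add: d_def)
  then have T: "d * T_cont s = log3_quotient s * zeta_cont (2 * s - 1) / 4 - U_cont s / 2"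
    using d assms unfolding T_cont_def log3_quotient_def d_def[symmetric] by (simp add: field_simps)
  show ?thesis
    unfolding Phi_cont_def Phi_num_def euler_factor_def[symmetric] d_def[symmetric] T[symmetric]
    using d by (simp add: power2_eq_square distrib_left add_divide_distrib mult_ac)
qed

lemma Phi_cont_pole: "is_pole Phi_cont 1" "zorder Phi_cont 1 = -2"
proof -
  let ?S = "{s. Re s > 1 / 2 \<and> euler_factor s \<noteq> 0}"
  have S: "open ?S" "1 \<in> ?S" using open_euler_factor_nonzero euler_factor_nonzero[of 1] by auto
  have "is_pole (\<lambda>s. Phi_num s / (s - 1) ^ 2) 1"
    using Phi_num_holomorphic S Phi_num_1 by (rule is_pole_basic) simp
  moreover have "\<forall>\<^sub>F s in at 1. Phi_num s / (s - 1) ^ 2 = Phi_cont s"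
    unfolding eventually_at_filter by (intro always_eventually) (auto simp: Phi_cont_eq_Phi_num)
  ultimately show "is_pole Phi_cont 1" by (simp add: is_pole_cong)
  show "zorder Phi_cont 1 = -2"
  proof (rule zorder_eqI[OF S Phi_num_holomorphic Phi_num_1])
    fix w :: complex assume "w \<noteq> 1"
    have "(w - 1) powi (- 2) = inverse ((w - 1)\<^sup>2)" by (simp add: power_int_minus)
    then show "Phi_cont w = Phi_num w * (w - 1) powi (- 2)"
      unfolding Phi_cont_eq_Phi_num[OF \<open>w \<noteq> 1\<close>] by (simp only: divide_inverse)
  qed
qed

section \<open>Asymptotics of the counting function\<close>

definition summatory :: "(nat \<Rightarrow> real) \<Rightarrow> real \<Rightarrow> real" where
  "summatory f x = (\<Sum>n | 1 \<le> n \<and> real n \<le> x. f n)"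

lemma finite_real_le: "finite {n. real n \<le> x}"
  by (rule finite_subset[of _ "{..nat \<lfloor>x\<rfloor>}"]) (auto simp: le_nat_floor)

lemma finite_summatory [simp]: "finite {n. 1 \<le> n \<and> real n \<le> x}"
  by (rule finite_subset[OF _ finite_real_le[of x]]) auto

lemma summatory_less_1: "x < 1 \<Longrightarrow> summatory f x = 0"
proof -
  assume "x < 1"
  then have "{n. 1 \<le> n \<and> real n \<le> x} = {}" by auto
  then show ?thesis by (simp only: summatory_def sum.empty)
qed

lemma summatory_nonneg: "(\<And>n. f n \<ge> 0) \<Longrightarrow> summatory f x \<ge> 0"
  unfolding summatory_def by (rule sum_nonneg)

lemma summatory_const: "summatory (\<lambda>_. 1) x = real (nat \<lfloor>x\<rfloor>)"
proof -
  have "{n. 1 \<le> n \<and> real n \<le> x} = {1..nat \<lfloor>x\<rfloor>}"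
  proof -
    have "real n \<le> x \<longleftrightarrow> n \<le> nat \<lfloor>x\<rfloor>" if "n \<ge> 1" for n
    proof -
      have "real n \<le> x \<longleftrightarrow> int n \<le> \<lfloor>x\<rfloor>" by (simp add: le_floor_iff)
      then show ?thesis using that by linarith
    qed
    then show ?thesis by auto
  qed
  then show ?thesis by (simp add: summatory_def)
qed

text \<open>The summed form of a convolution: all pairs with \<open>w k * m \<le> x\<close>,
  arranged by \<open>k\<close>.\<close>

lemma summatory_conv:
  fixes u :: "'a \<Rightarrow> real" and f c :: "nat \<Rightarrow> real"
  assumes w: "\<And>k. k \<in> X \<Longrightarrow> w k \<ge> 1" and fin: "\<And>n. finite {k \<in> X. w k \<le> n}"
    and c: "\<And>n. n \<ge> 1 \<Longrightarrow> c n = (\<Sum>(k, m)\<in>conv_pairs X w n. u k * f m)"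
  shows "summatory c x = (\<Sum>k | k \<in> X \<and> real (w k) \<le> x. u k * summatory f (x / real (w k)))"
proof -
  let ?N = "{n. 1 \<le> n \<and> real n \<le> x}" and ?K = "{k. k \<in> X \<and> real (w k) \<le> x}"
  let ?M = "\<lambda>k. {m. 1 \<le> m \<and> real m \<le> x / real (w k)}"
  have fK: "finite ?K"
    by (rule finite_subset[OF _ fin[of "nat \<lfloor>x\<rfloor>"]]) (auto simp: le_nat_floor)
  have fc: "finite (conv_pairs X w n)" if "n \<ge> 1" for n
    using that fin by (intro finite_conv_pairs) auto
  have "summatory c x = (\<Sum>n\<in>?N. \<Sum>(k, m)\<in>conv_pairs X w n. u k * f m)"
    unfolding summatory_def using c by (intro sum.cong) auto
  also have "\<dots> = (\<Sum>p\<in>(SIGMA n:?N. conv_pairs X w n). u (fst (snd p)) * f (snd (snd p)))"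
    by (subst sum.Sigma[OF finite_summatory]) (use fc in \<open>auto simp: case_prod_beta\<close>)
  also have "\<dots> = (\<Sum>p\<in>(SIGMA k:?K. ?M k). u (fst p) * f (snd p))"
  proof (rule sum.reindex_bij_witness[of _ "\<lambda>(k, m). (w k * m, (k, m))" snd])
    fix p assume p: "p \<in> (SIGMA n:?N. conv_pairs X w n)"
    then obtain n k m where nkm: "p = (n, (k, m))" "k \<in> X" "m \<ge> 1" "w k * m = n" "real n \<le> x"
      by (auto simp: conv_pairs_def)
    show "(case snd p of (k, m) \<Rightarrow> (w k * m, (k, m))) = p" using nkm by simp
    have wk: "w k \<ge> 1" using w nkm by simp
    have "real (w k) * real m \<le> x" using nkm by (simp flip: of_nat_mult)
    moreover have "real (w k) * 1 \<le> real (w k) * real m" using nkm by (intro mult_left_mono) auto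
    ultimately have "real (w k) \<le> x" by linarith
    moreover have "real m \<le> x / real (w k)" using \<open>real (w k) * real m \<le> x\<close> wk by (simp add: field_simps)
    ultimately show "snd p \<in> (SIGMA k:?K. ?M k)" using nkm by simp
  next
    fix p assume p: "p \<in> (SIGMA k:?K. ?M k)"
    then obtain k m where km: "p = (k, m)" "k \<in> X" "m \<ge> 1" "real m \<le> x / real (w k)" by auto
    have wk: "w k \<ge> 1" using w km by simp
    have "real (w k * m) \<le> x" using km wk by (simp add: field_simps)
    moreover have "w k * m \<ge> 1" using wk km by (simp add: Suc_le_eq)
    ultimately show "(case p of (k, m) \<Rightarrow> (w k * m, (k, m))) \<in> (SIGMA n:?N. conv_pairs X w n)"
      using km by (simp add: conv_pairs_def)
  qed (auto simp: case_prod_beta)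
  also have "\<dots> = (\<Sum>k\<in>?K. \<Sum>m\<in>?M k. u k * f m)"
    by (subst sum.Sigma[OF fK]) (simp_all add: case_prod_beta finite_summatory[simplified])
  also have "\<dots> = (\<Sum>k\<in>?K. u k * summatory f (x / real (w k)))"
    by (simp add: summatory_def sum_distrib_left)
  finally show ?thesis by simp
qed

section \<open>Counting the ideals up to norm x\<close>

definition hex_count :: "nat \<Rightarrow> real" where
  "hex_count n = real (card (eis_reps n)) / 6"

text \<open>Normalised by the six units like \<open>hex_count\<close>; the factor 1/2 for the sign
  of \<open>z\<close> then becomes the coefficient 3 in \<open>A_tri_eq\<close>.\<close>

definition red_count :: "nat \<Rightarrow> real" where
  "red_count n = real (card (eis_red n)) / 6"

definition floor_diff :: "real \<Rightarrow> nat \<Rightarrow> real" where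
  "floor_diff x j = real (nat \<lfloor>x / real (3 * j + 1)\<rfloor>) - real (nat \<lfloor>x / real (3 * j + 2)\<rfloor>)"

text \<open>Interchanging the sums gives character values times floors of \<open>x / d\<close>;
  these are grouped in blocks of three, and the floors beyond \<open>x\<close> vanish.\<close>

lemma summatory_hex_count:
  assumes "real J \<ge> x"
  shows "summatory hex_count x = (\<Sum>j<J. floor_diff x j)"
proof -
  have c: "hex_count n = (\<Sum>(k, m)\<in>conv_pairs {1..} id n. of_int (chi3 k) * 1)" if "n \<ge> 1" for n
  proof -
    have "bij_betw fst (conv_pairs {1..} id n) {d. d dvd n}"
    proof (rule bij_betwI')
      fix d assume "d \<in> {d. d dvd n}"
      then obtain m where "n = d * m" by blast
      then show "\<exists>x\<in>conv_pairs {1..} id n. d = fst x"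
        using that by (intro bexI[of _ "(d, m)"]) (auto simp: conv_pairs_def Suc_le_eq)
    qed (auto simp: conv_pairs_def)
    then have "(\<Sum>x\<in>conv_pairs {1..} id n. of_int (chi3 (fst x))) = (\<Sum>d | d dvd n. of_int (chi3 d) :: real)"
      by (rule sum.reindex_bij_betw)
    also have "\<dots> = of_int (divisor_chi n)" by (simp add: divisor_chi_def)
    also have "\<dots> = hex_count n"
    proof -
      have "of_int (int (card (eis_reps n))) = (of_int (6 * divisor_chi n) :: real)"
        using card_eis_reps[of n] that by simp
      then show ?thesis by (simp add: hex_count_def)
    qed
    finally show ?thesis by (simp add: case_prod_beta)
  qed
  have "summatory hex_count x = (\<Sum>d | d \<in> {1..} \<and> real (id d) \<le> x. of_int (chi3 d) * summatory (\<lambda>_. 1) (x / real (id d)))"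
    by (rule summatory_conv[OF _ _ c]) (auto intro: finite_subset[of _ "{.._}"])
  also have "\<dots> = (\<Sum>d\<in>{1..<3 * J + 1}. of_int (chi3 d) * real (nat \<lfloor>x / real d\<rfloor>))"
    unfolding summatory_const
  proof (rule sum.mono_neutral_cong_left)
    show "\<forall>d\<in>{1..<3 * J + 1} - {d. d \<in> {1..} \<and> real (id d) \<le> x}. of_int (chi3 d) * real (nat \<lfloor>x / real d\<rfloor>) = 0"
    proof
      fix d assume "d \<in> {1..<3 * J + 1} - {d. d \<in> {1..} \<and> real (id d) \<le> x}"
      then have "d \<ge> 1" "x < real d" by auto
      then have "x / real d < 1" by simp
      then have "\<lfloor>x / real d\<rfloor> \<le> 0" by linarith
      then show "of_int (chi3 d) * real (nat \<lfloor>x / real d\<rfloor>) = 0" by simp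
    qed
  qed (use assms in auto)
  also have "\<dots> = (\<Sum>j<J. floor_diff x j)"
  proof (induction J)
    case (Suc J)
    have "chi3 (3 * J + 1) = 1" "chi3 (3 * J + 2) = -1" "chi3 (3 * J + 3) = 0"
      unfolding chi3_def by presburger+
    moreover have "{1..<3 * Suc J + 1} = {1..<3 * J + 1} \<union> {3 * J + 1, 3 * J + 2, 3 * J + 3}" by auto
    ultimately show ?case using Suc.IH by (simp add: floor_diff_def add_ac)
  qed simp
  finally show ?thesis .
qed

lemma floor_diff_bounds:
  assumes "x \<ge> 0"
  shows "floor_diff x j \<ge> 0" "\<bar>floor_diff x j - x * (1 / (3 * real j + 1) - 1 / (3 * real j + 2))\<bar> \<le> 1"
    "floor_diff x j \<le> real (nat \<lfloor>x / real (3 * j + 1)\<rfloor>) - real (nat \<lfloor>x / real (3 * Suc j + 1)\<rfloor>)"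
proof -
  have mono: "nat \<lfloor>x / real b\<rfloor> \<le> nat \<lfloor>x / real a\<rfloor>" if "0 < a" "a \<le> b" for a b
    using that assms by (intro nat_mono floor_mono divide_left_mono) auto
  show "floor_diff x j \<ge> 0" using mono[of "3 * j + 1" "3 * j + 2"] by (simp add: floor_diff_def)
  show "floor_diff x j \<le> real (nat \<lfloor>x / real (3 * j + 1)\<rfloor>) - real (nat \<lfloor>x / real (3 * Suc j + 1)\<rfloor>)"
    using mono[of "3 * j + 2" "3 * Suc j + 1"] by (simp add: floor_diff_def)
  have fl: "real (nat \<lfloor>y\<rfloor>) \<le> y" "y < real (nat \<lfloor>y\<rfloor>) + 1" if "y \<ge> 0" for y :: real
    using that by linarith+
  have "x / real (3 * j + 1) \<ge> 0" "x / real (3 * j + 2) \<ge> 0" using assms by auto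
  note fl[OF this(1)] fl[OF this(2)]
  moreover have "x * (1 / (3 * real j + 1) - 1 / (3 * real j + 2)) = x / real (3 * j + 1) - x / real (3 * j + 2)"
    by (simp add: right_diff_distrib add.commute)
  ultimately show "\<bar>floor_diff x j - x * (1 / (3 * real j + 1) - 1 / (3 * real j + 2))\<bar> \<le> 1"
    unfolding floor_diff_def by linarith
qed

text \<open>The tail of the alternating sum of floors telescopes, whence the uniform bound \<open>x / (3 K + 1)\<close>.\<close>

lemma summatory_hex_count_bounds:
  assumes x: "x \<ge> 0"
  shows "(\<Sum>j<K. floor_diff x j) \<le> summatory hex_count x"
    "summatory hex_count x \<le> (\<Sum>j<K. floor_diff x j) + x / real (3 * K + 1)"
proof -
  define J where "J = K + nat \<lceil>x\<rceil>"
  have "real J \<ge> x" "K \<le> J" unfolding J_def by linarith+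
  then have H: "summatory hex_count x = (\<Sum>j<K. floor_diff x j) + (\<Sum>j\<in>{K..<J}. floor_diff x j)"
    using sum.atLeastLessThan_concat[of 0 K J "floor_diff x"]
    by (simp add: summatory_hex_count lessThan_atLeast0)
  show "(\<Sum>j<K. floor_diff x j) \<le> summatory hex_count x"
    unfolding H using floor_diff_bounds(1)[OF x] by (simp add: sum_nonneg)
  define g where "g = (\<lambda>j. - real (nat \<lfloor>x / real (3 * j + 1)\<rfloor>))"
  have "(\<Sum>j\<in>{K..<J}. floor_diff x j) \<le> (\<Sum>j\<in>{K..<J}. g (Suc j) - g j)"
    using floor_diff_bounds(3)[OF x] by (intro sum_mono) (simp add: g_def)
  also have "\<dots> = g J - g K" by (rule sum_Suc_diff') (simp add: J_def)
  also have "\<dots> \<le> real (nat \<lfloor>x / real (3 * K + 1)\<rfloor>)" by (simp add: g_def)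
  also have "\<dots> \<le> x / real (3 * K + 1)" using x by (intro of_nat_floor) auto
  finally show "summatory hex_count x \<le> (\<Sum>j<K. floor_diff x j) + x / real (3 * K + 1)"
    unfolding H by simp
qed

lemma summatory_hex_count_le: "x \<ge> 0 \<Longrightarrow> summatory hex_count x \<le> x"
  using summatory_hex_count_bounds(2)[of x 0] by simp

text \<open>Cutting at a fixed \<open>K\<close>, the head differs from \<open>x\<close> times a
  partial sum of L(1) by at most \<open>K\<close>, which is o(x), while the tail is at most
  \<open>x / real (3 * K + 1)\<close> uniformly in \<open>x\<close>.\<close>

lemma summatory_hex_count_asymp:
  "((\<lambda>x. summatory hex_count x / x) \<longlongrightarrow> pi / (3 * sqrt 3)) at_top"
proof (rule tendstoI)
  fix \<epsilon> :: real assume \<epsilon>: "\<epsilon> > 0"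
  define L where "L = pi / (3 * sqrt 3)"
  define c where "c = (\<lambda>j. 1 / (3 * real j + 1) - 1 / (3 * real j + 2))"
  have "(\<lambda>K. \<Sum>j<K. c j) \<longlonglongrightarrow> L" using L_chi3_at_1 unfolding sums_def c_def L_def .
  then have "\<forall>\<^sub>F K in sequentially. \<bar>(\<Sum>j<K. c j) - L\<bar> < \<epsilon> / 3"
    using \<epsilon> by (auto simp: tendsto_iff dist_real_def dest: spec[of _ "\<epsilon> / 3"])
  moreover have "(\<lambda>K. 1 / real (3 * K + 1)) \<longlonglongrightarrow> 0" by real_asymp
  then have "\<forall>\<^sub>F K in sequentially. 1 / real (3 * K + 1) < \<epsilon> / 3"
    using \<epsilon> by (intro order_tendstoD) auto
  ultimately have "\<forall>\<^sub>F K in sequentially. \<bar>(\<Sum>j<K. c j) - L\<bar> < \<epsilon> / 3 \<and> 1 / real (3 * K + 1) < \<epsilon> / 3"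
    by (rule eventually_conj)
  then obtain K where K: "\<bar>(\<Sum>j<K. c j) - L\<bar> < \<epsilon> / 3" "1 / real (3 * K + 1) < \<epsilon> / 3"
    using eventually_happens'[OF sequentially_bot] by blast
  have "((\<lambda>x. real K / x) \<longlongrightarrow> 0) at_top" by real_asymp
  then have "\<forall>\<^sub>F x in at_top. real K / x < \<epsilon> / 3" using \<epsilon> by (intro order_tendstoD) auto
  moreover have "\<forall>\<^sub>F x in at_top. x > (0 :: real)" by (rule eventually_gt_at_top)
  ultimately show "\<forall>\<^sub>F x in at_top. dist (summatory hex_count x / x) (pi / (3 * sqrt 3)) < \<epsilon>"
  proof eventually_elim
    case (elim x)
    have "\<bar>(\<Sum>j<K. floor_diff x j) - x * (\<Sum>j<K. c j)\<bar> \<le> (\<Sum>j<K. \<bar>floor_diff x j - x * c j\<bar>)"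
      unfolding sum_distrib_left sum_subtractf[symmetric] by (rule sum_abs)
    also have "\<dots> \<le> (\<Sum>j<K. 1)" unfolding c_def using elim by (intro sum_mono floor_diff_bounds(2)) auto
    finally have "\<bar>(\<Sum>j<K. floor_diff x j) - x * (\<Sum>j<K. c j)\<bar> \<le> real K" by simp
    moreover have "x / real (3 * K + 1) = x * (1 / real (3 * K + 1))" by simp
    ultimately have "\<bar>summatory hex_count x - x * (\<Sum>j<K. c j)\<bar> \<le> real K + x * (1 / real (3 * K + 1))"
      using summatory_hex_count_bounds[of x K] elim by linarith
    also have "\<dots> < x * (\<epsilon> / 3) + x * (\<epsilon> / 3)"
      using elim K(2) by (intro add_strict_mono mult_strict_left_mono) (auto simp: field_simps)
    finally have "\<bar>summatory hex_count x - x * (\<Sum>j<K. c j)\<bar> / x < 2 * \<epsilon> / 3"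
      using elim by (simp add: field_simps)
    moreover have "summatory hex_count x / x - (\<Sum>j<K. c j) = (summatory hex_count x - x * (\<Sum>j<K. c j)) / x"
      using elim by (simp add: diff_divide_distrib)
    then have "\<bar>summatory hex_count x / x - (\<Sum>j<K. c j)\<bar> = \<bar>summatory hex_count x - x * (\<Sum>j<K. c j)\<bar> / x"
      using elim by (simp only: abs_divide abs_of_pos)
    ultimately have "\<bar>summatory hex_count x / x - (\<Sum>j<K. c j)\<bar> < 2 * \<epsilon> / 3" by (simp only:)
    then show ?case using K(1) unfolding dist_real_def L_def[symmetric] by linarith
  qed
qed

text \<open>Inverting \<open>f(x) + \<Sum> c\<^sub>k f(x / q\<^sub>k)\<close> asymptotically: since \<open>\<Sum> c\<^sub>k / q\<^sub>k < 1\<close>, the limit superior of the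
  relative error is at most a proper fraction of itself.\<close>

lemma contraction_asymp:
  fixes f :: "real \<Rightarrow> real" and c q :: "nat \<Rightarrow> real"
  assumes bnd: "\<And>x. x > 0 \<Longrightarrow> \<bar>f x\<bar> \<le> C * x"
    and c: "\<And>k. c k \<ge> 0" and q: "\<And>k. q k > 0"
    and sums: "(\<lambda>k. c k / q k) sums \<kappa>" and \<kappa>: "\<kappa> < 1"
    and lim: "((\<lambda>x. (f x + (\<Sum>k. c k * f (x / q k))) / x) \<longlongrightarrow> \<tau> * (1 + \<kappa>)) at_top"
  shows "((\<lambda>x. f x / x) \<longlongrightarrow> \<tau>) at_top"
proof -
  define e where "e = (\<lambda>x. f x / x - \<tau>)"
  define \<eta> where "\<eta> = (\<lambda>x. (f x + (\<Sum>k. c k * f (x / q k))) / x - \<tau> * (1 + \<kappa>))"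
  define M where "M = C + \<bar>\<tau>\<bar>"
  have \<kappa>0: "\<kappa> \<ge> 0" using c q sums_le[OF _ sums_zero sums] by (simp add: less_imp_le)
  have eM: "\<bar>e x\<bar> \<le> M" if "x > 0" for x
  proof -
    have "\<bar>f x / x\<bar> \<le> C" using bnd[OF that] that by (simp add: abs_divide pos_divide_le_eq)
    then show ?thesis unfolding e_def M_def by linarith
  qed
  have M0: "M \<ge> 0" using eM[of 1] by simp
  have smk: "summable (\<lambda>k. c k / q k)" using sums by (rule sums_summable)
  have sme: "summable (\<lambda>k. c k / q k * e (x / q k))" "summable (\<lambda>k. \<bar>c k / q k * e (x / q k)\<bar>)" if "x > 0" for x
  proof -
    have "norm \<bar>c k / q k * e (x / q k)\<bar> \<le> c k / q k * M" for k
    proof -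
      have "0 \<le> c k / q k" "x / q k > 0" using c[of k] q[of k] that by auto
      then show ?thesis
        unfolding real_norm_def abs_abs abs_mult abs_of_nonneg[OF \<open>0 \<le> c k / q k\<close>] by (intro mult_left_mono eM)
    qed
    then show "summable (\<lambda>k. \<bar>c k / q k * e (x / q k)\<bar>)"
      by (intro summable_comparison_test'[OF summable_mult2[OF smk, of M]])
    then show "summable (\<lambda>k. c k / q k * e (x / q k))" by (rule summable_rabs_cancel)
  qed
  \<comment> \<open>Since the weights \<open>c k / q k\<close> add up to \<open>\<kappa>\<close>,
    the main term \<open>\<tau>\<close> cancels and the relative error satisfies the same equation
    with right-hand side tending to 0.\<close>
  have rec: "e x = \<eta> x - (\<Sum>k. c k / q k * e (x / q k))" if x: "x > 0" for x
  proof -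
    have t: "c k * f (x / q k) / x = c k / q k * e (x / q k) + \<tau> * (c k / q k)" for k
      using x q[of k] by (simp add: e_def field_simps)
    have "(\<lambda>k. c k / q k * e (x / q k) + \<tau> * (c k / q k)) sums ((\<Sum>k. c k / q k * e (x / q k)) + \<tau> * \<kappa>)"
      by (intro sums_add sums_mult sums summable_sums sme x)
    then have s: "(\<lambda>k. c k * f (x / q k) / x) sums ((\<Sum>k. c k / q k * e (x / q k)) + \<tau> * \<kappa>)" unfolding t .
    have "(\<lambda>k. c k * f (x / q k)) sums (((\<Sum>k. c k / q k * e (x / q k)) + \<tau> * \<kappa>) * x)"
      using sums_mult2[OF s, of x] x by simp
    then have "(\<Sum>k. c k * f (x / q k)) / x = (\<Sum>k. c k / q k * e (x / q k)) + \<tau> * \<kappa>"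
      using x by (simp add: sums_unique[symmetric])
    then show ?thesis by (simp add: e_def \<eta>_def add_divide_distrib algebra_simps)
  qed
  have \<eta>0: "(\<eta> \<longlongrightarrow> 0) at_top"
    using tendsto_diff[OF lim tendsto_const[of "\<tau> * (1 + \<kappa>)"]] unfolding \<eta>_def by simp
  have step: "\<forall>\<^sub>F x in at_top. \<bar>e x\<bar> \<le> \<kappa> * b + \<epsilon>"
    if b: "b \<ge> 0" "\<forall>\<^sub>F x in at_top. \<bar>e x\<bar> \<le> b" and \<epsilon>: "\<epsilon> > 0" for b \<epsilon>
  proof -
    have "(\<lambda>K. (\<Sum>k<K. c k / q k)) \<longlonglongrightarrow> \<kappa>" using sums by (simp add: sums_def)
    then have "(\<lambda>K. (\<kappa> - (\<Sum>k<K. c k / q k)) * M) \<longlonglongrightarrow> (\<kappa> - \<kappa>) * M" by (intro tendsto_intros)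
    then have "\<forall>\<^sub>F K in sequentially. (\<kappa> - (\<Sum>k<K. c k / q k)) * M < \<epsilon> / 2"
      using \<epsilon> by (intro order_tendstoD(2)) auto
    then obtain K where K: "(\<kappa> - (\<Sum>k<K. c k / q k)) * M < \<epsilon> / 2"
      using eventually_happens'[OF sequentially_bot] by blast
    obtain X where X: "\<And>x. x \<ge> X \<Longrightarrow> \<bar>e x\<bar> \<le> b"
      using b(2) unfolding eventually_at_top_linorder by blast
    have "\<forall>\<^sub>F x in at_top. \<forall>k<K. x / q k \<ge> X"
    proof -
      have "\<forall>\<^sub>F x in at_top. x / q k \<ge> X" for k
        using eventually_ge_at_top[of "X * q k"] by eventually_elim (use q[of k] in \<open>simp add: pos_le_divide_eq\<close>)
      then have "\<forall>\<^sub>F x in at_top. \<forall>k\<in>{..<K}. x / q k \<ge> X" by (simp add: eventually_ball_finite)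
      then show ?thesis unfolding Ball_def lessThan_iff .
    qed
    moreover have "\<forall>\<^sub>F x in at_top. \<bar>\<eta> x\<bar> < \<epsilon> / 2"
      using tendstoD[OF \<eta>0, of "\<epsilon> / 2"] \<epsilon> by (simp add: dist_real_def)
    moreover have "\<forall>\<^sub>F x in at_top. x > (0 :: real)" by (rule eventually_gt_at_top)
    ultimately show ?thesis
    proof eventually_elim
      case (elim x)
      \<comment> \<open>For \<open>k < K\<close> the argument \<open>x / q k\<close> has already
        passed \<open>X\<close>, so \<open>b\<close> applies; the rest has small total weight and
        gets the global bound \<open>M\<close>.\<close>
      define g where "g = (\<lambda>k. c k / q k * (if k < K then b else M))"
      have gs: "g sums ((\<Sum>k<K. c k / q k) * b + (\<kappa> - (\<Sum>k<K. c k / q k)) * M)"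
      proof -
        have "(\<lambda>k. c k / q k * M + (if k \<in> {..<K} then c k / q k * (b - M) else 0)) sums (\<kappa> * M + (\<Sum>k<K. c k / q k * (b - M)))"
          by (intro sums_add sums_mult2 sums sums_If_finite_set) simp
        also have "(\<lambda>k. c k / q k * M + (if k \<in> {..<K} then c k / q k * (b - M) else 0)) = g"
          by (auto simp: g_def fun_eq_iff right_diff_distrib)
        also have "\<kappa> * M + (\<Sum>k<K. c k / q k * (b - M)) = (\<Sum>k<K. c k / q k) * b + (\<kappa> - (\<Sum>k<K. c k / q k)) * M"
          unfolding sum_distrib_right[symmetric] by (simp add: algebra_simps)
        finally show ?thesis .
      qed
      have "\<bar>\<Sum>k. c k / q k * e (x / q k)\<bar> \<le> (\<Sum>k. \<bar>c k / q k * e (x / q k)\<bar>)"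
        using sme(2) elim by (intro summable_rabs) auto
      also have "\<dots> \<le> suminf g"
      proof (rule suminf_le)
        fix k
        have "\<bar>e (x / q k)\<bar> \<le> (if k < K then b else M)" using elim X eM[of "x / q k"] q[of k] by auto
        then show "\<bar>c k / q k * e (x / q k)\<bar> \<le> g k"
        proof -
          have nn: "0 \<le> c k / q k" using c[of k] q[of k] by auto
          show ?thesis
            unfolding g_def abs_mult abs_of_nonneg[OF nn] by (intro mult_left_mono nn) fact
        qed
      qed (use sme(2) elim gs sums_summable in auto)
      also have "\<dots> = (\<Sum>k<K. c k / q k) * b + (\<kappa> - (\<Sum>k<K. c k / q k)) * M"
        using gs by (simp add: sums_unique[symmetric])
      also have "\<dots> \<le> \<kappa> * b + \<epsilon> / 2"
      proof (intro add_mono mult_right_mono)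
        show "(\<Sum>k<K. c k / q k) \<le> \<kappa>"
          using c q sums by (metis (no_types, lifting) divide_nonneg_pos sum_le_suminf sums_iff finite_lessThan)
      qed (use K b in auto)
      finally show ?case using rec[of x] elim by linarith
    qed
  qed
  \<comment> \<open>\<open>Inf B\<close> serves as the limit superior of the absolute error;
    \<open>step\<close> shows that it is at most \<open>\<kappa>\<close> times itself.\<close>
  define B where "B = {b. b \<ge> 0 \<and> (\<forall>\<^sub>F x in at_top. \<bar>e x\<bar> \<le> b)}"
  have MB: "M \<in> B" unfolding B_def using eM M0 by (auto intro: eventually_mono[OF eventually_gt_at_top[of 0]])
  have bdd: "bdd_below B" unfolding B_def by (auto intro: bdd_belowI[of _ 0])
  define \<beta> where "\<beta> = Inf B"
  have \<beta>0: "\<beta> \<ge> 0" unfolding \<beta>_def using MB by (intro cInf_greatest) (auto simp: B_def)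
  have "\<beta> \<le> \<kappa> * \<beta> + \<epsilon>" if \<epsilon>: "\<epsilon> > 0" for \<epsilon>
  proof -
    have "\<exists>b\<in>B. b < \<beta> + \<epsilon> / 2"
      using cInf_lessD[of B "\<beta> + \<epsilon> / 2"] MB \<epsilon> unfolding \<beta>_def by force
    then obtain b where b: "b \<in> B" "b < \<beta> + \<epsilon> / 2" by blast
    have "\<kappa> * b + \<epsilon> / 2 \<in> B" using step[of b "\<epsilon> / 2"] b \<epsilon> \<kappa>0 by (auto simp: B_def)
    then have "\<beta> \<le> \<kappa> * b + \<epsilon> / 2" unfolding \<beta>_def using bdd by (rule cInf_lower)
    also have "\<dots> \<le> \<kappa> * (\<beta> + \<epsilon> / 2) + \<epsilon> / 2" using b \<kappa>0 by (intro add_right_mono mult_left_mono) auto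
    also have "\<dots> \<le> \<kappa> * \<beta> + \<epsilon>"
    proof -
      have "\<kappa> * (\<epsilon> / 2) \<le> 1 * (\<epsilon> / 2)" using \<kappa> \<epsilon> by (intro mult_right_mono) auto
      then show ?thesis unfolding distrib_left by linarith
    qed
    finally show ?thesis .
  qed
  then have "\<beta> \<le> \<kappa> * \<beta>" by (rule field_le_epsilon)
  then have "(1 - \<kappa>) * \<beta> \<le> 0" by (simp add: algebra_simps)
  then have "\<beta> = 0" using \<kappa> \<beta>0 by (simp add: mult_le_0_iff)
  have "(e \<longlongrightarrow> 0) at_top"
  proof (rule tendstoI)
    fix \<epsilon> :: real assume "\<epsilon> > 0"
    then have "\<exists>b\<in>B. b < \<epsilon>" using cInf_lessD[of B \<epsilon>] MB \<open>\<beta> = 0\<close> unfolding \<beta>_def by force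
    then obtain b where b: "\<forall>\<^sub>F x in at_top. \<bar>e x\<bar> \<le> b" "b < \<epsilon>" unfolding B_def by blast
    show "\<forall>\<^sub>F x in at_top. dist (e x) 0 < \<epsilon>"
      using b(1) by eventually_elim (use b(2) in \<open>simp add: dist_real_def\<close>)
  qed
  then have "((\<lambda>x. e x + \<tau>) \<longlongrightarrow> 0 + \<tau>) at_top" by (intro tendsto_intros)
  then show ?thesis by (simp add: e_def)
qed

section \<open>The density of reduced elements\<close>

lemma summatory_red_count_bounds: "0 \<le> summatory red_count x" "summatory red_count x \<le> summatory hex_count x"
proof -
  show "0 \<le> summatory red_count x" by (rule summatory_nonneg) (simp add: red_count_def)
  have "card (eis_red n) \<le> card (eis_reps n)" for n
    by (rule card_mono[OF finite_eis_reps]) (auto simp: eis_red_def)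
  then show "summatory red_count x \<le> summatory hex_count x"
    unfolding summatory_def red_count_def hex_count_def by (intro sum_mono divide_right_mono) auto
qed

text \<open>\<open>prim_sum\<close> counts the primitive Eisenstein integers, whose norm is divisible by 3 at most once.\<close>

definition prim_sum :: "real \<Rightarrow> real" where
  "prim_sum x = summatory red_count x + summatory red_count (x / 3)"

text \<open>\<open>card_eis_reps_red\<close> summed up to \<open>x\<close>, with the two values of
  \<open>e\<close> collected in \<open>prim_sum\<close>. The series is in fact finite, because the
  terms vanish once the argument is below 1.\<close>

lemma summatory_hex_prim:
  "(\<lambda>d. prim_sum (x / real (Suc d) ^ 2)) sums summatory hex_count x"
proof -
  let ?X = "{1..} \<times> {0, 1 :: nat}" and ?w = "\<lambda>(d :: nat, e :: nat). d\<^sup>2 * 3 ^ e"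
  have le: "d \<le> d\<^sup>2 * 3 ^ e" for d e :: nat
  proof -
    have "d * 1 \<le> d * (d * 3 ^ e)" by (cases "d = 0") auto
    then show ?thesis by (simp add: power2_eq_square mult.assoc)
  qed
  have c: "hex_count n = (\<Sum>(k, m)\<in>conv_pairs ?X ?w n. 1 * red_count m)" if "n \<ge> 1" for n
    using card_eis_reps_red[of n] that by (simp add: hex_count_def red_count_def case_prod_beta sum_divide_distrib)
  have fin: "finite {k \<in> ?X. ?w k \<le> n}" for n
    using le by (intro finite_mult_le) auto
  define N where "N = Suc (nat \<lfloor>x\<rfloor>)"
  have N: "x / real (Suc d) ^ 2 < 1" "x / real (Suc d) ^ 2 / 3 < 1" if "d \<ge> N" for d
  proof -
    have "x < real N" unfolding N_def by linarith
    also have "real N \<le> real (Suc d) * real (Suc d)"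
      using that mult_mono[of 1 "real (Suc d)" "real N" "real (Suc d)"] by simp
    finally have 1: "x / real (Suc d) ^ 2 < 1" by (simp add: power2_eq_square divide_less_eq)
    have "t / 3 < 1" if "t < 1" for t :: real using that by simp
    from 1 this[OF 1] show "x / real (Suc d) ^ 2 < 1" "x / real (Suc d) ^ 2 / 3 < 1" .
  qed
  have "summatory hex_count x = (\<Sum>k | k \<in> ?X \<and> real (?w k) \<le> x. 1 * summatory red_count (x / real (?w k)))"
    by (rule summatory_conv[OF _ fin c]) (auto simp: Suc_le_eq)
  also have "\<dots> = (\<Sum>k\<in>Suc ` {..<N} \<times> {0, 1}. summatory red_count (x / real (?w k)))"
  proof (rule sum.mono_neutral_cong_left)
    show "{k. k \<in> ?X \<and> real (?w k) \<le> x} \<subseteq> Suc ` {..<N} \<times> {0, 1}"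
    proof
      fix k assume k: "k \<in> {k. k \<in> ?X \<and> real (?w k) \<le> x}"
      obtain d e where de: "k = (d, e)" by fastforce
      have *: "d \<ge> 1" "e \<in> {0, 1}" "real (d\<^sup>2 * 3 ^ e) \<le> x" using k by (auto simp: de)
      then have "real d \<le> x" using le[of d e] by (meson of_nat_le_iff order_trans)
      then have "d \<le> N" unfolding N_def by linarith
      then have "d - 1 \<in> {..<N}" "d = Suc (d - 1)" using *(1) by auto
      then have "d \<in> Suc ` {..<N}" by blast
      then show "k \<in> Suc ` {..<N} \<times> {0, 1}" using * by (simp add: de)
    qed
    show "\<forall>k\<in>Suc ` {..<N} \<times> {0, 1} - {k. k \<in> ?X \<and> real (?w k) \<le> x}. summatory red_count (x / real (?w k)) = 0"
    proof
      fix k assume "k \<in> Suc ` {..<N} \<times> {0, 1} - {k. k \<in> ?X \<and> real (?w k) \<le> x}"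
      then have "\<not> real (?w k) \<le> x" "?w k \<ge> 1" by (auto simp: Suc_le_eq)
      then have "x / real (?w k) < 1" by (simp add: divide_less_eq)
      then show "summatory red_count (x / real (?w k)) = 0" by (rule summatory_less_1)
    qed
  qed auto
  also have "\<dots> = (\<Sum>d\<in>Suc ` {..<N}. \<Sum>e\<in>{0, 1}. summatory red_count (x / real (?w (d, e))))"
    unfolding sum.cartesian_product by (rule sum.cong) auto
  also have "\<dots> = (\<Sum>d<N. prim_sum (x / real (Suc d) ^ 2))"
    by (subst sum.reindex) (auto simp: prim_sum_def mult.commute)
  finally have eq: "summatory hex_count x = (\<Sum>d<N. prim_sum (x / real (Suc d) ^ 2))" .
  show ?thesis unfolding eq
    by (rule sums_finite) (use N in \<open>auto simp: prim_sum_def summatory_less_1 not_less\<close>)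
qed

text \<open>Exactly the condition \<open>\<kappa> < 1\<close> for the inversion in
  \<open>prim_sum_asymp\<close>; it comes from the tail estimate for zeta at 2.\<close>

lemma pi_squared_bounds: "pi\<^sup>2 / 6 < 2"
proof -
  have "(\<lambda>n. 1 / real (Suc n) powr 2) sums zeta (2 :: real)"
    by (rule has_sum_imp_sums_Suc[OF real_zeta(1)]) simp
  then have "(\<lambda>n. 1 / (real n + 1)\<^sup>2) sums zeta (2 :: real)"
    by (simp add: powr_numeral add.commute)
  moreover have "(\<lambda>n. 1 / (real n + 1)\<^sup>2) sums (pi\<^sup>2 / 6)"
    using inverse_squares_sums by (simp add: add.commute)
  ultimately have z: "zeta (2 :: real) = pi\<^sup>2 / 6" by (rule sums_unique2)
  have "zeta (2 :: complex) = of_real (zeta 2)" using real_zeta(2)[of 2] by simp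
  then have "norm (complex_of_real (zeta 2 - 1)) \<le> 3 / 4" using norm_zeta_minus_1[of 2] by simp
  then have "\<bar>zeta (2 :: real) - 1\<bar> \<le> 3 / 4" by (simp only: norm_of_real)
  then show ?thesis unfolding z by linarith
qed

text \<open>The weights \<open>q k\<close> run through the squares from 4 on, so that
  \<open>1 + \<kappa>\<close> is \<zeta>(2); the term for 1 is \<open>f x\<close> itself.\<close>

lemma prim_sum_asymp:
  "((\<lambda>x. prim_sum x / x) \<longlongrightarrow> pi / (3 * sqrt 3) / (pi\<^sup>2 / 6)) at_top"
proof (rule contraction_asymp[where c = "\<lambda>_. 1" and q = "\<lambda>k. real (Suc (Suc k)) ^ 2" and \<kappa> = "pi\<^sup>2 / 6 - 1" and C = 2])
  show "\<bar>prim_sum x\<bar> \<le> 2 * x" if "x > 0" for x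
  proof -
    have "summatory red_count x \<le> x" "summatory red_count (x / 3) \<le> x / 3"
      using summatory_red_count_bounds(2)[of x] summatory_hex_count_le[of x]
        summatory_red_count_bounds(2)[of "x / 3"] summatory_hex_count_le[of "x / 3"] that by linarith+
    then show ?thesis
      using summatory_red_count_bounds(1)[of x] summatory_red_count_bounds(1)[of "x / 3"] that
      unfolding prim_sum_def by linarith
  qed
  have "(\<lambda>n. 1 / real (Suc n) ^ 2) sums (pi\<^sup>2 / 6)" using inverse_squares_sums by simp
  then have "(\<lambda>n. 1 / real (Suc (Suc n)) ^ 2) sums (pi\<^sup>2 / 6 - 1 / real (Suc 0) ^ 2)"
    by (subst sums_Suc_iff)  simp
  then show "(\<lambda>k. 1 / real (Suc (Suc k)) ^ 2) sums (pi\<^sup>2 / 6 - 1)" by simp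
  show "pi\<^sup>2 / 6 - 1 < 1" using pi_squared_bounds by simp
  have "prim_sum x + (\<Sum>k. 1 * prim_sum (x / real (Suc (Suc k)) ^ 2)) = summatory hex_count x" for x
  proof -
    have "(\<lambda>k. prim_sum (x / real (Suc (Suc k)) ^ 2)) sums (summatory hex_count x - prim_sum (x / real (Suc 0) ^ 2))"
      using summatory_hex_prim[of x] by (subst sums_Suc_iff[of "\<lambda>k. prim_sum (x / real (Suc k) ^ 2)"]) simp
    then show ?thesis by (simp add: sums_unique[symmetric])
  qed
  moreover have "pi / (3 * sqrt 3) / (pi\<^sup>2 / 6) * (1 + (pi\<^sup>2 / 6 - 1)) = pi / (3 * sqrt 3)" by simp
  ultimately show "((\<lambda>x. (prim_sum x + (\<Sum>k. 1 * prim_sum (x / real (Suc (Suc k)) ^ 2))) / x) \<longlongrightarrow>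
      pi / (3 * sqrt 3) / (pi\<^sup>2 / 6) * (1 + (pi\<^sup>2 / 6 - 1))) at_top"
    using summatory_hex_count_asymp by (simp only:)
qed auto

text \<open>This is L(1) / (\<zeta>(2) (1 + 1/3)) with L(1) = pi / (3 sqrt 3).\<close>

definition red_density :: real where
  "red_density = sqrt 3 / (2 * pi)"

lemma red_density_eq: "pi / (3 * sqrt 3) / (pi\<^sup>2 / 6) = red_density * (1 + 1 / 3)"
proof -
  have e: "pi / (3 * sqrt 3) = pi * sqrt 3 / 9" by (simp add: field_simps)
  have "pi / (3 * sqrt 3) / (pi\<^sup>2 / 6) = (pi * sqrt 3 / 9) * 6 / (pi * pi)"
    by (simp only: e power2_eq_square divide_divide_eq_right)
  also have "\<dots> = red_density * (1 + 1 / 3)"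
    by (simp add: red_density_def field_simps)
  finally show ?thesis .
qed

text \<open>The same inversion for the single shift by 3: with \<open>c\<close> vanishing after
  \<open>k = 0\<close>, \<open>\<kappa>\<close> is 1/3.\<close>

lemma red_count_asymp: "((\<lambda>x. summatory red_count x / x) \<longlongrightarrow> red_density) at_top"
proof (rule contraction_asymp[where c = "\<lambda>k. if k = 0 then 1 else 0" and q = "\<lambda>_. 3" and \<kappa> = "1 / 3" and C = 1])
  show "\<bar>summatory red_count x\<bar> \<le> 1 * x" if "x > 0" for x
    using summatory_red_count_bounds[of x] summatory_hex_count_le[of x] that by simp
  show "(\<lambda>k :: nat. (if k = 0 then 1 else 0) / 3 :: real) sums (1 / 3)"
    using sums_single[of 0 "\<lambda>_. 1 / 3 :: real"] by (simp add: if_distrib[of "\<lambda>x. x / 3"] cong: if_cong)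
  have "(\<Sum>k. (if k = 0 then 1 else 0) * summatory red_count (x / 3)) = summatory red_count (x / 3)" for x
    using sums_unique[OF sums_single[of 0 "\<lambda>_. summatory red_count (x / 3)"]]
    by (simp add: if_distrib[of "\<lambda>y. y * _"] cong: if_cong)
  then show "((\<lambda>x. (summatory red_count x + (\<Sum>k. (if k = 0 then 1 else 0) * summatory red_count (x / 3))) / x)
      \<longlongrightarrow> red_density * (1 + 1 / 3)) at_top"
    using prim_sum_asymp unfolding red_density_eq prim_sum_def by simp
qed auto

section \<open>Pairs \<open>(P, Q)\<close> with bounded product\<close>

definition PQ_le :: "real \<Rightarrow> (nat \<times> nat) set" where
  "PQ_le x = {k. k \<in> PQ_pairs \<and> real ((\<lambda>(P, Q). P * Q) k) \<le> x}"

definition QJ_le :: "real \<Rightarrow> (nat \<times> nat) set" where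
  "QJ_le x = {(Q, j). 1 \<le> j \<and> j < Q \<and> real ((Q + 2 * j) * Q) \<le> x}"

lemma sum_PQ_le: "(\<Sum>k\<in>PQ_le x. f k) = (\<Sum>(Q, j)\<in>QJ_le x. f (Q + 2 * j, Q))"
proof -
  have eq: "PQ_le x = (\<lambda>(Q, j). (Q + 2 * j, Q)) ` QJ_le x"
    unfolding PQ_le_def QJ_le_def PQ_pairs_Sigma by auto
  show ?thesis
    unfolding eq by (subst sum.reindex[OF inj_PQ_Sigma]) (simp add: case_prod_beta)
qed

text \<open>As \<open>P * Q\<close> lies between \<open>Q\<^sup>2\<close> and
  \<open>3 * Q\<^sup>2\<close>, the region is enclosed between the full triangles for
  \<open>Q \<le> sqrt (x / 3)\<close> and \<open>Q \<le> sqrt x\<close>, whose logarithmic sizes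
  differ only by a constant.\<close>

lemma QJ_le_subset:
  assumes "x \<ge> 0"
  shows "QJ_le x \<subseteq> (SIGMA Q:{1..nat \<lfloor>sqrt x\<rfloor>}. {1..<Q})"
proof
  fix p assume "p \<in> QJ_le x"
  then obtain Q j where p: "p = (Q, j)" "1 \<le> j" "j < Q" "real ((Q + 2 * j) * Q) \<le> x" by (auto simp: QJ_le_def)
  have "real (Q * Q) \<le> real ((Q + 2 * j) * Q)" by (intro of_nat_mono mult_right_mono) auto
  then have "real (Q * Q) \<le> x" using p(4) by (rule order_trans)
  then have "(real Q)\<^sup>2 \<le> x" by (simp add: power2_eq_square)
  then have "real Q \<le> sqrt x" by (rule real_le_rsqrt)
  then have "Q \<le> nat \<lfloor>sqrt x\<rfloor>" by (rule le_nat_floor)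
  then show "p \<in> (SIGMA Q:{1..nat \<lfloor>sqrt x\<rfloor>}. {1..<Q})" using p by auto
qed

lemma QJ_le_superset:
  assumes "x \<ge> 0"
  shows "(SIGMA Q:{1..nat \<lfloor>sqrt (x / 3)\<rfloor>}. {1..<Q}) \<subseteq> QJ_le x"
proof
  fix p assume "p \<in> (SIGMA Q:{1..nat \<lfloor>sqrt (x / 3)\<rfloor>}. {1..<Q})"
  then obtain Q j where p: "p = (Q, j)" "1 \<le> j" "j < Q" "Q \<le> nat \<lfloor>sqrt (x / 3)\<rfloor>" by auto
  have "real Q \<le> sqrt (x / 3)" using p(4) assms by (metis le_floor_iff le_nat_iff of_int_of_nat_eq of_nat_0_le_iff order_trans real_sqrt_ge_zero zero_le_floor divide_nonneg_nonneg zero_le_numeral nat_0_le of_nat_le_iff)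
  then have "(real Q)\<^sup>2 \<le> x / 3" using assms by (metis of_nat_0_le_iff power2_le_iff_abs_le abs_of_nat real_sqrt_pow2 real_sqrt_ge_zero power_mono divide_nonneg_nonneg zero_le_numeral)
  moreover have "real ((Q + 2 * j) * Q) \<le> real (3 * Q * Q)" using p by (intro of_nat_mono mult_right_mono) auto
  moreover have "real (3 * Q * Q) = 3 * (real Q)\<^sup>2" by (simp add: power2_eq_square)
  ultimately have "real ((Q + 2 * j) * Q) \<le> x" by linarith
  then show "p \<in> QJ_le x" using p by (simp add: QJ_le_def)
qed

lemma ln_diff_bounds:
  fixes x h :: real
  assumes "x > 0" "h \<ge> 0"
  shows "ln (x + h) - ln x \<le> h / x" "h / (x + h) \<le> ln (x + h) - ln x"
proof -
  have "ln ((x + h) / x) \<le> (x + h) / x - 1" using assms by (intro ln_le_minus_one) auto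
  then show "ln (x + h) - ln x \<le> h / x" using assms by (simp add: ln_div field_simps)
  have "ln (x / (x + h)) \<le> x / (x + h) - 1" using assms by (intro ln_le_minus_one) auto
  moreover have "x / (x + h) - 1 = - (h / (x + h))" using assms by (simp add: field_simps)
  ultimately show "h / (x + h) \<le> ln (x + h) - ln x" using assms by (simp add: ln_div)
qed

definition inner_sum :: "nat \<Rightarrow> real" where
  "inner_sum Q = (\<Sum>j\<in>{1..<Q}. 1 / real (Q + 2 * j))"

text \<open>Comparison in steps of two with half the integral of 1/x over \<open>[Q, 3 Q]\<close>,
  which is \<open>ln 3 / 2\<close>; the lower bound loses the term \<open>j = 0\<close>.\<close>

lemma inner_sum_bounds:
  assumes Q: "Q \<ge> 1"
  shows "inner_sum Q \<le> ln 3 / 2" "ln 3 / 2 - 1 / real Q \<le> inner_sum Q"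
proof -
  define g where "g = (\<lambda>j. ln (real (Q + 2 * j)))"
  have "(\<Sum>j<Q. g (Suc j) - g j) = g Q - g 0" by (rule sum_lessThan_telescope)
  also have "\<dots> = ln 3" using Q by (simp add: g_def ln_mult)
  finally have tel: "(\<Sum>j<Q. g (Suc j) - g j) = ln 3" .
  have b: "g (Suc j) - g j \<le> 2 / real (Q + 2 * j)" "2 / real (Q + 2 * Suc j) \<le> g (Suc j) - g j" for j
  proof -
    have e: "real (Q + 2 * Suc j) = real (Q + 2 * j) + 2" by simp
    show "g (Suc j) - g j \<le> 2 / real (Q + 2 * j)" "2 / real (Q + 2 * Suc j) \<le> g (Suc j) - g j"
      unfolding g_def e using Q by (auto intro!: ln_diff_bounds simp del: of_nat_add)
  qed
  have "ln 3 \<le> (\<Sum>j<Q. 2 * (1 / real (Q + 2 * j)))"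
    unfolding tel[symmetric] using b(1) by (intro sum_mono) simp
  also have "\<dots> = 2 * (1 / real Q + inner_sum Q)"
    using Q unfolding sum_distrib_left[symmetric] inner_sum_def
    by (simp add: lessThan_atLeast0 sum.atLeast_Suc_lessThan)
  finally show "ln 3 / 2 - 1 / real Q \<le> inner_sum Q" by simp
  have "(\<Sum>j<Q. 2 * (1 / real (Q + 2 * Suc j))) \<le> ln 3"
    unfolding tel[symmetric] using b(2) by (intro sum_mono) simp
  moreover have "(\<Sum>j<Q. 1 / real (Q + 2 * Suc j)) = (\<Sum>j\<in>{1..<Suc Q}. 1 / real (Q + 2 * j))"
    by (rule sum.reindex_bij_witness[of _ "\<lambda>j. j - 1" Suc]) auto
  moreover have "(\<Sum>j\<in>{1..<Suc Q}. 1 / real (Q + 2 * j)) = inner_sum Q + 1 / real (3 * Q)"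
    using Q unfolding inner_sum_def by (simp add: sum.atLeastLessThan_Suc)
  ultimately have "2 * (inner_sum Q + 1 / real (3 * Q)) \<le> ln 3"
    by (simp only: sum_distrib_left[symmetric])
  moreover have "2 * inner_sum Q \<le> 2 * (inner_sum Q + 1 / real (3 * Q))" by simp
  ultimately have "2 * inner_sum Q \<le> ln 3" by (rule order_trans[rotated])
  then show "inner_sum Q \<le> ln 3 / 2" by simp
qed

definition recip_sum :: "real \<Rightarrow> real" where
  "recip_sum x = (\<Sum>(P, Q)\<in>PQ_le x. 1 / real (P * Q))"

lemma recip_sum_QJ: "recip_sum x = (\<Sum>(Q, j)\<in>QJ_le x. 1 / real Q * (1 / real (Q + 2 * j)))"
proof -
  have "1 / real ((Q + 2 * j) * Q) = 1 / real Q * (1 / real (Q + 2 * j))" for Q j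
    unfolding of_nat_mult by (simp only: times_divide_times_eq mult_1 mult.commute)
  then show ?thesis unfolding recip_sum_def sum_PQ_le by (simp only: prod.case)
qed

lemma harm_mult: "(\<Sum>Q = 1..N. 1 / real Q * c) = c * harm N"
proof -
  have "(\<Sum>Q = 1..N. 1 / real Q * c) = (\<Sum>Q = 1..N. 1 / real Q) * c" by (rule sum_distrib_right[symmetric])
  also have "(\<Sum>Q = 1..N. 1 / real Q) = harm N" by (simp add: harm_def inverse_eq_divide)
  finally show ?thesis by simp
qed

lemma sum_Sigma_inner:
  "(\<Sum>(Q, j)\<in>(SIGMA Q:{1..N}. {1..<Q}). 1 / real Q * (1 / real (Q + 2 * j))) = (\<Sum>Q = 1..N. 1 / real Q * inner_sum Q)"
  unfolding inner_sum_def sum_distrib_left by (rule sum.Sigma[symmetric]) auto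

lemma harm_le_ln: "N \<ge> 1 \<Longrightarrow> harm N \<le> ln (real N) + (1 :: real)"
proof (induction N rule: nat_induct_at_least)
  case base
  then show ?case by (simp add: harm_def)
next
  case (Suc N)
  have "1 / (real N + 1) \<le> ln (real N + 1) - ln (real N)"
    using Suc.hyps by (intro ln_diff_bounds) auto
  then show ?case using Suc.IH by (simp add: harm_Suc inverse_eq_divide add.commute)
qed

lemma recip_sum_upper:
  assumes x: "x \<ge> 1"
  shows "recip_sum x \<le> ln 3 / 2 * (ln x / 2 + 1)"
proof -
  define N where "N = nat \<lfloor>sqrt x\<rfloor>"
  have N: "N \<ge> 1" "real N \<le> sqrt x"
    using x by (auto simp: N_def le_nat_floor intro: of_nat_floor)
  have "recip_sum x \<le> (\<Sum>(Q, j)\<in>(SIGMA Q:{1..N}. {1..<Q}). 1 / real Q * (1 / real (Q + 2 * j)))"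
    unfolding recip_sum_QJ N_def using QJ_le_subset[of x] x by (intro sum_mono2) auto
  also have "\<dots> \<le> (\<Sum>Q = 1..N. 1 / real Q * (ln 3 / 2))"
    unfolding sum_Sigma_inner by (intro sum_mono mult_left_mono inner_sum_bounds) auto
  also have "\<dots> = ln 3 / 2 * harm N"
    by (simp only: harm_mult)
  also have "\<dots> \<le> ln 3 / 2 * (ln (real N) + 1)"
    using N harm_le_ln[of N] by (intro mult_left_mono) auto
  also have "\<dots> \<le> ln 3 / 2 * (ln (sqrt x) + 1)"
    using N by (intro mult_left_mono add_right_mono ln_mono) auto
  also have "ln (sqrt x) = ln x / 2" using x by (simp add: ln_sqrt)
  finally show ?thesis .
qed

lemma recip_sum_lower:
  assumes x: "x > 0"
  shows "ln 3 / 2 * (ln x / 2 - ln 3 / 2) - 2 \<le> recip_sum x"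
proof -
  define N where "N = nat \<lfloor>sqrt (x / 3)\<rfloor>"
  have N: "sqrt (x / 3) \<le> real N + 1" unfolding N_def using x by linarith
  \<comment> \<open>The errors \<open>1 / real Q\<close> of the inner sums, weighted by another
    \<open>1 / real Q\<close>, stay bounded in total.\<close>
  have "(\<Sum>Q = 1..N. 1 / real Q ^ 2) \<le> 2"
  proof -
    have "(\<Sum>Q = 1..N. 1 / real Q ^ 2) = (\<Sum>n<N. 1 / real (Suc n) ^ 2)"
      by (rule sum.reindex_bij_witness[of _ Suc "\<lambda>j. j - 1"]) auto
    also have "\<dots> \<le> pi\<^sup>2 / 6"
      using inverse_squares_sums sum_le_suminf[of "\<lambda>n. 1 / real (Suc n) ^ 2" "{..<N}"]
      by (simp add: sums_iff)
    finally show ?thesis using pi_squared_bounds by linarith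
  qed
  have "ln 3 / 2 * (ln x / 2 - ln 3 / 2) = ln 3 / 2 * ln (sqrt (x / 3))"
    using x by (simp add: ln_sqrt ln_div field_simps)
  also have "\<dots> \<le> ln 3 / 2 * harm N"
  proof (rule mult_left_mono)
    have "ln (sqrt (x / 3)) \<le> ln (real N + 1)" using x N by (intro ln_mono) auto
    also have "\<dots> \<le> harm N" by (rule ln_le_harm)
    finally show "ln (sqrt (x / 3)) \<le> harm N" .
  qed simp
  also have "\<dots> = (\<Sum>Q = 1..N. 1 / real Q * (ln 3 / 2))"
    by (simp only: harm_mult)
  also have "\<dots> = (\<Sum>Q = 1..N. 1 / real Q * (ln 3 / 2 - 1 / real Q)) + (\<Sum>Q = 1..N. 1 / real Q ^ 2)"
    unfolding sum.distrib[symmetric] by (rule sum.cong) (simp_all add: right_diff_distrib power2_eq_square)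
  also have "\<dots> \<le> (\<Sum>Q = 1..N. 1 / real Q * inner_sum Q) + 2"
    by (intro add_mono sum_mono mult_left_mono inner_sum_bounds \<open>(\<Sum>Q = 1..N. 1 / real Q ^ 2) \<le> 2\<close>) auto
  also have "(\<Sum>Q = 1..N. 1 / real Q * inner_sum Q) \<le> recip_sum x"
    unfolding recip_sum_QJ sum_Sigma_inner[symmetric] N_def
    using QJ_le_superset[of x] x finite_subset[OF QJ_le_subset[of x]] by (intro sum_mono2) auto
  finally show ?thesis by simp
qed

text \<open>\<open>ln 3 / 2\<close> comes from the inner sums, and another factor 1/2 arises because
  \<open>Q\<close> runs up to the order of \<open>sqrt x\<close> only.\<close>

lemma recip_sum_asymp: "((\<lambda>x. recip_sum x / ln x) \<longlongrightarrow> ln 3 / 4) at_top"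
proof (rule tendsto_sandwich)
  have "\<forall>\<^sub>F x in at_top. x > (1 :: real)" by (rule eventually_gt_at_top)
  then show "\<forall>\<^sub>F x in at_top. (ln 3 / 2 * (ln x / 2 - ln 3 / 2) - 2) / ln x \<le> recip_sum x / ln x"
    by eventually_elim (intro divide_right_mono recip_sum_lower; simp)
  show "\<forall>\<^sub>F x in at_top. recip_sum x / ln x \<le> ln 3 / 2 * (ln x / 2 + 1) / ln x"
    using \<open>\<forall>\<^sub>F x in at_top. x > (1 :: real)\<close> by eventually_elim (intro divide_right_mono recip_sum_upper; simp)
  have "((\<lambda>x. (c / 2 * (ln x / 2 - c / 2) - 2) / ln x) \<longlongrightarrow> c / 4) at_top" for c :: real by real_asymp
  then show "((\<lambda>x :: real. (ln 3 / 2 * (ln x / 2 - ln 3 / 2) - 2) / ln x) \<longlongrightarrow> ln 3 / 4) at_top" .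
  have "((\<lambda>x. c / 2 * (ln x / 2 + 1) / ln x) \<longlongrightarrow> c / 4) at_top" for c :: real by real_asymp
  then show "((\<lambda>x :: real. ln 3 / 2 * (ln x / 2 + 1) / ln x) \<longlongrightarrow> ln 3 / 4) at_top" .
qed

text \<open>A linear bound without logarithm, so that a constant error for each pair disappears
  against \<open>x * ln x\<close>.\<close>

lemma card_PQ_le:
  assumes "x \<ge> 0"
  shows "real (card (PQ_le x)) \<le> x"
proof -
  define N where "N = nat \<lfloor>sqrt x\<rfloor>"
  have "card (PQ_le x) = card (QJ_le x)"
    using sum_PQ_le[of "\<lambda>_. 1 :: nat" x] by (simp add: case_prod_beta)
  also have "\<dots> \<le> card ({1..N} \<times> {1..N})"
    using QJ_le_subset[OF assms] unfolding N_def by (intro card_mono) auto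
  also have "\<dots> = N * N" by simp
  finally have "real (card (PQ_le x)) \<le> real N * real N" by (simp flip: of_nat_mult)
  also have "\<dots> \<le> sqrt x * sqrt x" unfolding N_def using assms by (intro mult_mono of_nat_floor) auto
  finally show ?thesis using assms by simp
qed

lemma A_tri_eq:
  "A_tri x = summatory hex_count x
    + 3 * (\<Sum>k\<in>PQ_le x. summatory red_count (x / real ((\<lambda>(P, Q). P * Q) k)))"
proof -
  define c where "c = (\<lambda>n. \<Sum>(k, m)\<in>conv_pairs PQ_pairs (\<lambda>(P, Q). P * Q) n. 3 * red_count m)"
  have a: "real (a_tri n) = hex_count n + c n" if "n \<ge> 1" for n
  proof -
    have "real (6 * a_tri n) = 6 * (hex_count n + c n)"
      using a_tri_eq[of n] that
      by (simp add: c_def hex_count_def red_count_def case_prod_beta sum_distrib_left distrib_left)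
    then show ?thesis by simp
  qed
  have c: "c n = (\<Sum>(k, m)\<in>conv_pairs PQ_pairs (\<lambda>(P, Q). P * Q) n. 3 * red_count m)" for n
    by (simp add: c_def)
  have "A_tri x = summatory hex_count x + summatory c x"
    unfolding A_tri_def summatory_def sum.distrib[symmetric] using a by (intro sum.cong) auto
  also have "summatory c x = (\<Sum>k\<in>PQ_le x. 3 * summatory red_count (x / real ((\<lambda>(P, Q). P * Q) k)))"
    unfolding PQ_le_def by (rule summatory_conv[OF _ PQ_pairs_finite c]) (auto simp: PQ_pairs_def Suc_le_eq)
  finally show ?thesis by (simp only: sum_distrib_left)
qed

text \<open>The counting function of reduced elements is replaced by its linear approximation for
  every pair. The main terms add up to \<open>red_density * x * recip_sum x\<close>; the total error
  is at most \<open>\<delta> * x * recip_sum x\<close> plus a constant for each pair.\<close>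

lemma A_tri_asymp: "((\<lambda>x. A_tri x / (x * ln x)) \<longlongrightarrow> 3 * red_density * (ln 3 / 4)) at_top"
proof -
  define w where "w = (\<lambda>k :: nat \<times> nat. real ((\<lambda>(P, Q). P * Q) k))"
  define S where "S = (\<lambda>x. \<Sum>k\<in>PQ_le x. summatory red_count (x / w k))"
  have gam0: "red_density \<ge> 0" by (simp add: red_density_def)
  have S: "((\<lambda>x. S x / (x * ln x)) \<longlongrightarrow> red_density * (ln 3 / 4)) at_top"
  proof -
    have "((\<lambda>x. S x / (x * ln x) - red_density * (recip_sum x / ln x)) \<longlongrightarrow> 0) at_top"
    proof (rule tendstoI)
      fix \<epsilon> :: real assume \<epsilon>: "\<epsilon> > 0"
      define \<delta> where "\<delta> = \<epsilon> / 2"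
      have \<delta>: "\<delta> > 0" using \<epsilon> by (simp add: \<delta>_def)
      have "\<forall>\<^sub>F y in at_top. dist (summatory red_count y / y) red_density < \<delta>"
        using red_count_asymp \<delta> by (rule tendstoD)
      then obtain Y0 where Y0: "\<And>y. y \<ge> Y0 \<Longrightarrow> dist (summatory red_count y / y) red_density < \<delta>"
        unfolding eventually_at_top_linorder by blast
      define Y where "Y = max Y0 1"
      define C where "C = (1 + red_density) * Y"
      \<comment> \<open>The density only controls large \<open>y\<close>; for \<open>y < Y\<close>
        everything is absorbed in the constant \<open>C\<close>, which makes the estimate valid for
        all pairs at once.\<close>
      have err: "\<bar>summatory red_count y - red_density * y\<bar> \<le> \<delta> * y + C" if y: "y > 0" for y
      proof (cases "y \<ge> Y")
        case True
        then have "\<bar>summatory red_count y / y - red_density\<bar> < \<delta>" using Y0[of y] by (simp add: Y_def dist_real_def)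
        moreover have "summatory red_count y - red_density * y = (summatory red_count y / y - red_density) * y"
          using y by (simp add: left_diff_distrib)
        ultimately have "\<bar>summatory red_count y - red_density * y\<bar> \<le> \<delta> * y"
          using y by (simp add: abs_mult mult_right_mono)
        moreover have "C \<ge> 0" using gam0 by (simp add: C_def Y_def)
        ultimately show ?thesis by simp
      next
        case False
        have "\<bar>summatory red_count y - red_density * y\<bar> \<le> summatory red_count y + red_density * y"
          using summatory_red_count_bounds(1)[of y] gam0 y mult_nonneg_nonneg[of red_density y] by linarith
        also have "\<dots> \<le> (1 + red_density) * y"
          using summatory_red_count_bounds(2)[of y] summatory_hex_count_le[of y] y by (simp add: distrib_right)
        also have "\<dots> \<le> C" unfolding C_def using False gam0 by (intro mult_left_mono) auto
        also have "C \<le> \<delta> * y + C" using \<delta> y by simp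
        finally show ?thesis .
      qed
      have "((\<lambda>x. \<delta> * (recip_sum x / ln x) + C / ln x) \<longlongrightarrow> \<delta> * (ln 3 / 4) + 0) at_top"
      proof (intro tendsto_add tendsto_mult tendsto_const recip_sum_asymp)
        show "((\<lambda>x. C / ln x) \<longlongrightarrow> 0) at_top" by real_asymp
      qed
      moreover have "\<delta> * (ln 3 / 4) + 0 < \<epsilon>"
      proof -
        have "ln (3 :: real) \<le> 3 - 1" by (rule ln_le_minus_one) simp
        then have "\<delta> * (ln 3 / 4) \<le> \<delta> * 1" using \<delta> by (intro mult_left_mono) auto
        then show ?thesis using \<epsilon> by (simp add: \<delta>_def)
      qed
      ultimately have "\<forall>\<^sub>F x in at_top. \<delta> * (recip_sum x / ln x) + C / ln x < \<epsilon>" by (rule order_tendstoD)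
      moreover have "\<forall>\<^sub>F x in at_top. x > (1 :: real)" by (rule eventually_gt_at_top)
      ultimately show "\<forall>\<^sub>F x in at_top. dist (S x / (x * ln x) - red_density * (recip_sum x / ln x)) 0 < \<epsilon>"
      proof eventually_elim
        case (elim x)
        have lx: "ln x > 0" using elim by simp
        have wpos: "w k > 0" if "k \<in> PQ_le x" for k
          using that by (auto simp: w_def PQ_le_def PQ_pairs_def)
        have rs: "recip_sum x = (\<Sum>k\<in>PQ_le x. 1 / w k)"
          by (simp add: recip_sum_def w_def case_prod_beta)
        have "\<bar>S x - red_density * x * recip_sum x\<bar> \<le> (\<Sum>k\<in>PQ_le x. \<bar>summatory red_count (x / w k) - red_density * (x / w k)\<bar>)"
        proof -
          have "S x - red_density * x * recip_sum x = (\<Sum>k\<in>PQ_le x. summatory red_count (x / w k) - red_density * (x / w k))"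
            unfolding S_def rs sum_distrib_left sum_subtractf[symmetric] by simp
          then show ?thesis by (simp only: sum_abs)
        qed
        also have "\<dots> \<le> (\<Sum>k\<in>PQ_le x. \<delta> * (x / w k) + C)"
          using wpos elim by (intro sum_mono err) auto
        also have "\<dots> = \<delta> * x * recip_sum x + real (card (PQ_le x)) * C"
          unfolding rs by (simp add: sum.distrib sum_distrib_left)
        also have "\<dots> \<le> \<delta> * x * recip_sum x + x * C"
          using card_PQ_le[of x] elim gam0 by (intro add_left_mono mult_right_mono) (auto simp: C_def Y_def)
        also have "\<dots> = (\<delta> * (recip_sum x / ln x) + C / ln x) * (x * ln x)"
          using lx by (simp add: field_simps)
        also have "\<dots> < \<epsilon> * (x * ln x)" using elim lx by (intro mult_strict_right_mono) auto
        finally have "\<bar>S x - red_density * x * recip_sum x\<bar> / (x * ln x) < \<epsilon>"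
          using elim lx by (subst pos_divide_less_eq) auto
        moreover have "S x / (x * ln x) - red_density * (recip_sum x / ln x) = (S x - red_density * x * recip_sum x) / (x * ln x)"
          using elim lx by (simp add: diff_divide_distrib)
        ultimately show ?case using elim lx by (simp add: dist_real_def abs_mult)
      qed
    qed
    moreover have "((\<lambda>x. red_density * (recip_sum x / ln x)) \<longlongrightarrow> red_density * (ln 3 / 4)) at_top"
      by (intro tendsto_mult tendsto_const recip_sum_asymp)
    ultimately have "((\<lambda>x. (S x / (x * ln x) - red_density * (recip_sum x / ln x)) + red_density * (recip_sum x / ln x)) \<longlongrightarrow> 0 + red_density * (ln 3 / 4)) at_top"
      by (rule tendsto_add)
    then show ?thesis by simp
  qed
  \<comment> \<open>The ideals have only linear growth and do not contribute to the leading
    term.\<close>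
  have "((\<lambda>x. summatory hex_count x / x * (1 / ln x)) \<longlongrightarrow> pi / (3 * sqrt 3) * 0) at_top"
    by (intro tendsto_mult summatory_hex_count_asymp) real_asymp
  then have "((\<lambda>x. summatory hex_count x / x * (1 / ln x) + 3 * (S x / (x * ln x))) \<longlongrightarrow>
      pi / (3 * sqrt 3) * 0 + 3 * (red_density * (ln 3 / 4))) at_top"
    by (rule tendsto_add[OF _ tendsto_mult[OF tendsto_const S]])
  moreover have "A_tri x / (x * ln x) = summatory hex_count x / x * (1 / ln x) + 3 * (S x / (x * ln x))" for x
    unfolding A_tri_eq S_def w_def by (simp add: add_divide_distrib)
  ultimately have "((\<lambda>x. A_tri x / (x * ln x)) \<longlongrightarrow> pi / (3 * sqrt 3) * 0 + 3 * (red_density * (ln 3 / 4))) at_top"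
    by (simp only:)
  then show ?thesis by (simp add: mult.assoc)
qed

lemma A_tri_smallo:
  "(\<lambda>x. A_tri x - 3 * sqrt 3 * ln 3 / (8 * pi) * (x * ln x)) \<in> o[at_top](\<lambda>x. x * ln x)"
proof (rule smalloI_tendsto)
  have ev: "\<forall>\<^sub>F x in at_top. x > (1 :: real)" by (rule eventually_gt_at_top)
  have c: "3 * red_density * (ln 3 / 4) = 3 * sqrt 3 * ln 3 / (8 * pi)"
    by (simp add: red_density_def)
  have "((\<lambda>x. A_tri x / (x * ln x) - 3 * sqrt 3 * ln 3 / (8 * pi)) \<longlongrightarrow> 0) at_top"
    using LIM_zero[OF A_tri_asymp] unfolding c .
  moreover have "\<forall>\<^sub>F x in at_top. A_tri x / (x * ln x) - 3 * sqrt 3 * ln 3 / (8 * pi)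
      = (A_tri x - 3 * sqrt 3 * ln 3 / (8 * pi) * (x * ln x)) / (x * ln x)"
    using ev by eventually_elim (simp add: diff_divide_distrib)
  ultimately show "((\<lambda>x. (A_tri x - 3 * sqrt 3 * ln 3 / (8 * pi) * (x * ln x)) / (x * ln x)) \<longlongrightarrow> 0) at_top"
    by (rule Lim_transform_eventually)
  show "\<forall>\<^sub>F x in at_top. x * ln x \<noteq> (0 :: real)"
    using ev by eventually_elim simp
qed

text \<open>The upper bound for all \<open>s > 1\<close> carries the additional
  \<open>Phi_tri s\<close>, the contribution of the ideals, which \<open>D_tri\<close> does not
  account for. Near 1, here up to 3/2, the excess of the integrals over the sums outweighs
  it.\<close>

theorem theorem4p1:
  shows "(\<forall>s::complex. Re s > 1 \<longrightarrow>
            (\<lambda>n. of_nat (a_tri n) / of_nat n powr s) summable_on {1..} \<and>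
            Phi_wr s = Phi_tri s + Phi_wr_even s + Phi_wr_odd s) \<and>
         (\<forall>s::real. s > 1 \<longrightarrow>
            D_tri s - E_tri s < Phi_wr s \<and> Phi_wr s < D_tri s + Phi_tri s) \<and>
         (\<forall>s::real. 1 < s \<and> s \<le> 3/2 \<longrightarrow> Phi_wr s < D_tri s) \<and>
         (\<exists>F. F meromorphic_on {s. Re s > 1/2} \<and>
            (\<forall>s. Re s > 1 \<longrightarrow> F s = Phi_wr s) \<and>
            is_pole F 1 \<and> zorder F 1 = -2 \<and>
            (\<forall>s. Re s \<ge> 1 \<and> s \<noteq> 1 \<longrightarrow> \<not> is_pole F s)) \<and>
         (\<lambda>x. A_tri x - 3 * sqrt 3 * ln 3 / (8 * pi) * (x * ln x)) \<in> o[at_top](\<lambda>x. x * ln x)"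
proof (intro conjI allI impI)
  fix s :: complex assume s: "Re s > 1"
  show "(\<lambda>n. of_nat (a_tri n) / of_nat n powr s) summable_on {1..}"
    using Phi_wr_T(1)[OF s] unfolding dir_abs_def by (rule Infinite_Sum.abs_summable_summable)
  show "Phi_wr s = Phi_tri s + Phi_wr_even s + Phi_wr_odd s" using s by (rule Phi_wr_identity)
next
  fix s :: real assume "s > 1"
  then show "D_tri s - E_tri s < Phi_wr s" "Phi_wr s < D_tri s + Phi_tri s"
    by (rule Phi_wr_bounds)+
next
  fix s :: real assume "1 < s \<and> s \<le> 3 / 2"
  then show "Phi_wr s < D_tri s" using Phi_wr_bounds(3) by blast
next
  show "\<exists>F. F meromorphic_on {s. Re s > 1/2} \<and> (\<forall>s. Re s > 1 \<longrightarrow> F s = Phi_wr s) \<and>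
      is_pole F 1 \<and> zorder F 1 = -2 \<and> (\<forall>s. Re s \<ge> 1 \<and> s \<noteq> 1 \<longrightarrow> \<not> is_pole F s)"
    using Phi_cont_meromorphic Phi_cont_eq Phi_cont_pole Phi_cont_not_pole by blast
qed (rule A_tri_smallo)


end
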